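(* Let $M$ be a matroid of rank $k$ on a ground set $E=[n]$ of size $n$, with $0<k<n$, and let $\Delta=\Delta(M)$ be its independence complex. Let $S=\mathbb{L}[x_1,\dots,x_n]$ be a polynomial ring over a field $\mathbb{L}$, fix an integer $N\ge n-k$, let $R=\mathbb{L}[y_0,\dots,y_N]$ be a polynomial ring over $\mathbb{L}$, and let $f_1,\dots,f_n\in R$ be homogeneous polynomials of degrees $\delta_1,\dots,\delta_n$, respectively, such that any subset of at most $n-k+1$ of them forms a regular sequence in $R$. Let $\phi:S\to R$ be the $\mathbb{L}$-algebra homomorphism with $\phi(x_i)=f_i$, and let $\phi_*(I_\Delta)$ be the ideal of $R$ generated by $\phi(I_\Delta)$. Then: (a) $\widehat{\rho}(\phi_*(I_\Delta))\le\rho(\phi_*(I_\Delta))\le\rho(I_\Delta)<n-k$. (b) If $f_1,\dots,f_n$ all have the same degree, then \[ \frac{(n-k)d_1(M)}{n}\le\max\left\{\frac{rd_1(M)}{d_r(M)} : r\in[n-k]\right\}\le\widehat{\rho}(\phi_*(I_\Delta)). \]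
   Context: $[m]=\{1,\dots,m\}$. The independence complex $\Delta(M)$ is the simplicial complex on $E$ whose faces are the independent sets of $M$. $I_\Delta=\langle\prod_{i\in C}x_i: C\text{ a circuit of }M\rangle\subset S$ is the Stanley-Reisner ideal of $\Delta$. For $r\in[n-k]$, $d_r(M)=\min\{|U|: U\subseteq E,\ |U|-\mathrm{rk}_M(U)=r\}$ is the $r$-th generalized Hamming weight of $M$, where $\mathrm{rk}_M$ is the rank function of $M$. For a homogeneous ideal $J$ of a polynomial ring $A$, $J^{(s)}=\bigcap_{P\in\mathrm{Ass}(A/J)}(J^sA_P\cap A)$ is the $s$-th symbolic power. The resurgence of $J$ is $\rho(J)=\sup\{\frac{s}{r}: s,r\ge1,\ J^{(s)}\not\subseteq J^r\}$, and the asymptotic resurgence of $J$ is $\widehat{\rho}(J)=\sup\{\frac{s}{r}: s,r\ge1,\ J^{(st)}\not\subseteq J^{rt}\text{ for all }t\gg0\}$.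
   Formalization: In (a), the strict bound ρ(I_Δ) < n−k is claimed only when n−k ≠ 1; in general ρ(I_Δ) ≤ n−k. For n−k = 1 the ideal I_Δ is principal and ρ(I_Δ) = 1 = n−k, so the strict inequality fails. *)

theory Defs
  imports
    Complex_Main
    "HOL-Library.Poly_Mapping"
    "HOL-Library.Extended_Real"
    "HOL-Computational_Algebra.Fraction_Field"
    "HOL-Algebra.Ideal_Product"
    "HOL-Algebra.QuotRing"
    "HOL-Algebra.Algebraic_Closure_Type"
begin

section \<open>Matroids\<close>

text \<open>A matroid is given by its ground set \<open>E\<close> and its family \<open>\<Delta>\<close> of independent sets.  Its
  independence complex, as a set of faces, is \<open>\<Delta>\<close> itself.\<close>

locale matroid =
  fixes E :: "'v set" and \<Delta> :: "'v set set"
  assumes finite_ground: "finite E"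
    and indep_subset_ground: "F \<in> \<Delta> \<Longrightarrow> F \<subseteq> E"
    and empty_indep: "{} \<in> \<Delta>"
    and indep_subset: "F \<in> \<Delta> \<Longrightarrow> G \<subseteq> F \<Longrightarrow> G \<in> \<Delta>"
    and augmentation: "F \<in> \<Delta> \<Longrightarrow> G \<in> \<Delta> \<Longrightarrow> card F < card G \<Longrightarrow> \<exists>g\<in>G - F. insert g F \<in> \<Delta>"

definition matroid_rank :: "'v set set \<Rightarrow> 'v set \<Rightarrow> nat" where
  "matroid_rank \<Delta> U = Max (card ` {F \<in> \<Delta>. F \<subseteq> U})"

definition circuits :: "'v set \<Rightarrow> 'v set set \<Rightarrow> 'v set set" where
  "circuits E \<Delta> = {C. C \<subseteq> E \<and> C \<notin> \<Delta> \<and> (\<forall>D. D \<subset> C \<longrightarrow> D \<in> \<Delta>)}"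

text \<open>The subtraction on \<open>nat\<close> does not truncate, since the rank of \<open>U\<close> is at most \<open>card U\<close>.  For
  \<open>r \<le> card E - matroid_rank \<Delta> E\<close> the minimum is over a nonempty finite set.\<close>

definition hamming_weight :: "'v set \<Rightarrow> 'v set set \<Rightarrow> nat \<Rightarrow> nat" where
  "hamming_weight E \<Delta> r = Min {card U | U. U \<subseteq> E \<and> card U - matroid_rank \<Delta> U = r}"


section \<open>Polynomial rings\<close>

text \<open>Polynomials in the variables \<open>Var i\<close>, \<open>i :: nat\<close>; a monomial is its finitely supported exponent
  vector.  The polynomial ring in the variables indexed by \<open>V\<close> is a subring of this type.\<close>

type_synonym 'l mpoly = "(nat \<Rightarrow>\<^sub>0 nat) \<Rightarrow>\<^sub>0 'l"

definition Const :: "'l::field \<Rightarrow> 'l mpoly" where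
  "Const c = Poly_Mapping.single 0 c"

definition Var :: "nat \<Rightarrow> 'l::field mpoly" where
  "Var i = Poly_Mapping.single (Poly_Mapping.single i 1) 1"

definition polynomial_ring :: "nat set \<Rightarrow> 'l::field mpoly ring" where
  "polynomial_ring V = ring_of_type_algebra\<lparr>carrier :=
     {p. \<forall>m \<in> Poly_Mapping.keys p. Poly_Mapping.keys m \<subseteq> V}\<rparr>"

definition homogeneous_of_degree :: "nat \<Rightarrow> 'l::field mpoly \<Rightarrow> bool" where
  "homogeneous_of_degree d p \<longleftrightarrow>
     (\<forall>m \<in> Poly_Mapping.keys p. (\<Sum>i\<in>Poly_Mapping.keys m. Poly_Mapping.lookup m i) = d)"

definition stanley_reisner_ideal :: "nat set \<Rightarrow> nat set set \<Rightarrow> 'l::field mpoly set" where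
  "stanley_reisner_ideal E \<Delta> = genideal (polynomial_ring E) {\<Prod>i\<in>C. Var i | C. C \<in> circuits E \<Delta>}"


section \<open>Regular sequences\<close>

definition regular_sequence :: "('a, 'b) ring_scheme \<Rightarrow> 'a list \<Rightarrow> bool" where
  "regular_sequence A fs \<longleftrightarrow>
     set fs \<subseteq> carrier A \<and>
     genideal A (set fs) \<noteq> carrier A \<and>
     (\<forall>j < length fs. let I = genideal A (set (take j fs)) in
        \<forall>x \<in> carrier (A Quot I).
          (I +>\<^bsub>A\<^esub> fs ! j) \<otimes>\<^bsub>A Quot I\<^esub> x = \<zero>\<^bsub>A Quot I\<^esub> \<longrightarrow> x = \<zero>\<^bsub>A Quot I\<^esub>)"


section \<open>Symbolic powers and resurgence\<close>

abbreviation ideal_power :: "('a, 'b) ring_scheme \<Rightarrow> 'a set \<Rightarrow> nat \<Rightarrow> 'a set" where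
  "ideal_power A J s \<equiv> J [^]\<^bsub>ideals_set A\<^esub> s"

text \<open>The associated primes of the \<open>A\<close>-module \<open>A/J\<close>: prime ideals that are the annihilator of an
  element of \<open>A/J\<close>.\<close>

definition associated_primes :: "('a, 'b) ring_scheme \<Rightarrow> 'a set \<Rightarrow> 'a set set" where
  "associated_primes A J = {P. primeideal P A \<and>
     (\<exists>x \<in> carrier (A Quot J).
        P = {a \<in> carrier A. (J +>\<^bsub>A\<^esub> a) \<otimes>\<^bsub>A Quot J\<^esub> x = \<zero>\<^bsub>A Quot J\<^esub>})}"

text \<open>In the following, \<open>A\<close> is a subring of an integral domain \<open>'a\<close>, with the operations of
  \<open>'a\<close>.  The localization of \<open>A\<close> at \<open>P\<close> is taken inside the field of fractions, \<open>A\<close> being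
  embedded by \<open>a \<mapsto> a/1\<close>.\<close>

definition localization_at :: "'a::idom ring \<Rightarrow> 'a set \<Rightarrow> 'a fract ring" where
  "localization_at A P = ring_of_type_algebra\<lparr>carrier :=
     {Fract a u | a u. a \<in> carrier A \<and> u \<in> carrier A - P}\<rparr>"

definition symbolic_power :: "'a::idom ring \<Rightarrow> 'a set \<Rightarrow> nat \<Rightarrow> 'a set" where
  "symbolic_power A J s = {a \<in> carrier A. \<forall>P \<in> associated_primes A J.
     Fract a 1 \<in> genideal (localization_at A P) ((\<lambda>b. Fract b 1) ` ideal_power A J s)}"

text \<open>The suprema are taken in the extended reals, so that no boundedness is presupposed.\<close>

definition resurgence :: "'a::idom ring \<Rightarrow> 'a set \<Rightarrow> ereal" where
  "resurgence A J = Sup {ereal (real s / real r) | s r.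
     s \<ge> 1 \<and> r \<ge> 1 \<and> \<not> symbolic_power A J s \<subseteq> ideal_power A J r}"

definition asymptotic_resurgence :: "'a::idom ring \<Rightarrow> 'a set \<Rightarrow> ereal" where
  "asymptotic_resurgence A J = Sup {ereal (real s / real r) | s r.
     s \<ge> 1 \<and> r \<ge> 1 \<and>
     (\<forall>\<^sub>F t in sequentially. \<not> symbolic_power A J (s * t) \<subseteq> ideal_power A J (r * t))}"

end

theory Submission
  imports Defs "HOL-Library.Indicator_Function"
begin

text \<open>
  Put \<open>c = n - k\<close>, write \<open>f^a\<close> for the product of the \<open>f i ^ a i\<close>, and for a basis \<open>B\<close> let \<open>Q_B\<close> be the
  ideal generated by the \<open>f i\<close> with \<open>i \<notin> B\<close>. The heart of the matter is that \<open>J\<close> has \<open>s\<close>-th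
  symbolic power equal to the intersection of the \<open>Q_B ^ s\<close>, and that this intersection is generated by
  the \<open>f^a\<close> with \<open>\<Sum>i\<in>E - B. a i \<ge> s\<close> for all bases \<open>B\<close>; the case \<open>f i = x_i\<close> describes \<open>I\<close>.

  No free resolutions are needed. Order the pairs (minimal cost \<open>\<Sum>i\<in>E - B. a i\<close>, optimal basis \<open>B\<close>),
  with ties between bases broken by a generic perturbation. By the exchange property, the exponent
  vectors with a given optimal basis \<open>B\<close> and given values off \<open>B\<close> form a translate of \<open>\<nat>^B\<close>, so
  removing the pairs one after the other filters \<open>R\<close> by ideals generated by \<open>f\<close>-monomials. Each step is
  controlled by the quasi-regularity of \<open>(f i)_{i \<notin> B}\<close> and by the fact that \<open>f j\<close>, \<open>j \<in> B\<close>, is a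
  nonzerodivisor modulo \<open>Q_B\<close>; this is where sequences of length \<open>c + 1\<close> enter.

  Since the exponents do not depend on \<open>f\<close>, containments for \<open>I\<close> pass to \<open>J\<close>. For the bound on
  \<open>\<rho>(I)\<close>, split a monomial into its level sets \<open>U_t\<close>: the nullities of the \<open>U_t\<close> add up to at least \<open>s\<close>,
  each dependent \<open>U_t\<close> contributes one factor of \<open>I\<close>, and if \<open>c \<ge> 2\<close> then every \<open>n - 1\<close> level sets of
  full nullity contribute an additional one. The lower bound compares degrees: a set \<open>U\<close> of nullity \<open>r\<close>
  and size \<open>d_r\<close> gives an element of \<open>J^{(r)}\<close> of degree \<open>d_r \<delta>\<close>, whereas \<open>J ^ q\<close> starts in degree
  \<open>q d_1 \<delta>\<close>.
\<close>

section \<open>Ideals in a subring and quasi-regular sequences\<close>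

text \<open>Subrings are subsets of a ring type and use its operations, so the same lemmas serve
  polynomial rings and their localizations. The link with rings given as records is made near the
  end.\<close>

locale subring_carrier =
  fixes A :: "'a::comm_ring_1 set"
  assumes one_mem [simp, intro]: "1 \<in> A"
    and add_mem [intro]: "x \<in> A \<Longrightarrow> y \<in> A \<Longrightarrow> x + y \<in> A"
    and mult_mem [intro]: "x \<in> A \<Longrightarrow> y \<in> A \<Longrightarrow> x * y \<in> A"
    and uminus_mem [intro]: "x \<in> A \<Longrightarrow> - x \<in> A"
begin

lemma zero_mem [simp, intro]: "0 \<in> A"
  using add_mem[of 1 "-1"] uminus_mem[of 1] by simp

lemma diff_mem [intro]: "x \<in> A \<Longrightarrow> y \<in> A \<Longrightarrow> x - y \<in> A"
  using add_mem[of x "- y"] by auto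

lemma sum_mem [intro]: "(\<And>i. i \<in> F \<Longrightarrow> u i \<in> A) \<Longrightarrow> (\<Sum>i\<in>F. u i) \<in> A"
  by (induction F rule: infinite_finite_induct) auto

lemma prod_mem [intro]: "(\<And>i. i \<in> F \<Longrightarrow> u i \<in> A) \<Longrightarrow> (\<Prod>i\<in>F. u i) \<in> A"
  by (induction F rule: infinite_finite_induct) auto

lemma power_mem [intro]: "x \<in> A \<Longrightarrow> x ^ n \<in> A"
  by (induction n) auto

definition is_ideal :: "'a set \<Rightarrow> bool" where
  "is_ideal K \<longleftrightarrow> K \<subseteq> A \<and> 0 \<in> K \<and> (\<forall>x\<in>K. \<forall>y\<in>K. x + y \<in> K) \<and> (\<forall>a\<in>A. \<forall>x\<in>K. a * x \<in> K)"

lemma is_idealD: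
  assumes "is_ideal K"
  shows "K \<subseteq> A" "0 \<in> K" "x \<in> K \<Longrightarrow> y \<in> K \<Longrightarrow> x + y \<in> K"
    "a \<in> A \<Longrightarrow> x \<in> K \<Longrightarrow> a * x \<in> K" "a \<in> A \<Longrightarrow> x \<in> K \<Longrightarrow> x * a \<in> K"
    "x \<in> K \<Longrightarrow> - x \<in> K" "x \<in> K \<Longrightarrow> y \<in> K \<Longrightarrow> x - y \<in> K"
proof -
  note d = assms[unfolded is_ideal_def]
  show "K \<subseteq> A" "0 \<in> K" "x \<in> K \<Longrightarrow> y \<in> K \<Longrightarrow> x + y \<in> K"
    "a \<in> A \<Longrightarrow> x \<in> K \<Longrightarrow> a * x \<in> K" using d by auto
  show "a \<in> A \<Longrightarrow> x \<in> K \<Longrightarrow> x * a \<in> K" using d by (auto simp: mult.commute)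
  have m: "- z \<in> K" if "z \<in> K" for z
    using d that uminus_mem[OF one_mem] by (metis mult_minus1)
  then show "x \<in> K \<Longrightarrow> - x \<in> K" .
  show "x \<in> K \<Longrightarrow> y \<in> K \<Longrightarrow> x - y \<in> K"
    using d m by (metis diff_conv_add_uminus)
qed

lemma is_ideal_sum: "is_ideal K \<Longrightarrow> (\<And>i. i \<in> F \<Longrightarrow> u i \<in> K) \<Longrightarrow> (\<Sum>i\<in>F. u i) \<in> K"
  by (induction F rule: infinite_finite_induct) (auto simp: is_idealD)

text \<open>Adding one multiple of a generator at a time gives an induction principle from which
  both upper bounds and coefficient expansions are obtained.\<close>

inductive_set ideal_span :: "'a set \<Rightarrow> 'a set" for G where
  ideal_span_zero: "0 \<in> ideal_span G"
| ideal_span_step: "x \<in> ideal_span G \<Longrightarrow> a \<in> A \<Longrightarrow> g \<in> G \<Longrightarrow> x + a * g \<in> ideal_span G"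

lemma ideal_span_base: "g \<in> G \<Longrightarrow> g \<in> ideal_span G"
  using ideal_span_step[OF ideal_span_zero, of 1 g G] by simp

lemma is_ideal_span:
  assumes "G \<subseteq> A"
  shows "is_ideal (ideal_span G)"
proof -
  have 1: "x \<in> A" if "x \<in> ideal_span G" for x
    using that by induction (use assms in auto)
  have 2: "x + y \<in> ideal_span G" if "y \<in> ideal_span G" "x \<in> ideal_span G" for x y
    using that by induction (auto simp: add.assoc[symmetric] intro: ideal_span_step)
  have 3: "a * x \<in> ideal_span G" if "x \<in> ideal_span G" "a \<in> A" for a x
    using that
    by induction (auto simp: distrib_left mult.assoc[symmetric] intro: ideal_span_step ideal_span_zero)
  show ?thesis
    using 1 2 3 by (auto simp: is_ideal_def intro: ideal_span_zero)
qed

lemma ideal_span_least: "is_ideal K \<Longrightarrow> G \<subseteq> K \<Longrightarrow> ideal_span G \<subseteq> K"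
proof
  fix x assume K: "is_ideal K" "G \<subseteq> K" and "x \<in> ideal_span G"
  from this(3) show "x \<in> K" by induction (use K in \<open>auto simp: is_idealD\<close>)
qed

lemma ideal_span_mono: "G \<subseteq> H \<Longrightarrow> ideal_span G \<subseteq> ideal_span H"
proof
  fix x assume K: "G \<subseteq> H" and "x \<in> ideal_span G"
  from this(2) show "x \<in> ideal_span H"
    by induction (use K in \<open>auto intro: ideal_span_zero ideal_span_step\<close>)
qed

lemma ideal_span_Un:
  assumes "x \<in> ideal_span (G \<union> H)"
  shows "\<exists>y\<in>ideal_span G. \<exists>z\<in>ideal_span H. x = y + z"
  using assms
proof induction
  case ideal_span_zero
  show ?case using ideal_span.ideal_span_zero by (metis add_0)
next
  case (ideal_span_step x a g)
  then obtain y z where yz: "y \<in> ideal_span G" "z \<in> ideal_span H" "x = y + z" by auto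
  show ?case
  proof (cases "g \<in> G")
    case True
    then have "y + a * g \<in> ideal_span G" using yz ideal_span_step by (auto intro: ideal_span.intros)
    moreover have "x + a * g = (y + a * g) + z" using yz by (simp add: algebra_simps)
    ultimately show ?thesis using yz by blast
  next
    case False
    then have "z + a * g \<in> ideal_span H" using yz ideal_span_step by (auto intro: ideal_span.intros)
    moreover have "x + a * g = y + (z + a * g)" using yz by (simp add: algebra_simps)
    ultimately show ?thesis using yz by blast
  qed
qed

lemma ideal_span_image_finite:
  assumes "x \<in> ideal_span (g ` F)" "finite F"
  shows "\<exists>u. (\<forall>i. u i \<in> A) \<and> x = (\<Sum>i\<in>F. u i * g i)"
  using assms(1)
proof induction
  case ideal_span_zero
  show ?case by (rule exI[of _ "\<lambda>_. 0"]) auto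
next
  case (ideal_span_step x a h)
  then obtain u i where u: "\<forall>i. u i \<in> A" "x = (\<Sum>i\<in>F. u i * g i)" and i: "i \<in> F" "h = g i" by auto
  have "(\<Sum>j\<in>F. (u(i := u i + a)) j * g j) = (\<Sum>j\<in>F. u j * g j + (if j = i then a * g j else 0))"
    by (intro sum.cong) (auto simp: algebra_simps)
  also have "\<dots> = x + a * h"
    using i assms(2) u by (simp add: sum.distrib)
  finally have eq: "x + a * h = (\<Sum>j\<in>F. (u(i := u i + a)) j * g j)" by simp
  have "\<forall>j. (u(i := u i + a)) j \<in> A"
    using u ideal_span_step(2) by auto
  with eq show ?case by blast
qed

lemma ideal_span_mult_subset:
  assumes K: "is_ideal K" and x: "x \<in> ideal_span G" and y: "y \<in> ideal_span H"
    and G: "G \<subseteq> A" "H \<subseteq> A"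
    and GH: "\<And>g h. g \<in> G \<Longrightarrow> h \<in> H \<Longrightarrow> g * h \<in> K"
  shows "x * y \<in> K"
proof -
  have 1: "g * y \<in> K" if g: "g \<in> G" for g
    using y
  proof induction
    case (ideal_span_step z a h)
    then have "g * z + a * (g * h) \<in> K" using K GH[OF g] by (simp add: is_idealD)
    then show ?case by (simp add: algebra_simps)
  qed (use K in \<open>simp add: is_idealD\<close>)
  from x show ?thesis
  proof induction
    case (ideal_span_step z a g)
    then have "z * y + a * (g * y) \<in> K" using K 1 by (simp add: is_idealD)
    then show ?case by (simp add: algebra_simps)
  qed (use K in \<open>simp add: is_idealD\<close>)
qed

lemma ideal_span_empty: "ideal_span {} = {0}"
proof -
  have "is_ideal {0}" by (auto simp: is_ideal_def)
  from ideal_span_least[OF this, of "{}"] show ?thesis using ideal_span_zero by blast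
qed

fun ideal_pow :: "'a set \<Rightarrow> nat \<Rightarrow> 'a set" where
  "ideal_pow K 0 = A"
| "ideal_pow K (Suc s) = ideal_span {x * y | x y. x \<in> ideal_pow K s \<and> y \<in> K}"

lemma is_ideal_carrier: "is_ideal A"
  by (auto simp: is_ideal_def)

lemma is_ideal_pow: "is_ideal K \<Longrightarrow> is_ideal (ideal_pow K s)"
proof (induction s)
  case 0
  show ?case using is_ideal_carrier by simp
next
  case (Suc s)
  then have "{x * y | x y. x \<in> ideal_pow K s \<and> y \<in> K} \<subseteq> A"
    using is_idealD(1) by blast
  then show ?case using is_ideal_span by simp
qed

lemma ideal_pow_Suc_mem: "x \<in> ideal_pow K s \<Longrightarrow> y \<in> K \<Longrightarrow> x * y \<in> ideal_pow K (Suc s)"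
  by (auto intro: ideal_span_base)

lemma ideal_pow_add_mem:
  "is_ideal K \<Longrightarrow> x \<in> ideal_pow K s \<Longrightarrow> y \<in> ideal_pow K t \<Longrightarrow> x * y \<in> ideal_pow K (s + t)"
proof (induction t arbitrary: y)
  case 0
  then show ?case using is_idealD(5)[OF is_ideal_pow] by simp
next
  case (Suc t)
  note K = is_ideal_pow[OF Suc.prems(1)]
  have "y \<in> ideal_span {x * y | x y. x \<in> ideal_pow K t \<and> y \<in> K}" using Suc.prems by simp
  then show ?case
  proof induction
    case ideal_span_zero
    then show ?case using is_idealD(2)[OF K, of "s + Suc t"] by simp
  next
    case (ideal_span_step z a g)
    then obtain v w where vw: "g = v * w" "v \<in> ideal_pow K t" "w \<in> K" by auto
    have "x * v * w \<in> ideal_pow K (s + Suc t)"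
      using Suc.IH[OF Suc.prems(1,2) vw(2)] ideal_pow_Suc_mem[OF _ vw(3)] by fastforce
    then have "x * z + a * (x * v * w) \<in> ideal_pow K (s + Suc t)"
      using ideal_span_step is_idealD[OF K] by meson
    then show ?case using vw by (simp add: algebra_simps)
  qed
qed

lemma ideal_pow_one_mem: "x \<in> K \<Longrightarrow> x \<in> ideal_pow K 1"
  using ideal_pow_Suc_mem[of 1 K 0 x] by simp

lemma ideal_pow_power_mem:
  assumes "is_ideal K" "x \<in> ideal_pow K s" shows "x ^ n \<in> ideal_pow K (s * n)"
proof (induction n)
  case (Suc n)
  from ideal_pow_add_mem[OF assms(1) Suc assms(2)] show ?case by (simp add: mult.commute add.commute)
qed simp

lemma ideal_pow_prod_mem:
  assumes "is_ideal K" "\<And>i. i \<in> F \<Longrightarrow> g i \<in> ideal_pow K (s i)"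
  shows "(\<Prod>i\<in>F. g i) \<in> ideal_pow K (\<Sum>i\<in>F. s i)"
  using assms(2)
  by (induction F rule: infinite_finite_induct) (auto intro: ideal_pow_add_mem[OF assms(1)])

lemma ideal_pow_antimono:
  assumes "is_ideal K" "s \<le> t" shows "ideal_pow K t \<subseteq> ideal_pow K s"
proof -
  have "ideal_pow K (Suc s) \<subseteq> ideal_pow K s" for s
    unfolding ideal_pow.simps
    using is_idealD(5)[OF is_ideal_pow[OF assms(1)]] is_idealD(1)[OF assms(1)]
    by (intro ideal_span_least[OF is_ideal_pow[OF assms(1), of s]]) auto
  then show ?thesis using lift_Suc_antimono_le[of "ideal_pow K" s t] assms by blast
qed

end

section \<open>Monomials in a family of ring elements\<close>

definition monom_at :: "('i \<Rightarrow> 'a::comm_ring_1) \<Rightarrow> 'i set \<Rightarrow> ('i \<Rightarrow> nat) \<Rightarrow> 'a" where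
  "monom_at f D \<alpha> = (\<Prod>i\<in>D. f i ^ \<alpha> i)"

text \<open>Vanishing off \<open>D\<close> gives each monomial of degree \<open>s\<close> a single
  exponent vector, so sums over \<open>exponents D s\<close> with coefficients in the ring are the
  forms of degree \<open>s\<close>.\<close>

definition exponents :: "'i set \<Rightarrow> nat \<Rightarrow> ('i \<Rightarrow> nat) set" where
  "exponents D s = {\<alpha>. (\<forall>i. i \<notin> D \<longrightarrow> \<alpha> i = 0) \<and> sum \<alpha> D = s}"

lemma finite_exponents: "finite D \<Longrightarrow> finite (exponents D s)"
proof -
  assume D: "finite D"
  have "exponents D s \<subseteq> {\<alpha>. \<forall>i. (i \<in> D \<longrightarrow> \<alpha> i \<in> {..s}) \<and> (i \<notin> D \<longrightarrow> \<alpha> i = 0)}"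
    using member_le_sum[of _ D] D by (fastforce simp: exponents_def)
  then show ?thesis
    using finite_set_of_finite_funs[OF D, of "{..s}" 0] finite_subset by blast
qed

lemma exponents_zero: "finite D \<Longrightarrow> exponents D 0 = {\<lambda>_. 0}"
  by (auto simp: exponents_def)

lemma monom_at_zero [simp]: "monom_at f D (\<lambda>_. 0) = 1"
  by (simp add: monom_at_def)

lemma monom_at_add: "monom_at f D (\<lambda>i. \<alpha> i + \<beta> i) = monom_at f D \<alpha> * monom_at f D \<beta>"
  by (simp add: monom_at_def power_add prod.distrib)

lemma monom_at_upd:
  assumes "finite D" "e \<in> D"
  shows "monom_at f D (\<alpha>(e := Suc (\<alpha> e))) = f e * monom_at f D \<alpha>"
  using assms by (simp add: monom_at_def prod.remove[of D e] algebra_simps)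

lemma exponents_upd:
  assumes "finite D" "e \<in> D" "\<alpha> \<in> exponents D s"
  shows "\<alpha>(e := Suc (\<alpha> e)) \<in> exponents D (Suc s)"
proof -
  have "sum (\<alpha>(e := Suc (\<alpha> e))) D = Suc (sum \<alpha> D)"
    using assms by (simp add: sum.remove[of D e])
  then show ?thesis using assms by (auto simp: exponents_def)
qed

lemma exponents_SucE:
  assumes "finite D" "\<alpha> \<in> exponents D (Suc s)"
  obtains e \<beta> where "e \<in> D" "\<beta> \<in> exponents D s" "\<alpha> = \<beta>(e := Suc (\<beta> e))"
proof -
  have "sum \<alpha> D \<noteq> 0" using assms by (simp add: exponents_def)
  then obtain e where e: "e \<in> D" "\<alpha> e \<noteq> 0" by (meson sum.neutral)
  define \<beta> where "\<beta> = \<alpha>(e := \<alpha> e - 1)"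
  have a: "\<alpha> = \<beta>(e := Suc (\<beta> e))" using e by (auto simp: \<beta>_def)
  have "sum \<alpha> D = Suc (sum \<beta> D)" using e assms(1) by (simp add: \<beta>_def sum.remove[of D e])
  then have "\<beta> \<in> exponents D s" using assms e by (auto simp: exponents_def \<beta>_def)
  with a e show ?thesis using that by blast
qed

locale subring_family = subring_carrier A for A :: "'a::comm_ring_1 set" +
  fixes E :: "'i set" and f :: "'i \<Rightarrow> 'a"
  assumes finite_E: "finite E" and f_mem: "i \<in> E \<Longrightarrow> f i \<in> A"
begin

lemma monom_at_mem: "D \<subseteq> E \<Longrightarrow> monom_at f D \<alpha> \<in> A"
  unfolding monom_at_def using f_mem by auto

definition Q :: "'i set \<Rightarrow> 'a set" where "Q D = ideal_span (f ` D)"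

text \<open>For \<open>D \<subseteq> E\<close> this is the \<open>s\<close>-th power of
  \<open>Q D\<close>, presented by monomial generators so that elements can be written as forms and
  their coefficients compared.\<close>

definition Qpow :: "'i set \<Rightarrow> nat \<Rightarrow> 'a set" where
  "Qpow D s = ideal_span (monom_at f D ` exponents D s)"

lemma is_ideal_Q: "D \<subseteq> E \<Longrightarrow> is_ideal (Q D)"
  unfolding Q_def using f_mem by (intro is_ideal_span) auto

lemma Q_mono: "D \<subseteq> D' \<Longrightarrow> Q D \<subseteq> Q D'"
  unfolding Q_def by (intro ideal_span_mono) auto

lemma f_in_Q: "i \<in> D \<Longrightarrow> f i \<in> Q D"
  unfolding Q_def by (intro ideal_span_base) auto

lemma is_ideal_Qpow: "D \<subseteq> E \<Longrightarrow> is_ideal (Qpow D s)"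
  unfolding Qpow_def using monom_at_mem by (intro is_ideal_span) auto

lemma Qpow_zero: "D \<subseteq> E \<Longrightarrow> Qpow D 0 = A"
proof -
  assume D: "D \<subseteq> E"
  then have "finite D" using finite_E finite_subset by blast
  then have "1 \<in> Qpow D 0" unfolding Qpow_def by (intro ideal_span_base) (simp add: exponents_zero)
  then have "a \<in> Qpow D 0" if "a \<in> A" for a
    using is_idealD(4)[OF is_ideal_Qpow[OF D], of a 1 0] that by simp
  then show ?thesis using is_idealD(1)[OF is_ideal_Qpow[OF D]] by blast
qed

lemma Qpow_Suc_mem:
  assumes D: "D \<subseteq> E" and x: "x \<in> Qpow D s" and y: "y \<in> Q D"
  shows "x * y \<in> Qpow D (Suc s)"
proof (rule ideal_span_mult_subset[OF is_ideal_Qpow[OF D] x[unfolded Qpow_def] y[unfolded Q_def]])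
  fix g h assume "g \<in> monom_at f D ` exponents D s" "h \<in> f ` D"
  then obtain \<alpha> e where \<alpha>: "g = monom_at f D \<alpha>" "\<alpha> \<in> exponents D s" "h = f e" "e \<in> D" by auto
  have fin: "finite D" using D finite_E finite_subset by blast
  have "monom_at f D (\<alpha>(e := Suc (\<alpha> e))) \<in> Qpow D (Suc s)"
    unfolding Qpow_def using exponents_upd[OF fin \<alpha>(4,2)] by (intro ideal_span_base) auto
  then show "g * h \<in> Qpow D (Suc s)"
    using \<alpha> by (simp add: monom_at_upd[OF fin] mult.commute)
qed (use D f_mem monom_at_mem in auto)

lemma Qpow_Suc_subset: "D \<subseteq> E \<Longrightarrow> Qpow D (Suc s) \<subseteq> Qpow D s"
proof -
  assume D: "D \<subseteq> E"
  then have fin: "finite D" using finite_E finite_subset by blast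
  show ?thesis
    unfolding Qpow_def[of D "Suc s"]
  proof (rule ideal_span_least[OF is_ideal_Qpow[OF D]], safe)
    fix \<alpha> assume "\<alpha> \<in> exponents D (Suc s)"
    then obtain e \<beta> where e: "e \<in> D" "\<beta> \<in> exponents D s" "\<alpha> = \<beta>(e := Suc (\<beta> e))"
      using exponents_SucE[OF fin] by metis
    have "monom_at f D \<beta> \<in> Qpow D s"
      unfolding Qpow_def using e by (intro ideal_span_base) auto
    then show "monom_at f D \<alpha> \<in> Qpow D s"
      using e D f_mem is_idealD(4)[OF is_ideal_Qpow[OF D]] by (auto simp: monom_at_upd[OF fin])
  qed
qed

lemma Qpow_antimono: "D \<subseteq> E \<Longrightarrow> s \<le> t \<Longrightarrow> Qpow D t \<subseteq> Qpow D s"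
  using lift_Suc_antimono_le[of "Qpow D" s t] Qpow_Suc_subset by blast

lemma monom_at_in_Qpow:
  assumes D: "D \<subseteq> E" and s: "sum \<alpha> D \<ge> s"
  shows "monom_at f D \<alpha> \<in> Qpow D s"
proof -
  have "monom_at f D \<alpha> = monom_at f D (\<lambda>i. if i \<in> D then \<alpha> i else 0)"
    unfolding monom_at_def by (intro prod.cong) auto
  moreover have "(\<lambda>i. if i \<in> D then \<alpha> i else 0) \<in> exponents D (sum \<alpha> D)"
    by (auto simp: exponents_def)
  ultimately have "monom_at f D \<alpha> \<in> Qpow D (sum \<alpha> D)"
    unfolding Qpow_def by (intro ideal_span_base) auto
  then show ?thesis using Qpow_antimono[OF D s] by blast
qed

text \<open>One factor is split off each generator of degree \<open>Suc s\<close> and moved into the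
  coefficient. This later turns membership in the next power into an equation between two forms of
  degree \<open>s\<close>.\<close>

lemma Qpow_Suc_repr:
  assumes D: "D \<subseteq> E" and x: "x \<in> Qpow D (Suc s)"
  shows "\<exists>v. (\<forall>\<alpha>. v \<alpha> \<in> Q D) \<and> x = (\<Sum>\<alpha>\<in>exponents D s. v \<alpha> * monom_at f D \<alpha>)"
  using x unfolding Qpow_def
proof induction
  case ideal_span_zero
  show ?case using is_idealD(2)[OF is_ideal_Q[OF D]] by (intro exI[of _ "\<lambda>_. 0"]) auto
next
  case (ideal_span_step x a g)
  have fin: "finite D" using D finite_E finite_subset by blast
  obtain v where v: "\<forall>\<alpha>. v \<alpha> \<in> Q D" "x = (\<Sum>\<alpha>\<in>exponents D s. v \<alpha> * monom_at f D \<alpha>)"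
    using ideal_span_step by auto
  obtain e \<beta> where e: "e \<in> D" "\<beta> \<in> exponents D s" "g = f e * monom_at f D \<beta>"
    using ideal_span_step(3) exponents_SucE[OF fin] monom_at_upd[OF fin] by (smt (verit) imageE)
  let ?v = "v(\<beta> := v \<beta> + a * f e)"
  have "(\<Sum>\<alpha>\<in>exponents D s. ?v \<alpha> * monom_at f D \<alpha>)
      = (\<Sum>\<alpha>\<in>exponents D s. v \<alpha> * monom_at f D \<alpha> + (if \<alpha> = \<beta> then a * f e * monom_at f D \<alpha> else 0))"
    by (intro sum.cong) (auto simp: algebra_simps)
  also have "\<dots> = x + a * g"
    using e v finite_exponents[OF fin, of s] by (simp add: sum.distrib algebra_simps)
  finally have "x + a * g = (\<Sum>\<alpha>\<in>exponents D s. ?v \<alpha> * monom_at f D \<alpha>)" by simp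
  moreover have "\<forall>\<alpha>. ?v \<alpha> \<in> Q D"
    using v e f_in_Q is_idealD(3,4)[OF is_ideal_Q[OF D]] ideal_span_step(2) by auto
  ultimately show ?case by blast
qed

text \<open>Equivalently, the associated graded ring of \<open>Q D\<close> is a polynomial ring over
  \<open>A / Q D\<close>: the monomials of degree \<open>s\<close> are independent modulo the next
  power.\<close>

definition quasi_regular :: "'i set \<Rightarrow> bool" where
  "quasi_regular D \<longleftrightarrow> (\<forall>s u. (\<forall>\<alpha>. u \<alpha> \<in> A) \<longrightarrow>
     (\<Sum>\<alpha>\<in>exponents D s. u \<alpha> * monom_at f D \<alpha>) \<in> Qpow D (Suc s) \<longrightarrow>
     (\<forall>\<alpha>\<in>exponents D s. u \<alpha> \<in> Q D))"

lemma sum_mem_Qpow: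
  assumes D: "D \<subseteq> E" and "\<And>\<alpha>. \<alpha> \<in> exponents D s \<Longrightarrow> u \<alpha> \<in> A"
  shows "(\<Sum>\<alpha>\<in>exponents D s. u \<alpha> * monom_at f D \<alpha>) \<in> Qpow D s"
proof (rule is_ideal_sum[OF is_ideal_Qpow[OF D]])
  fix \<alpha> assume "\<alpha> \<in> exponents D s"
  then show "u \<alpha> * monom_at f D \<alpha> \<in> Qpow D s"
    using is_idealD(4)[OF is_ideal_Qpow[OF D]] assms monom_at_in_Qpow[OF D]
    by (simp add: exponents_def)
qed

lemma sum_mem_Qpow_Suc:
  assumes D: "D \<subseteq> E" and "\<And>\<alpha>. \<alpha> \<in> exponents D s \<Longrightarrow> u \<alpha> \<in> Q D"
  shows "(\<Sum>\<alpha>\<in>exponents D s. u \<alpha> * monom_at f D \<alpha>) \<in> Qpow D (Suc s)"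
proof (rule is_ideal_sum[OF is_ideal_Qpow[OF D]])
  fix \<alpha> assume a: "\<alpha> \<in> exponents D s"
  then have "monom_at f D \<alpha> \<in> Qpow D s"
    using monom_at_in_Qpow[OF D] by (simp add: exponents_def)
  from Qpow_Suc_mem[OF D this assms(2)[OF a]]
  show "u \<alpha> * monom_at f D \<alpha> \<in> Qpow D (Suc s)" by (simp add: mult.commute)
qed

lemma Qpow_repr:
  assumes D: "D \<subseteq> E" and x: "x \<in> Qpow D s"
  obtains u where "\<And>\<alpha>. u \<alpha> \<in> A" "x = (\<Sum>\<alpha>\<in>exponents D s. u \<alpha> * monom_at f D \<alpha>)"
proof -
  have "finite D" using D finite_E finite_subset by blast
  from ideal_span_image_finite[OF x[unfolded Qpow_def] finite_exponents[OF this]] that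
  show ?thesis by blast
qed

text \<open>Induction on \<open>s\<close>. Once \<open>r\<close> is a form of degree
  \<open>s\<close>, quasi-regularity applied to \<open>x * r\<close> puts \<open>x\<close> times
  each coefficient into \<open>Q D\<close>; cancelling \<open>x\<close> there raises the power by
  one.\<close>

lemma nonzerodivisor_Qpow:
  assumes D: "D \<subseteq> E" and qr: "quasi_regular D" and x: "x \<in> A"
    and nz: "\<And>r. r \<in> A \<Longrightarrow> x * r \<in> Q D \<Longrightarrow> r \<in> Q D"
    and r: "r \<in> A" "x * r \<in> Qpow D s"
  shows "r \<in> Qpow D s"
  using r(2)
proof (induction s)
  case 0
  then show ?case using r Qpow_zero[OF D] by simp
next
  case (Suc s)
  then have "r \<in> Qpow D s" using Qpow_Suc_subset[OF D] by blast
  then obtain u where u: "\<And>\<alpha>. u \<alpha> \<in> A" "r = (\<Sum>\<alpha>\<in>exponents D s. u \<alpha> * monom_at f D \<alpha>)"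
    using Qpow_repr[OF D] by metis
  have "x * r = (\<Sum>\<alpha>\<in>exponents D s. (x * u \<alpha>) * monom_at f D \<alpha>)"
    by (simp add: u(2) sum_distrib_left algebra_simps)
  then have "\<forall>\<alpha>\<in>exponents D s. x * u \<alpha> \<in> Q D"
    using qr[unfolded quasi_regular_def, rule_format, of "\<lambda>\<alpha>. x * u \<alpha>" s] Suc.prems u(1) x by auto
  then have "\<forall>\<alpha>\<in>exponents D s. u \<alpha> \<in> Q D" using nz u by blast
  then show ?case using sum_mem_Qpow_Suc[OF D, of s u] u(2) by simp
qed

text \<open>Induction on the degree. A relation splits as \<open>G + f e * H\<close> with
  \<open>G\<close> free of \<open>e\<close>; cancelling \<open>f e\<close> modulo a power of
  \<open>Q D\<close> shows that \<open>H\<close>, a form of lower degree, lies in a higher power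
  than its degree, so the induction hypothesis applies to it.\<close>

lemma quasi_regular_insert:
  assumes D: "insert e D \<subseteq> E" "e \<notin> D" and qr: "quasi_regular D"
    and nz: "\<And>r. r \<in> A \<Longrightarrow> f e * r \<in> Q D \<Longrightarrow> r \<in> Q D"
  shows "quasi_regular (insert e D)"
proof -
  define D' where "D' = insert e D"
  have DE: "D \<subseteq> E" and D': "D' \<subseteq> E" "finite D'" "finite D" "e \<in> D'" "D \<subseteq> D'"
    using D finite_E finite_subset by (auto simp: D'_def)
  have mon0: "monom_at f D' \<alpha> = monom_at f D \<alpha>" if "\<alpha> e = 0" for \<alpha>
    using D D' that by (simp add: D'_def monom_at_def)
  have ex0: "{\<alpha>\<in>exponents D' s. \<alpha> e = 0} = exponents D s" for s
  proof (rule Set.set_eqI)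
    fix \<alpha>
    show "\<alpha> \<in> {\<alpha>\<in>exponents D' s. \<alpha> e = 0} \<longleftrightarrow> \<alpha> \<in> exponents D s"
    proof (cases "\<alpha> e = 0")
      case True
      then have "(\<forall>i. i \<notin> D' \<longrightarrow> \<alpha> i = 0) \<longleftrightarrow> (\<forall>i. i \<notin> D \<longrightarrow> \<alpha> i = 0)"
        unfolding D'_def by (metis insert_iff)
      then show ?thesis using D D'(3) True by (simp add: D'_def exponents_def)
    next
      case False
      then show ?thesis using D by (auto simp: exponents_def)
    qed
  qed
  have up: "(\<lambda>\<beta>. \<beta>(e := Suc (\<beta> e))) ` exponents D' s \<subseteq> exponents D' (Suc s)" for s
    by (rule image_subsetI) (rule exponents_upd[OF D'(2,4)])
  have dn: "\<alpha> \<in> (\<lambda>\<beta>. \<beta>(e := Suc (\<beta> e))) ` exponents D' s"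
    if "\<alpha> \<in> exponents D' (Suc s)" "\<alpha> e \<noteq> 0" for \<alpha> s
  proof -
    define \<beta> where "\<beta> = \<alpha>(e := \<alpha> e - 1)"
    have a: "\<alpha> = \<beta>(e := Suc (\<beta> e))" using that by (auto simp: \<beta>_def)
    have "sum \<alpha> D' = Suc (sum \<beta> D')" using that D' by (simp add: \<beta>_def sum.remove[of D' e])
    then have "\<beta> \<in> exponents D' s" using that D' by (auto simp: exponents_def \<beta>_def)
    with a show ?thesis by blast
  qed
  have ex1: "exponents D' (Suc s) = exponents D (Suc s) \<union> (\<lambda>\<beta>. \<beta>(e := Suc (\<beta> e))) ` exponents D' s" for s
  proof (intro equalityI Un_least up subsetI)
    fix \<alpha> assume a: "\<alpha> \<in> exponents D' (Suc s)"
    show "\<alpha> \<in> exponents D (Suc s) \<union> (\<lambda>\<beta>. \<beta>(e := Suc (\<beta> e))) ` exponents D' s"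
    proof (cases "\<alpha> e = 0")
      case True
      with a show ?thesis unfolding ex0[of "Suc s", symmetric] by simp
    next
      case False
      from dn[OF a this] show ?thesis by (rule UnI2)
    qed
  next
    fix \<alpha> assume "\<alpha> \<in> exponents D (Suc s)"
    then show "\<alpha> \<in> exponents D' (Suc s)" unfolding ex0[of "Suc s", symmetric] by simp
  qed
  have Pmono: "Qpow D s \<subseteq> Qpow D' s" for s
  proof -
    have "monom_at f D ` exponents D s \<subseteq> monom_at f D' ` exponents D' s"
    proof (rule image_subsetI)
      fix \<alpha> assume "\<alpha> \<in> exponents D s"
      then have "\<alpha> \<in> exponents D' s" "\<alpha> e = 0" unfolding ex0[of s, symmetric] by simp_all
      then show "monom_at f D \<alpha> \<in> monom_at f D' ` exponents D' s"
        using mon0[of \<alpha>] by (metis imageI)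
    qed
    then show ?thesis unfolding Qpow_def by (rule ideal_span_mono)
  qed
  have "\<forall>\<alpha>\<in>exponents D' s. u \<alpha> \<in> Q D'"
    if "\<forall>\<alpha>. u \<alpha> \<in> A" "(\<Sum>\<alpha>\<in>exponents D' s. u \<alpha> * monom_at f D' \<alpha>) \<in> Qpow D' (Suc s)" for s u
    using that
  proof (induction s arbitrary: u)
    case 0
    obtain v where v: "\<forall>\<alpha>. v \<alpha> \<in> Q D'"
      "(\<Sum>\<alpha>\<in>exponents D' 0. u \<alpha> * monom_at f D' \<alpha>) = (\<Sum>\<alpha>\<in>exponents D' 0. v \<alpha> * monom_at f D' \<alpha>)"
      using Qpow_Suc_repr[OF D'(1) 0(2)] by blast
    then show ?case using D'(2) by (simp add: exponents_zero)
  next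
    case (Suc s)
    obtain v where v: "\<forall>\<alpha>. v \<alpha> \<in> Q D'"
      "(\<Sum>\<alpha>\<in>exponents D' (Suc s). u \<alpha> * monom_at f D' \<alpha>)
        = (\<Sum>\<alpha>\<in>exponents D' (Suc s). v \<alpha> * monom_at f D' \<alpha>)"
      using Qpow_Suc_repr[OF D'(1) Suc.prems(2)] by blast
    \<comment> \<open>The coefficients \<open>v\<close> already lie in \<open>Q D'\<close>.
      Subtracting them replaces membership in the higher power by a form that is exactly
      zero.\<close>
    define w where "w \<alpha> = u \<alpha> - v \<alpha>" for \<alpha>
    have wA: "w \<alpha> \<in> A" for \<alpha>
      using Suc.prems(1) v(1) is_idealD(1)[OF is_ideal_Q[OF D'(1)]] by (auto simp: w_def)
    \<comment> \<open>\<open>H\<close> collects the monomials divisible by \<open>f e\<close>, with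
      one factor \<open>f e\<close> removed; \<open>G\<close> collects the others, which only
      involve \<open>D\<close>.\<close>
    define H where "H = (\<Sum>\<beta>\<in>exponents D' s. w (\<beta>(e := Suc (\<beta> e))) * monom_at f D' \<beta>)"
    define G where "G = (\<Sum>\<alpha>\<in>exponents D (Suc s). w \<alpha> * monom_at f D \<alpha>)"
    have inj: "inj_on (\<lambda>\<beta>. \<beta>(e := Suc (\<beta> e))) Y" for Y :: "('i \<Rightarrow> nat) set"
      by (rule inj_onI) (metis fun_upd_apply fun_upd_triv fun_upd_upd nat.inject)
    have disj: "exponents D (Suc s) \<inter> (\<lambda>\<beta>. \<beta>(e := Suc (\<beta> e))) ` exponents D' s = {}"
      using D by (auto simp: exponents_def) 
    have "0 = (\<Sum>\<alpha>\<in>exponents D' (Suc s). w \<alpha> * monom_at f D' \<alpha>)"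
      using v(2) by (simp add: w_def left_diff_distrib sum_subtractf)
    also have "\<dots> = (\<Sum>\<alpha>\<in>exponents D (Suc s). w \<alpha> * monom_at f D' \<alpha>)
        + (\<Sum>\<beta>\<in>exponents D' s. w (\<beta>(e := Suc (\<beta> e))) * monom_at f D' (\<beta>(e := Suc (\<beta> e))))"
      unfolding ex1 using disj finite_exponents D'
      by (subst sum.union_disjoint) (auto simp: sum.reindex[OF inj] o_def)
    also have "(\<Sum>\<beta>\<in>exponents D' s. w (\<beta>(e := Suc (\<beta> e))) * monom_at f D' (\<beta>(e := Suc (\<beta> e)))) = f e * H"
      unfolding H_def sum_distrib_left
      by (intro sum.cong) (auto simp: monom_at_upd[OF D'(2,4)] algebra_simps)
    also have "(\<Sum>\<alpha>\<in>exponents D (Suc s). w \<alpha> * monom_at f D' \<alpha>) = G"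
      unfolding G_def using D by (intro sum.cong) (auto simp: exponents_def mon0)
    finally have GH: "G + f e * H = 0" by simp
    have HA: "H \<in> A" unfolding H_def using wA monom_at_mem[OF D'(1)] by auto
    have "G \<in> Qpow D (Suc s)" unfolding G_def using wA by (intro sum_mem_Qpow[OF DE]) auto
    then have "f e * H \<in> Qpow D (Suc s)"
      using GH is_idealD(6)[OF is_ideal_Qpow[OF DE], of G "Suc s"] by (metis add.commute minus_unique)
    \<comment> \<open>\<open>f e * H\<close> equals \<open>- G\<close>, which lies in a power of
      \<open>Q D\<close> alone. Therefore \<open>f e\<close> can be cancelled by
      \<open>nonzerodivisor_Qpow\<close>.\<close>
    then have HD: "H \<in> Qpow D (Suc s)"
      using nonzerodivisor_Qpow[OF DE qr _ nz HA] D f_mem by auto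
    have "\<forall>\<beta>\<in>exponents D' s. w (\<beta>(e := Suc (\<beta> e))) \<in> Q D'"
      using Suc.IH[of "\<lambda>\<beta>. w (\<beta>(e := Suc (\<beta> e)))"] wA HD Pmono[of "Suc s"] unfolding H_def by auto
    moreover have "w \<alpha> \<in> Q D'" if a: "\<alpha> \<in> exponents D (Suc s)" for \<alpha>
    proof -
      \<comment> \<open>Rewriting \<open>H\<close> as a form in \<open>D\<close> makes
        \<open>G + f e * H\<close> a vanishing form in \<open>D\<close>, to which quasi-regularity
        of \<open>D\<close> applies.\<close>
      obtain h where h: "\<And>\<alpha>. h \<alpha> \<in> A" "H = (\<Sum>\<alpha>\<in>exponents D (Suc s). h \<alpha> * monom_at f D \<alpha>)"
        using Qpow_repr[OF DE HD] by metis
      have "(\<Sum>\<alpha>\<in>exponents D (Suc s). (w \<alpha> + f e * h \<alpha>) * monom_at f D \<alpha>) = 0"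
        using GH unfolding h(2) G_def by (simp add: sum.distrib sum_distrib_left algebra_simps)
      then have "w \<alpha> + f e * h \<alpha> \<in> Q D"
        using qr[unfolded quasi_regular_def, rule_format, of "\<lambda>\<alpha>. w \<alpha> + f e * h \<alpha>" "Suc s" \<alpha>] a
          is_idealD(2)[OF is_ideal_Qpow[OF DE]] add_mem[OF wA mult_mem[OF f_mem h(1)]] D by simp
      moreover have "f e * h \<alpha> \<in> Q D'"
        using f_in_Q[OF D'(4)] h(1) is_idealD(5)[OF is_ideal_Q[OF D'(1)]] by blast
      ultimately show ?thesis
        using Q_mono[OF D'(5)] is_idealD(7)[OF is_ideal_Q[OF D'(1)], of "w \<alpha> + f e * h \<alpha>" "f e * h \<alpha>"] by auto
    qed
    ultimately have "\<forall>\<alpha>\<in>exponents D' (Suc s). w \<alpha> \<in> Q D'"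
      unfolding ex1 by blast
    then show ?case
      using v(1) is_idealD(3)[OF is_ideal_Q[OF D'(1)]] unfolding w_def by (metis diff_add_cancel)
  qed
  then show ?thesis unfolding quasi_regular_def D'_def[symmetric] by blast
qed

text \<open>The cancellation property ranges over all subsets of \<open>D\<close>, so an induction
  over finite sets adds the elements one by one in any order.\<close>

lemma quasi_regularI:
  assumes "D \<subseteq> E"
    and "\<And>D' e r. insert e D' \<subseteq> D \<Longrightarrow> e \<notin> D' \<Longrightarrow> r \<in> A \<Longrightarrow> f e * r \<in> Q D' \<Longrightarrow> r \<in> Q D'"
  shows "quasi_regular D"
proof -
  have "finite D" using assms finite_E finite_subset by blast
  then show ?thesis using assms
  proof (induction D rule: finite_induct)
    case empty
    have Q0: "Q {} = {0}" unfolding Q_def by (simp add: ideal_span_empty)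
    have ex: "exponents ({} :: 'i set) s = (if s = 0 then {\<lambda>_. 0} else {})" for s
      by (auto simp: exponents_def)
    have "Qpow {} (Suc s) = {0}" for s
      unfolding Qpow_def by (simp add: ideal_span_empty ex)
    then show ?case unfolding quasi_regular_def Q0 by (simp add: ex)
  next
    case (insert e D)
    have DE: "D \<subseteq> E" using insert.prems(1) by simp
    have "quasi_regular D"
    proof (rule insert.IH[OF DE])
      fix D' e' r assume "insert e' D' \<subseteq> D" "e' \<notin> D'" "r \<in> A" "f e' * r \<in> Q D'"
      moreover from this(1) have "insert e' D' \<subseteq> insert e D" by auto
      ultimately show "r \<in> Q D'" using insert.prems(2) by metis
    qed
    from quasi_regular_insert[OF insert.prems(1) insert.hyps(2) this insert.prems(2)[OF subset_refl insert.hyps(2)]]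
    show ?case .
  qed
qed

end

section \<open>Matroid bases and symbolic exponents\<close>

context matroid
begin

definition bases :: "'v set set" where
  "bases = {B \<in> \<Delta>. card B = matroid_rank \<Delta> E}"

lemma finite_indeps: "finite \<Delta>"
  using finite_subset[of \<Delta> "Pow E"] finite_ground indep_subset_ground by blast

lemma finite_indep: "F \<in> \<Delta> \<Longrightarrow> finite F"
  using indep_subset_ground finite_ground finite_subset by blast

lemma card_le_rank: "F \<in> \<Delta> \<Longrightarrow> F \<subseteq> U \<Longrightarrow> card F \<le> matroid_rank \<Delta> U"
  unfolding matroid_rank_def using finite_indeps by (intro Max_ge) auto

lemma rank_attained: "\<exists>F\<in>\<Delta>. F \<subseteq> U \<and> card F = matroid_rank \<Delta> U"
proof -
  have "matroid_rank \<Delta> U \<in> card ` {F \<in> \<Delta>. F \<subseteq> U}"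
    unfolding matroid_rank_def using finite_indeps empty_indep by (intro Max_in) auto
  then show ?thesis by auto
qed

lemma rank_mono: "U \<subseteq> V \<Longrightarrow> matroid_rank \<Delta> U \<le> matroid_rank \<Delta> V"
  using rank_attained[of U] card_le_rank[of _ V] by (metis order_trans)

lemma rank_le_card: "finite U \<Longrightarrow> matroid_rank \<Delta> U \<le> card U"
  using rank_attained[of U] card_mono by metis

lemma indep_rank: "F \<in> \<Delta> \<Longrightarrow> matroid_rank \<Delta> F = card F"
  using card_le_rank[of F F] rank_le_card[OF finite_indep, of F] by simp

lemma basesD:
  assumes "B \<in> bases"
  shows "B \<in> \<Delta>" "B \<subseteq> E" "finite B" "card B = matroid_rank \<Delta> E"
  using assms indep_subset_ground finite_indep by (auto simp: bases_def)

lemma finite_bases: "finite bases"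
  using finite_indeps by (simp add: bases_def)

lemma bases_nonempty: "bases \<noteq> {}"
  using rank_attained[of E] by (auto simp: bases_def)

lemma extend_indep:
  assumes "F \<in> \<Delta>" "G \<in> \<Delta>" "card F \<le> card G"
  shows "\<exists>H\<in>\<Delta>. F \<subseteq> H \<and> H \<subseteq> F \<union> G \<and> card H = card G"
  using assms
proof (induction "card G - card F" arbitrary: F)
  case 0
  then show ?case by auto
next
  case (Suc d)
  then have "card F < card G" by simp
  then obtain g where g: "g \<in> G - F" "insert g F \<in> \<Delta>" using augmentation Suc by metis
  have "card (insert g F) = Suc (card F)" using g finite_indep[OF Suc.prems(1)] by simp
  then have "\<exists>H\<in>\<Delta>. insert g F \<subseteq> H \<and> H \<subseteq> insert g F \<union> G \<and> card H = card G"
    using Suc g by (intro Suc.hyps) auto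
  then show ?case using g by blast
qed

lemma extend_to_basis:
  assumes "F \<in> \<Delta>" "B \<in> bases"
  shows "\<exists>H\<in>bases. F \<subseteq> H \<and> H \<subseteq> F \<union> B"
proof -
  have "card F \<le> card B"
    using basesD[OF assms(2)] card_le_rank[OF assms(1) indep_subset_ground[OF assms(1)]] by simp
  then show ?thesis using extend_indep[OF assms(1) basesD(1)[OF assms(2)]] basesD(4)[OF assms(2)]
    by (auto simp: bases_def)
qed

text \<open>The part of \<open>B\<close> at level \<open>t\<close> or above can be augmented by some
  \<open>g\<close> from \<open>F\<close> and then extended to a basis inside
  \<open>insert g B\<close>. By cardinality that basis omits exactly one element of
  \<open>B\<close>, and this element lies below level \<open>t\<close>.\<close>

lemma exchange_across_level:
  assumes B: "B \<in> bases" and F: "F \<in> \<Delta>" "\<And>x. x \<in> F \<Longrightarrow> t \<le> v x"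
    and less: "card {i\<in>B. t \<le> v i} < card F"
  shows "\<exists>i\<in>B. \<exists>j\<in>F - B. insert j (B - {i}) \<in> bases \<and> v i < (t::nat)"
proof -
  define Bt where "Bt = {i\<in>B. t \<le> v i}"
  have "Bt \<in> \<Delta>" using indep_subset[OF basesD(1)[OF B]] by (auto simp: Bt_def)
  then obtain g where g: "g \<in> F - Bt" "insert g Bt \<in> \<Delta>"
    using augmentation[of Bt F] F(1) less unfolding Bt_def[symmetric] by blast
  then have gB: "g \<notin> B" using F(2) by (auto simp: Bt_def)
  obtain H where H: "H \<in> bases" "insert g Bt \<subseteq> H" "H \<subseteq> insert g Bt \<union> B"
    using extend_to_basis[OF g(2) B] by blast
  then have sub: "H \<subseteq> insert g B" by (auto simp: Bt_def)
  have "card (insert g B) = Suc (card H)"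
    using gB basesD[OF B] basesD[OF H(1)] by simp
  then have "card (insert g B - H) = 1"
    using sub basesD(3)[OF H(1)] by (simp add: card_Diff_subset)
  then obtain i where i: "insert g B - H = {i}" by (auto simp: card_1_singleton_iff)
  then have "i \<in> B" "H = insert g (B - {i})" "i \<notin> Bt" using H(2) sub gB by auto
  then show ?thesis using g(1) gB H(1) by (auto simp: Bt_def)
qed

text \<open>Double counting of the points below the graph of \<open>v\<close>, by columns and by
  rows.\<close>

lemma sum_levels:
  fixes v :: "'b \<Rightarrow> nat"
  assumes "finite B" "\<And>i. i \<in> B \<Longrightarrow> v i \<le> M"
  shows "sum v B = (\<Sum>t\<in>{1..M}. card {i\<in>B. t \<le> v i})"
proof -
  have "v i = (\<Sum>t\<in>{1..M}. of_bool (t \<le> v i))" if "i \<in> B" for i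
  proof -
    have "{1..M} \<inter> {t. t \<le> v i} = {1..v i}" using assms(2)[OF that] by auto
    then show ?thesis by simp
  qed
  then have "sum v B = (\<Sum>i\<in>B. \<Sum>t\<in>{1..M}. of_bool (t \<le> v i))" by simp
  also have "\<dots> = (\<Sum>t\<in>{1..M}. \<Sum>i\<in>B. of_bool (t \<le> v i))" by (rule sum.swap)
  also have "\<dots> = (\<Sum>t\<in>{1..M}. card {i\<in>B. t \<le> v i})"
    using assms(1) by (intro sum.cong) (auto simp: Int_def)
  finally show ?thesis .
qed

text \<open>If \<open>B'\<close> had more elements than \<open>B\<close> above some level,
  \<open>exchange_across_level\<close> would produce an improving exchange. Hence \<open>B\<close>
  dominates level by level, and summing the levels compares the totals.\<close>

lemma locally_max_basis_max:
  fixes v :: "'v \<Rightarrow> nat"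
  assumes B: "B \<in> bases"
    and loc: "\<And>i j. i \<in> B \<Longrightarrow> j \<in> E - B \<Longrightarrow> insert j (B - {i}) \<in> bases \<Longrightarrow> v j \<le> v i"
    and B': "B' \<in> bases"
  shows "sum v B' \<le> sum v B"
proof -
  define M where "M = Max (insert 0 (v ` E))"
  have M: "v i \<le> M" if "i \<in> E" for i unfolding M_def using that finite_ground by (intro Max_ge) auto
  have "card {i\<in>B'. t \<le> v i} \<le> card {i\<in>B. t \<le> v i}" for t
  proof (rule ccontr)
    assume "\<not> ?thesis"
    then have less: "card {i\<in>B. t \<le> v i} < card {i\<in>B'. t \<le> v i}" by simp
    have "{i\<in>B'. t \<le> v i} \<in> \<Delta>" using indep_subset[OF basesD(1)[OF B']] by auto
    from exchange_across_level[OF B this _ less]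
    obtain i j where ij: "i \<in> B" "j \<in> {i\<in>B'. t \<le> v i} - B" "insert j (B - {i}) \<in> bases" "v i < t"
      by auto
    then have "v j \<le> v i" using loc basesD(2)[OF B'] by blast
    then show False using ij by auto
  qed
  moreover have "sum v B' = (\<Sum>t\<in>{1..M}. card {i\<in>B'. t \<le> v i})"
    using M basesD[OF B'] by (intro sum_levels) auto
  moreover have "sum v B = (\<Sum>t\<in>{1..M}. card {i\<in>B. t \<le> v i})"
    using M basesD[OF B] by (intro sum_levels) auto
  ultimately show ?thesis by (simp add: sum_mono)
qed

lemma sum_exchange:
  fixes w :: "'v \<Rightarrow> nat"
  assumes "B \<in> bases" "i \<in> B" "j \<in> E - B"
  shows "sum w (insert j (B - {i})) + w i = sum w B + w j"
    "sum w (E - insert j (B - {i})) + w j = sum w (E - B) + w i"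
proof -
  have fin: "finite B" "finite (E - B)" and "i \<in> E" using basesD[OF assms(1)] finite_ground assms by auto
  show "sum w (insert j (B - {i})) + w i = sum w B + w j"
    using fin assms by (simp add: sum.remove[of B i])
  have "E - insert j (B - {i}) = insert i (E - B - {j})" using assms \<open>i \<in> E\<close> by auto
  then show "sum w (E - insert j (B - {i})) + w j = sum w (E - B) + w i"
    using fin assms by (simp add: sum.remove[of "E - B" j])
qed

text \<open>For variables these are the exponents of monomials in the intersection of the
  \<open>m\<close>-th powers of the primes generated by the variables off a basis, which are the
  minimal primes of the Stanley-Reisner ideal.\<close>

definition symbolic_exponents :: "nat \<Rightarrow> ('v \<Rightarrow> nat) set" where
  "symbolic_exponents m = {a. \<forall>B\<in>bases. m \<le> sum a (E - B)}"

end

section \<open>Weights, optimal bases and cells of exponent vectors\<close>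

locale nat_matroid = matroid E \<Delta> for E :: "nat set" and \<Delta>
begin

text \<open>This exceeds every sum of distinct powers \<open>2 ^ i\<close> with
  \<open>i \<in> E\<close>. Division by \<open>tie\<close> therefore recovers the cost as quotient
  and the basis, in binary, as remainder.\<close>

definition tie :: nat where "tie = Suc (\<Sum>i\<in>E. 2 ^ i)"

text \<open>The sum of powers of two breaks ties: for a fixed exponent vector, distinct bases have distinct
  weights, while the order by \<open>sum a (E - B)\<close> is respected.\<close>

definition weight :: "nat set \<Rightarrow> (nat \<Rightarrow> nat) \<Rightarrow> nat" where
  "weight B a = tie * sum a (E - B) + (\<Sum>i\<in>B. 2 ^ i)"

lemma tie_bound: "B \<subseteq> E \<Longrightarrow> (\<Sum>i\<in>B. 2 ^ i) < tie"
  unfolding tie_def using sum_mono2[OF finite_ground, of B "\<lambda>i. 2 ^ i :: nat"] by (simp add: less_Suc_eq_le)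

lemma weight_mod: "B \<subseteq> E \<Longrightarrow> weight B a mod tie = (\<Sum>i\<in>B. 2 ^ i)"
  using tie_bound[of B] by (simp add: weight_def)

lemma weight_div: "B \<subseteq> E \<Longrightarrow> weight B a div tie = sum a (E - B)"
  using tie_bound[of B] by (simp add: weight_def)

lemma weight_inj:
  assumes "B \<subseteq> E" "B' \<subseteq> E" "weight B a = weight B' a'"
  shows "B = B'"
proof -
  have "set_encode B = set_encode B'"
    unfolding set_encode_def using weight_mod[OF assms(1), of a] weight_mod[OF assms(2), of a'] assms(3) by simp
  then show ?thesis
    using inj_on_set_encode assms(1,2) finite_ground finite_subset by (metis inj_onD mem_Collect_eq)
qed

lemma weight_mono: "(\<And>i. i \<in> E \<Longrightarrow> a i \<le> b i) \<Longrightarrow> weight B a \<le> weight B b"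
  unfolding weight_def by (intro add_mono mult_le_mono2 sum_mono) auto

definition optimal :: "nat set \<Rightarrow> (nat \<Rightarrow> nat) \<Rightarrow> bool" where
  "optimal B a \<longleftrightarrow> (\<forall>B'\<in>bases. weight B a \<le> weight B' a)"

definition swappable :: "nat set \<Rightarrow> nat \<Rightarrow> nat set" where
  "swappable B i = {j \<in> E - B. insert j (B - {i}) \<in> bases}"

text \<open>A basis that no single exchange improves is globally optimal. In this form optimality
  becomes, for each \<open>i \<in> B\<close>, a lower bound on \<open>a i\<close> that depends only
  on values off \<open>B\<close>; this is what makes the cells orthants.\<close>

lemma optimal_iff_local:
  assumes B: "B \<in> bases"
  shows "optimal B a \<longleftrightarrow> (\<forall>i\<in>B. \<forall>j\<in>swappable B i. tie * a j + 2 ^ i \<le> tie * a i + 2 ^ j)"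
proof (intro iffI ballI)
  fix i j assume opt: "optimal B a" and i: "i \<in> B" and j: "j \<in> swappable B i"
  have jE: "j \<in> E - B" and B': "insert j (B - {i}) \<in> bases" using j by (auto simp: swappable_def)
  have "weight B a \<le> weight (insert j (B - {i})) a" using opt B' by (simp add: optimal_def)
  moreover have "tie * sum a (E - insert j (B - {i})) + tie * a j = tie * sum a (E - B) + tie * a i"
    using sum_exchange(2)[OF B i jE, of a] by (metis distrib_left)
  moreover have "(\<Sum>i\<in>insert j (B - {i}). 2 ^ i) + 2 ^ i = (\<Sum>i\<in>B. 2 ^ i) + (2::nat) ^ j"
    using sum_exchange(1)[OF B i jE, of "\<lambda>i. 2 ^ i"] .
  ultimately show "tie * a j + 2 ^ i \<le> tie * a i + 2 ^ j" unfolding weight_def by linarith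
next
  assume loc: "\<forall>i\<in>B. \<forall>j\<in>swappable B i. tie * a j + 2 ^ i \<le> tie * a i + 2 ^ j"
  \<comment> \<open>Minimizing the weight is turned into maximizing \<open>sum v\<close>. Adding one
    to \<open>a i\<close> keeps the subtraction of \<open>2 ^ i\<close> from truncating, and it
    shifts the total of every basis by the same amount, since all bases have the same size.\<close>
  define v where "v i = tie * (a i + 1) - 2 ^ i" for i
  have le: "2 ^ i \<le> tie" if "i \<in> E" for i using tie_bound[of "{i}"] that by simp
  have v: "v i + 2 ^ i = tie * a i + tie" if "i \<in> E" for i
    using le[OF that] by (simp add: v_def)
  have total: "weight C a + sum v C = tie * sum a E + tie * matroid_rank \<Delta> E" if C: "C \<in> bases" for C
  proof -
    note C = basesD[OF C]
    have "(\<Sum>i\<in>C. 2 ^ i) + sum v C = (\<Sum>i\<in>C. tie * a i + tie)"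
      using v C(2) by (subst sum.distrib[symmetric]) (intro sum.cong, auto simp: add.commute)
    also have "\<dots> = tie * sum a C + tie * matroid_rank \<Delta> E"
      using C(4) by (simp add: sum.distrib sum_distrib_left)
    finally have 1: "(\<Sum>i\<in>C. 2 ^ i) + sum v C = tie * sum a C + tie * matroid_rank \<Delta> E" .
    have "sum a E = sum a (E - C) + sum a C" using sum.subset_diff[OF C(2) finite_ground] .
    then have "tie * sum a E = tie * sum a (E - C) + tie * sum a C" by (simp add: distrib_left)
    with 1 show ?thesis unfolding weight_def by linarith
  qed
  show "optimal B a" unfolding optimal_def
  proof
    fix B' assume B': "B' \<in> bases"
    have "sum v B' \<le> sum v B"
    proof (rule locally_max_basis_max[OF B _ B'])
      fix i j assume ij: "i \<in> B" "j \<in> E - B" "insert j (B - {i}) \<in> bases"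
      then have "tie * a j + 2 ^ i \<le> tie * a i + 2 ^ j" using loc by (auto simp: swappable_def)
      then show "v j \<le> v i" using v[of i] v[of j] ij basesD(2)[OF B] by fastforce
    qed
    then show "weight B a \<le> weight B' a" using total[OF B] total[OF B'] by linarith
  qed
qed

definition cell_base :: "nat set \<Rightarrow> (nat \<Rightarrow> nat) \<Rightarrow> nat \<Rightarrow> nat" where
  "cell_base B a i = (if i \<in> B
     then LEAST x. \<forall>j\<in>swappable B i. tie * a j + 2 ^ i \<le> tie * x + 2 ^ j else a i)"

text \<open>The exponent vectors with optimal basis \<open>B\<close> and prescribed values off \<open>B\<close> form a translate of
  the orthant spanned by \<open>B\<close>; its apex is \<^term>\<open>cell_base B a\<close>.\<close>

lemma cell_base_outside: "i \<notin> B \<Longrightarrow> cell_base B a i = a i"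
  by (simp add: cell_base_def)

lemma cell_base_inside:
  assumes B: "B \<in> bases" "i \<in> B"
  shows "\<forall>j\<in>swappable B i. tie * a j + 2 ^ i \<le> tie * cell_base B a i + 2 ^ j"
proof -
  \<comment> \<open>A value satisfying all inequalities must exist before \<open>LEAST\<close> can
    be used: \<open>sum a E\<close> dominates each \<open>a j\<close>, and the additional
    \<open>tie\<close> from the successor absorbs \<open>2 ^ i\<close>.\<close>
  have "\<forall>j\<in>swappable B i. tie * a j + 2 ^ i \<le> tie * Suc (sum a E) + 2 ^ j"
  proof
    fix j assume "j \<in> swappable B i"
    then have "a j \<le> sum a E" using finite_ground by (intro member_le_sum) (auto simp: swappable_def)
    then have "tie * a j \<le> tie * sum a E" by simp
    moreover have "2 ^ i \<le> tie" using tie_bound[of "{i}"] basesD(2)[OF B(1)] B(2) by auto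
    ultimately show "tie * a j + 2 ^ i \<le> tie * Suc (sum a E) + 2 ^ j"
      unfolding mult_Suc_right by linarith
  qed
  from LeastI[of "\<lambda>x. \<forall>j\<in>swappable B i. tie * a j + 2 ^ i \<le> tie * x + 2 ^ j", OF this]
  show ?thesis unfolding cell_base_def using B(2) by simp
qed

lemma optimal_cell_base:
  assumes B: "B \<in> bases"
  shows "optimal B (cell_base B a)"
  unfolding optimal_iff_local[OF B]
proof (intro ballI)
  fix i j assume ij: "i \<in> B" "j \<in> swappable B i"
  then have "cell_base B a j = a j" by (auto simp: swappable_def cell_base_outside)
  then show "tie * cell_base B a j + 2 ^ i \<le> tie * cell_base B a i + 2 ^ j"
    using cell_base_inside[OF B ij(1)] ij by auto
qed

text \<open>The apex coordinates are the least solutions of the local optimality inequalities, which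
  \<open>a\<close> satisfies as well. So the apex monomial divides every monomial of its
  cell.\<close>

lemma cell_base_le:
  assumes B: "B \<in> bases" and opt: "optimal B a"
    and b: "\<And>i. i \<in> E - B \<Longrightarrow> b i = a i" and i: "i \<in> E"
  shows "cell_base B b i \<le> a i"
proof (cases "i \<in> B")
  case True
  have "\<forall>j\<in>swappable B i. tie * b j + 2 ^ i \<le> tie * a i + 2 ^ j"
    using opt[unfolded optimal_iff_local[OF B]] True b by (auto simp: swappable_def)
  then show ?thesis unfolding cell_base_def using True by (simp add: Least_le)
next
  case False
  then show ?thesis using b i by (simp add: cell_base_outside)
qed

end

text \<open>The bound on \<open>card D\<close> is written additively to avoid truncated subtraction.
  With rank \<open>k\<close>, the set \<open>D\<close> together with \<open>j\<close> has at most
  \<open>n - k + 1\<close> elements, the length allowed for the regular sequences of the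
  theorem.\<close>

locale matroid_subring_family = nat_matroid E \<Delta> + subring_family A E f
  for E :: "nat set" and \<Delta> and A :: "'a::comm_ring_1 set" and f +
  assumes nonzerodivisor: "D \<subseteq> E \<Longrightarrow> card D + matroid_rank \<Delta> E \<le> card E \<Longrightarrow> j \<in> E - D \<Longrightarrow>
      r \<in> A \<Longrightarrow> f j * r \<in> Q D \<Longrightarrow> r \<in> Q D"
begin

lemma card_cobasis: "B \<in> bases \<Longrightarrow> card (E - B) + matroid_rank \<Delta> E = card E"
  using basesD[of B] finite_ground card_mono[of E B] by (simp add: card_Diff_subset)

lemma nonzerodivisor_cobasis:
  "B \<in> bases \<Longrightarrow> j \<in> B \<Longrightarrow> r \<in> A \<Longrightarrow> f j * r \<in> Q (E - B) \<Longrightarrow> r \<in> Q (E - B)"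
  using nonzerodivisor[of "E - B" j r] card_cobasis[of B] basesD(2)[of B] by auto

lemma quasi_regular_cobasis: "B \<in> bases \<Longrightarrow> quasi_regular (E - B)"
proof (rule quasi_regularI)
  fix D' e r assume B: "B \<in> bases" and D': "insert e D' \<subseteq> E - B" "e \<notin> D'" "r \<in> A" "f e * r \<in> Q D'"
  have "card D' \<le> card (E - B)" using D' finite_ground by (intro card_mono) auto
  then show "r \<in> Q D'" using nonzerodivisor[of D' e r] D' card_cobasis[OF B] by auto
qed auto

lemma nonzerodivisor_monom:
  assumes B: "B \<in> bases" and r: "r \<in> A" "monom_at f B a * r \<in> Q (E - B)"
  shows "r \<in> Q (E - B)"
proof -
  have pow: "s \<in> Q (E - B)" if "j \<in> B" "s \<in> A" "f j ^ n * s \<in> Q (E - B)" for j s n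
    using that(3)
  proof (induction n)
    case (Suc n)
    have "f j ^ n * s \<in> A" using that basesD(2)[OF B] f_mem by auto
    then show ?case using Suc nonzerodivisor_cobasis[OF B that(1), of "f j ^ n * s"]
      by (simp add: mult.assoc)
  qed simp
  have "r \<in> Q (E - B)" if "finite C" "C \<subseteq> B" "r \<in> A" "(\<Prod>i\<in>C. f i ^ a i) * r \<in> Q (E - B)" for C r
    using that
  proof (induction C arbitrary: r rule: finite_induct)
    case (insert j C)
    have "(\<Prod>i\<in>C. f i ^ a i) * r \<in> A"
      using insert.prems basesD(2)[OF B] f_mem by (intro mult_mem prod_mem power_mem) auto
    then have "(\<Prod>i\<in>C. f i ^ a i) * r \<in> Q (E - B)"
      using pow[of j _ "a j"] insert by (simp add: mult.assoc)
    then show ?case using insert by auto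
  qed simp
  then show ?thesis using r basesD(3)[OF B] unfolding monom_at_def by blast
qed

section \<open>The filtration by weights and the intersection of powers\<close>

definition monomial_ideal :: "(nat \<Rightarrow> nat) set \<Rightarrow> 'a set" where
  "monomial_ideal K = ideal_span (monom_at f E ` K)"

lemma is_ideal_monomial_ideal: "is_ideal (monomial_ideal K)"
  unfolding monomial_ideal_def using monom_at_mem by (intro is_ideal_span) auto

lemma monom_at_split: "B \<subseteq> E \<Longrightarrow> monom_at f E a = monom_at f (E - B) a * monom_at f B a"
  unfolding monom_at_def using prod.subset_diff[OF _ finite_ground] by blast

lemma monom_at_dvd:
  assumes "\<And>i. i \<in> E \<Longrightarrow> b i \<le> a i"
  obtains c where "c \<in> A" "monom_at f E a = c * monom_at f E b"
proof
  show "monom_at f E (\<lambda>i. a i - b i) \<in> A" using monom_at_mem by blast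
  have "monom_at f E a = monom_at f E (\<lambda>i. (a i - b i) + b i)"
    unfolding monom_at_def using assms by (intro prod.cong) auto
  then show "monom_at f E a = monom_at f E (\<lambda>i. a i - b i) * monom_at f E b"
    by (simp add: monom_at_add)
qed

text \<open>The number \<open>v\<close> encodes the cost \<open>s\<close> and the basis
  \<open>B\<close>. Generators lost when passing from \<open>v\<close> to \<open>Suc v\<close> are
  multiples of apex monomials with optimal basis \<open>B\<close> and cost \<open>s\<close>.
  Quasi-regularity and cancellation of the factors from \<open>B\<close> force their coefficients
  into \<open>Q (E - B)\<close>, and multiplying an apex monomial by \<open>f i\<close> with
  \<open>i\<close> off \<open>B\<close> lands in the smaller ideal.\<close>

lemma cell_step:
  assumes B: "B \<in> bases" and v: "v = tie * s + (\<Sum>i\<in>B. 2 ^ i)"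
    and g: "g \<in> monomial_ideal {a. \<forall>B\<in>bases. v \<le> weight B a}" and gB: "g \<in> Qpow (E - B) (Suc s)"
  shows "g \<in> monomial_ideal {a. \<forall>B\<in>bases. Suc v \<le> weight B a}"
proof -
  define K where "K = {a. \<forall>B\<in>bases. Suc v \<le> weight B a}"
  note BE = basesD(2)[OF B]
  define cells where "cells = exponents (E - B) s"
  have fin_cells: "finite cells" unfolding cells_def using finite_ground by (intro finite_exponents) auto
  define cb where "cb b = monom_at f E (cell_base B b)" for b
  have cbA: "cb b \<in> A" for b unfolding cb_def using monom_at_mem by blast
  have ideal: "is_ideal (ideal_span (monom_at f E ` K \<union> cb ` cells))"
    using monom_at_mem cbA by (intro is_ideal_span) auto
  have "monom_at f E a \<in> ideal_span (monom_at f E ` K \<union> cb ` cells)" if a: "\<forall>B\<in>bases. v \<le> weight B a" for a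
  proof (cases "a \<in> K")
    case True
    then show ?thesis by (intro ideal_span_base) auto
  next
    case False
    \<comment> \<open>A generator outside \<open>K\<close> has a basis of weight exactly
      \<open>v\<close>, and the remainder modulo \<open>tie\<close> identifies this basis as
      \<open>B\<close>. As \<open>v\<close> is the least weight of \<open>a\<close>, the basis
      \<open>B\<close> is optimal for \<open>a\<close>.\<close>
    then obtain B' where B': "B' \<in> bases" "weight B' a < Suc v" by (auto simp: K_def)
    then have w: "weight B' a = v" using a by fastforce
    have "(\<Sum>i\<in>B'. 2 ^ i) = (\<Sum>i\<in>B. (2::nat) ^ i)"
      using weight_mod[OF basesD(2)[OF B'(1)], of a] tie_bound[OF BE] w v by simp
    then have "B' = B"
      using inj_on_set_encode basesD(3)[OF B] basesD(3)[OF B'(1)]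
      unfolding set_encode_def inj_on_def by blast
    then have wB: "weight B a = v" using w by simp
    then have opt: "optimal B a" using a by (simp add: optimal_def)
    have s: "sum a (E - B) = s"
      using weight_div[OF BE, of a] tie_bound[OF BE] unfolding wB v by simp
    define b where "b i = (if i \<in> E - B then a i else 0)" for i
    have "b \<in> cells" unfolding cells_def exponents_def using s by (auto simp: b_def)
    moreover have "cell_base B b i \<le> a i" if "i \<in> E" for i
      using that by (intro cell_base_le[OF B opt]) (auto simp: b_def)
    then obtain c where "c \<in> A" "monom_at f E a = c * cb b"
      unfolding cb_def using monom_at_dvd by metis
    ultimately show ?thesis
      using is_idealD(4)[OF ideal] ideal_span_base by (metis UnI2 imageI)
  qed
  then have "monomial_ideal {a. \<forall>B\<in>bases. v \<le> weight B a} \<subseteq> ideal_span (monom_at f E ` K \<union> cb ` cells)"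
    unfolding monomial_ideal_def using ideal by (intro ideal_span_least) auto
  then obtain h y where hy: "h \<in> ideal_span (monom_at f E ` K)" "y \<in> ideal_span (cb ` cells)" "g = h + y"
    using ideal_span_Un g by blast
  obtain u where u: "\<forall>b. u b \<in> A" "y = (\<Sum>b\<in>cells. u b * cb b)"
    using ideal_span_image_finite[OF hy(2) fin_cells] by blast
  have EB: "E - B \<subseteq> E" by auto
  have "h \<in> Qpow (E - B) (Suc s)"
  proof -
    have "monom_at f E a \<in> Qpow (E - B) (Suc s)" if "a \<in> K" for a
    proof -
      have "Suc v \<le> weight B a" using that B by (auto simp: K_def)
      \<comment> \<open>Both \<open>v\<close> and the weight of \<open>B\<close> contain the same
        binary code of \<open>B\<close>, so the strict increase must come from the cost.\<close>
      then have "tie * s < tie * sum a (E - B)" unfolding v weight_def by linarith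
      then have "Suc s \<le> sum a (E - B)" by simp
      then show ?thesis
        using monom_at_split[OF BE, of a] monom_at_in_Qpow[OF EB] monom_at_mem[OF BE]
          is_idealD(5)[OF is_ideal_Qpow[OF EB]] by metis
    qed
    then show ?thesis using ideal_span_least[OF is_ideal_Qpow[OF EB], of "monom_at f E ` K"] hy(1) by blast
  qed
  then have yQ: "y \<in> Qpow (E - B) (Suc s)"
    using gB hy(3) is_idealD(7)[OF is_ideal_Qpow[OF EB]] by (metis add_diff_cancel_left')
  \<comment> \<open>The factors belonging to \<open>B\<close> are absorbed into the coefficients,
    which makes \<open>y\<close> a form of degree \<open>s\<close> in the \<open>f i\<close> with
    \<open>i\<close> off \<open>B\<close>.\<close>
  define w where "w b = u b * monom_at f B (cell_base B b)" for b
  have wA: "w b \<in> A" for b unfolding w_def using u monom_at_mem[OF BE] by auto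
  have "monom_at f (E - B) (cell_base B b) = monom_at f (E - B) b" for b
    unfolding monom_at_def by (intro prod.cong) (auto simp: cell_base_outside)
  then have "y = (\<Sum>b\<in>exponents (E - B) s. w b * monom_at f (E - B) b)"
    unfolding u(2) cb_def w_def cells_def monom_at_split[OF BE] by (simp add: algebra_simps)
  then have "\<forall>b\<in>cells. w b \<in> Q (E - B)"
    using quasi_regular_cobasis[OF B, unfolded quasi_regular_def, rule_format, of w s] wA yQ
    unfolding cells_def by blast
  then have uQ: "u b \<in> Q (E - B)" if "b \<in> cells" for b
    using nonzerodivisor_monom[OF B, of "u b"] u(1) that unfolding w_def by (metis mult.commute)
  note KI = is_ideal_monomial_ideal[of K]
  have "u b * cb b \<in> monomial_ideal K" if b: "b \<in> cells" for b
  proof (rule ideal_span_mult_subset[OF KI uQ[OF b, unfolded Q_def], of "cb b" "{cb b}"])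
    fix g h assume "g \<in> f ` (E - B)" "h \<in> {cb b}"
    then obtain i where i: "i \<in> E - B" "g = f i" "h = cb b" by auto
    \<comment> \<open>Raising an exponent off \<open>B\<close> raises the cost of \<open>B\<close>.
      Every other basis has weight at least \<open>v\<close> at the apex, and not \<open>v\<close>
      itself because the remainders differ, so all weights exceed \<open>v\<close>.\<close>
    let ?a = "(cell_base B b)(i := Suc (cell_base B b i))"
    have sb: "sum (cell_base B b) (E - B) = s"
    proof -
      have "sum (cell_base B b) (E - B) = sum b (E - B)"
        by (intro sum.cong) (auto simp: cell_base_outside)
      then show ?thesis using b unfolding cells_def exponents_def by simp
    qed
    have wb: "weight B (cell_base B b) = v" unfolding weight_def v sb ..
    have "?a \<in> K"
      unfolding K_def
    proof (intro CollectI ballI)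
      fix B' assume B': "B' \<in> bases"
      have mono: "weight B' (cell_base B b) \<le> weight B' ?a" by (rule weight_mono) auto
      show "Suc v \<le> weight B' ?a"
      proof (cases "B' = B")
        case True
        have "sum ?a (E - B) = Suc s"
          using i(1) sb finite_ground by (simp add: sum.remove[of "E - B" i])
        then show ?thesis unfolding True weight_def v tie_def by simp
      next
        case False
        have "v \<le> weight B' (cell_base B b)"
          using optimal_cell_base[OF B, of b] B' wb unfolding optimal_def by metis
        moreover have "weight B' (cell_base B b) \<noteq> v"
          using weight_inj[OF basesD(2)[OF B'] BE] False wb by metis
        ultimately show ?thesis using mono by linarith
      qed
    qed
    then have "monom_at f E ?a \<in> monomial_ideal K"
      unfolding monomial_ideal_def by (intro ideal_span_base) auto
    then show "g * h \<in> monomial_ideal K"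
      using i monom_at_upd[OF finite_ground, of i f] unfolding cb_def by simp
  qed (use f_mem cbA ideal_span_base in auto)
  then have "y \<in> monomial_ideal K"
    unfolding u(2) by (rule is_ideal_sum[OF KI])
  then show ?thesis
    using hy is_idealD(3)[OF KI] unfolding monomial_ideal_def K_def by blast
qed

text \<open>The filtration starts at weight zero with the whole ring and is descended one unit of
  weight at a time. At weight \<open>tie * m\<close>, division by \<open>tie\<close> shows that
  every cost is at least \<open>m\<close>.\<close>

theorem Inter_Qpow_subset_monomial_ideal:
  assumes gA: "g \<in> A" and g: "\<And>B. B \<in> bases \<Longrightarrow> g \<in> Qpow (E - B) m"
  shows "g \<in> monomial_ideal (symbolic_exponents m)"
proof -
  have "g \<in> monomial_ideal {a. \<forall>B\<in>bases. v \<le> weight B a}" if "v \<le> tie * m" for v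
    using that
  proof (induction v)
    case 0
    have "(\<lambda>_. 0) \<in> {a. \<forall>B\<in>bases. 0 \<le> weight B a}" by simp
    then have "1 \<in> monomial_ideal {a. \<forall>B\<in>bases. 0 \<le> weight B a}"
      unfolding monomial_ideal_def by (intro ideal_span_base) (rule image_eqI, rule monom_at_zero[symmetric])
    from is_idealD(4)[OF is_ideal_monomial_ideal gA this] show ?case by (simp only: mult_1_right)
  next
    case (Suc v)
    then have IH: "g \<in> monomial_ideal {a. \<forall>B\<in>bases. v \<le> weight B a}" by simp
    show ?case
    proof (cases "\<exists>B\<in>bases. v mod tie = (\<Sum>i\<in>B. 2 ^ i)")
      case True
      then obtain B where B: "B \<in> bases" "v mod tie = (\<Sum>i\<in>B. 2 ^ i)" by blast
      have "v div tie < m" using Suc.prems by (simp add: div_less_iff_less_mult tie_def mult.commute)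
      then have "g \<in> Qpow (E - B) (Suc (v div tie))"
        using g[OF B(1)] Qpow_antimono[of "E - B" "Suc (v div tie)" m] by auto
      from cell_step[OF B(1) _ IH this] show ?thesis using B(2) by (metis mult_div_mod_eq)
    next
      case False
      \<comment> \<open>When the remainder of \<open>v\<close> is not the code of a basis, no weight
        equals \<open>v\<close> and the two ideals of the filtration coincide.\<close>
      then have "weight B a \<noteq> v" if "B \<in> bases" for a B
        using weight_mod[OF basesD(2)[OF that]] that by metis
      then have "{a. \<forall>B\<in>bases. v \<le> weight B a} = {a. \<forall>B\<in>bases. Suc v \<le> weight B a}"
        by (auto simp: Suc_le_eq order_less_le)
      then show ?thesis using IH by simp
    qed
  qed
  then have "g \<in> monomial_ideal {a. \<forall>B\<in>bases. tie * m \<le> weight B a}" by simp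
  moreover have "{a. \<forall>B\<in>bases. tie * m \<le> weight B a} \<subseteq> symbolic_exponents m"
  proof
    fix a assume a: "a \<in> {a. \<forall>B\<in>bases. tie * m \<le> weight B a}"
    have "m \<le> sum a (E - B)" if "B \<in> bases" for B
    proof -
      have "tie * m div tie \<le> weight B a div tie" using a that by (intro div_le_mono) auto
      moreover have "tie * m div tie = m" by (rule nonzero_mult_div_cancel_left) (simp add: tie_def)
      ultimately show ?thesis using weight_div[OF basesD(2)[OF that], of a] by simp
    qed
    then show "a \<in> symbolic_exponents m" by (auto simp: symbolic_exponents_def)
  qed
  ultimately show ?thesis
    unfolding monomial_ideal_def using ideal_span_mono[OF image_mono] by blast
qed

end

section \<open>Symbolic powers of the circuit ideal\<close>

context subring_carrier
begin

definition prime_ideal :: "'a set \<Rightarrow> bool" where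
  "prime_ideal P \<longleftrightarrow> is_ideal P \<and> 1 \<notin> P \<and> (\<forall>p\<in>A. \<forall>q\<in>A. p * q \<in> P \<longrightarrow> p \<in> P \<or> q \<in> P)"

definition colon :: "'a set \<Rightarrow> 'a \<Rightarrow> 'a set" where
  "colon K x = {a \<in> A. a * x \<in> K}"

definition assoc_prime :: "'a set \<Rightarrow> 'a set \<Rightarrow> bool" where
  "assoc_prime K P \<longleftrightarrow> prime_ideal P \<and> (\<exists>x\<in>A. P = colon K x)"

text \<open>Membership of \<open>a / 1\<close> in the extension to the localization at
  \<open>P\<close> is expressed by a multiplier outside \<open>P\<close>, so fractions are avoided
  until the final translation.\<close>

definition symb_pow :: "'a set \<Rightarrow> nat \<Rightarrow> 'a set" where
  "symb_pow K s = {a \<in> A. \<forall>P. assoc_prime K P \<longrightarrow> (\<exists>u\<in>A - P. u * a \<in> ideal_pow K s)}"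

lemma is_ideal_colon: "is_ideal K \<Longrightarrow> x \<in> A \<Longrightarrow> is_ideal (colon K x)"
  by (subst is_ideal_def) (auto simp: colon_def distrib_right mult.assoc is_idealD)

lemma prime_ideal_prod:
  assumes P: "prime_ideal P" and "\<And>i. i \<in> F \<Longrightarrow> g i \<in> A" "(\<Prod>i\<in>F. g i) \<in> P"
  shows "\<exists>i\<in>F. g i \<in> P"
  using assms(2,3)
proof (induction F rule: infinite_finite_induct)
  case (insert i F)
  then have "g i * (\<Prod>i\<in>F. g i) \<in> P" "g i \<in> A" "(\<Prod>i\<in>F. g i) \<in> A" by auto
  then show ?case using P insert unfolding prime_ideal_def by blast
qed (use P in \<open>auto simp: prime_ideal_def\<close>)

lemma prime_ideal_power: "prime_ideal P \<Longrightarrow> g \<in> A \<Longrightarrow> g ^ n \<in> P \<Longrightarrow> g \<in> P"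
  using prime_ideal_prod[of P "{..<n}" "\<lambda>_. g"] by auto

text \<open>The set is the contraction of the extension of \<open>K\<close> to the localization at
  \<open>P\<close>. Being an ideal, it can be tested on generators.\<close>

lemma is_ideal_saturation:
  assumes P: "prime_ideal P" and K: "is_ideal K"
  shows "is_ideal {g \<in> A. \<exists>u\<in>A - P. u * g \<in> K}"
  unfolding is_ideal_def
proof (intro conjI ballI)
  show "0 \<in> {g \<in> A. \<exists>u\<in>A - P. u * g \<in> K}"
    using P is_idealD(2)[OF K] by (auto simp: prime_ideal_def intro!: bexI[of _ 1])
next
  fix x y assume "x \<in> {g \<in> A. \<exists>u\<in>A - P. u * g \<in> K}" "y \<in> {g \<in> A. \<exists>u\<in>A - P. u * g \<in> K}"
  then obtain u v where uv: "u \<in> A - P" "u * x \<in> K" "v \<in> A - P" "v * y \<in> K" and xy: "x \<in> A" "y \<in> A"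
    by auto
  have "u * v \<in> A - P" using uv P by (auto simp: prime_ideal_def)
  moreover have "v * (u * x) + u * (v * y) \<in> K" using uv K by (simp add: is_idealD)
  then have "(u * v) * (x + y) \<in> K" by (simp add: algebra_simps)
  ultimately show "x + y \<in> {g \<in> A. \<exists>u\<in>A - P. u * g \<in> K}" using xy by blast
next
  fix a x assume a: "a \<in> A" and "x \<in> {g \<in> A. \<exists>u\<in>A - P. u * g \<in> K}"
  then obtain u where u: "u \<in> A - P" "u * x \<in> K" and x: "x \<in> A" by auto
  have "a * (u * x) \<in> K" using u K a by (simp add: is_idealD)
  then have "u * (a * x) \<in> K" by (simp add: algebra_simps)
  then show "a * x \<in> {g \<in> A. \<exists>u\<in>A - P. u * g \<in> K}" using u a x by blast
qed auto

end

section \<open>Circuits and the ideal they generate\<close>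

context matroid
begin

lemma dependent_contains_circuit:
  assumes "U \<subseteq> E" "U \<notin> \<Delta>"
  shows "\<exists>C\<in>circuits E \<Delta>. C \<subseteq> U"
proof -
  have "finite U" using assms finite_ground finite_subset by blast
  then show ?thesis using assms
  proof (induction U rule: finite_psubset_induct)
    case (psubset U)
    show ?case
    proof (cases "\<exists>D. D \<subset> U \<and> D \<notin> \<Delta>")
      case True
      then obtain D where D: "D \<subset> U" "D \<notin> \<Delta>" by blast
      then have "D \<subseteq> E" using psubset.prems by blast
      from psubset.IH[OF D(1) this D(2)] D(1) show ?thesis by blast
    next
      case False
      then have "U \<in> circuits E \<Delta>" using psubset.prems by (auto simp: circuits_def)
      then show ?thesis by blast
    qed
  qed
qed

lemma circuit_not_subset_basis: "C \<in> circuits E \<Delta> \<Longrightarrow> B \<in> bases \<Longrightarrow> \<not> C \<subseteq> B"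
  using indep_subset basesD(1) by (auto simp: circuits_def)

text \<open>An independent support would lie in a basis, whose cost is then zero. Conversely a
  circuit is contained in no basis, so it meets the complement of each one.\<close>

lemma symbolic_exponents_one:
  "a \<in> symbolic_exponents 1 \<longleftrightarrow> (\<exists>C\<in>circuits E \<Delta>. \<forall>i\<in>C. 0 < a i)"
proof
  assume a: "a \<in> symbolic_exponents 1"
  define U where "U = {i\<in>E. 0 < a i}"
  have "U \<notin> \<Delta>"
  proof
    assume "U \<in> \<Delta>"
    then obtain B where B: "B \<in> bases" "U \<subseteq> B" using extend_to_basis bases_nonempty by blast
    then have "sum a (E - B) = 0" by (auto simp: U_def intro!: sum.neutral)
    then show False using a B(1) by (auto simp: symbolic_exponents_def)
  qed
  then obtain C where "C \<in> circuits E \<Delta>" "C \<subseteq> U" using dependent_contains_circuit[of U] by (auto simp: U_def)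
  then show "\<exists>C\<in>circuits E \<Delta>. \<forall>i\<in>C. 0 < a i" by (auto simp: U_def)
next
  assume "\<exists>C\<in>circuits E \<Delta>. \<forall>i\<in>C. 0 < a i"
  then obtain C where C: "C \<in> circuits E \<Delta>" "\<forall>i\<in>C. 0 < a i" by blast
  show "a \<in> symbolic_exponents 1" unfolding symbolic_exponents_def
  proof (intro CollectI ballI)
    fix B assume "B \<in> bases"
    then obtain i where i: "i \<in> C" "i \<notin> B" using circuit_not_subset_basis C(1) by blast
    then have "i \<in> E - B" using C(1) by (auto simp: circuits_def)
    then have "a i \<le> sum a (E - B)" using finite_ground by (intro member_le_sum) auto
    moreover have "0 < a i" using C(2) i(1) by blast
    ultimately show "1 \<le> sum a (E - B)" by linarith
  qed
qed

end

text \<open>The assumption is the form in which Noetherianity enters: each nonzero class modulo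
  \<open>K\<close> has a multiple whose annihilator is prime.\<close>

locale noetherian_matroid_family = matroid_subring_family E \<Delta> A f
  for E :: "nat set" and \<Delta> and A :: "'a::comm_ring_1 set" and f +
  assumes prime_colon_above: "is_ideal K \<Longrightarrow> c \<in> A \<Longrightarrow> c \<notin> K \<Longrightarrow> \<exists>y\<in>A. prime_ideal (colon K (c * y))"
begin

definition circuit_ideal :: "'a set" where
  "circuit_ideal = ideal_span {\<Prod>i\<in>C. f i | C. C \<in> circuits E \<Delta>}"

lemma prod_circuit_mem: "C \<in> circuits E \<Delta> \<Longrightarrow> (\<Prod>i\<in>C. f i) \<in> A"
  using f_mem by (auto simp: circuits_def)

lemma is_ideal_circuit_ideal: "is_ideal circuit_ideal"
  unfolding circuit_ideal_def using prod_circuit_mem by (intro is_ideal_span) auto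

lemma monom_at_indicator:
  assumes "C \<subseteq> E"
  shows "monom_at f E (indicator C) = (\<Prod>i\<in>C. f i)"
proof -
  have "monom_at f E (indicator C) = (\<Prod>i\<in>E. if i \<in> C then f i else 1)"
    unfolding monom_at_def by (intro prod.cong) (auto simp: indicator_def)
  also have "\<dots> = (\<Prod>i\<in>C. f i)"
    using prod.inter_restrict[OF finite_ground, of f C] assms by (simp add: Int_absorb1)
  finally show ?thesis .
qed

lemma circuit_ideal_eq: "circuit_ideal = monomial_ideal (symbolic_exponents 1)"
proof (intro equalityI)
  show "circuit_ideal \<subseteq> monomial_ideal (symbolic_exponents 1)"
    unfolding circuit_ideal_def
  proof (rule ideal_span_least[OF is_ideal_monomial_ideal], safe)
    fix C assume C: "C \<in> circuits E \<Delta>"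
    then have "indicator C \<in> symbolic_exponents 1" unfolding symbolic_exponents_one
      by (intro bexI[of _ C]) auto
    then have "monom_at f E (indicator C) \<in> monomial_ideal (symbolic_exponents 1)"
      unfolding monomial_ideal_def by (intro ideal_span_base) auto
    then show "(\<Prod>i\<in>C. f i) \<in> monomial_ideal (symbolic_exponents 1)"
      using monom_at_indicator C by (simp add: circuits_def)
  qed
  show "monomial_ideal (symbolic_exponents 1) \<subseteq> circuit_ideal"
    unfolding monomial_ideal_def
  proof (rule ideal_span_least[OF is_ideal_circuit_ideal], rule image_subsetI)
    fix a assume "a \<in> symbolic_exponents 1"
    then obtain C where C: "C \<in> circuits E \<Delta>" "\<forall>i\<in>C. 0 < a i" unfolding symbolic_exponents_one by blast
    then have CE: "C \<subseteq> E" by (auto simp: circuits_def)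
    obtain c where c: "c \<in> A" "monom_at f E a = c * monom_at f E (indicator C)"
    proof (rule monom_at_dvd[of "indicator C" a])
      show "indicator C i \<le> a i" for i using C(2) by (auto simp: indicator_def Suc_le_eq)
    qed
    have "(\<Prod>i\<in>C. f i) \<in> circuit_ideal"
      unfolding circuit_ideal_def using C(1) by (intro ideal_span_base) auto
    then show "monom_at f E a \<in> circuit_ideal"
      using c monom_at_indicator[OF CE] is_idealD(4)[OF is_ideal_circuit_ideal] by simp
  qed
qed

lemma Q_subset_Qpow_one: "D \<subseteq> E \<Longrightarrow> Q D \<subseteq> Qpow D 1"
  using Qpow_Suc_mem[of D 1 0] Qpow_zero by auto

lemma monomial_ideal_subset_Qpow:
  assumes "B \<in> bases"
  shows "monomial_ideal (symbolic_exponents m) \<subseteq> Qpow (E - B) m"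
  unfolding monomial_ideal_def
proof (rule ideal_span_least[OF is_ideal_Qpow], force, rule image_subsetI)
  fix a assume "a \<in> symbolic_exponents m"
  then have "m \<le> sum a (E - B)" using assms by (auto simp: symbolic_exponents_def)
  then have "monom_at f (E - B) a \<in> Qpow (E - B) m" by (intro monom_at_in_Qpow) auto
  then show "monom_at f E a \<in> Qpow (E - B) m"
    unfolding monom_at_split[OF basesD(2)[OF assms]]
    using is_idealD(5)[OF is_ideal_Qpow] monom_at_mem[OF basesD(2)[OF assms]] by auto
qed

lemma Qpow_one_subset: "D \<subseteq> E \<Longrightarrow> Qpow D 1 \<subseteq> Q D"
proof
  fix x assume D: "D \<subseteq> E" and "x \<in> Qpow D 1"
  then obtain v where v: "\<forall>\<alpha>. v \<alpha> \<in> Q D" "x = (\<Sum>\<alpha>\<in>exponents D 0. v \<alpha> * monom_at f D \<alpha>)"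
    using Qpow_Suc_repr[OF D, of x 0] by auto
  show "x \<in> Q D"
    unfolding v(2) using v(1) monom_at_mem[OF D]
    by (intro is_ideal_sum[OF is_ideal_Q[OF D]] is_idealD(5)[OF is_ideal_Q[OF D]]) auto
qed

lemma circuit_ideal_subset_Q: "B \<in> bases \<Longrightarrow> circuit_ideal \<subseteq> Q (E - B)"
  using monomial_ideal_subset_Qpow[of B 1] Qpow_one_subset[of "E - B"] unfolding circuit_ideal_eq by blast

lemma circuit_ideal_eq_Inter: "x \<in> circuit_ideal \<longleftrightarrow> x \<in> A \<and> (\<forall>B\<in>bases. x \<in> Q (E - B))"
  using circuit_ideal_subset_Q is_idealD(1)[OF is_ideal_circuit_ideal]
    Inter_Qpow_subset_monomial_ideal[of x 1] Q_subset_Qpow_one unfolding circuit_ideal_eq by blast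

text \<open>Adding an element to a basis gives a dependent set. Thus \<open>circuit_ideal\<close>
  and \<open>Q (E - B)\<close> agree once the \<open>f i\<close> with \<open>i \<in> B\<close> are
  inverted, which links the associated primes of the two ideals.\<close>

lemma basis_monom_mult_Q:
  assumes B: "B \<in> bases" and x: "x \<in> Q (E - B)"
  shows "(\<Prod>i\<in>B. f i) * x \<in> circuit_ideal"
proof -
  note BE = basesD(2)[OF B]
  have pB: "(\<Prod>i\<in>B. f i) \<in> A" using BE f_mem by auto
  have "(\<Prod>i\<in>B. f i) * f j \<in> circuit_ideal" if j: "j \<in> E - B" for j
  proof -
    have "indicator (insert j B) \<in> symbolic_exponents 1"
      unfolding symbolic_exponents_def
    proof (intro CollectI ballI)
      fix B' assume B': "B' \<in> bases"
      have "card (insert j B) = Suc (card B')"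
        using j basesD[OF B] basesD[OF B'] by simp
      then have "\<not> insert j B \<subseteq> B'" using card_mono[OF basesD(3)[OF B'], of "insert j B"] by linarith
      then obtain i where i: "i \<in> insert j B" "i \<notin> B'" by blast
      then have "i \<in> E - B'" using j BE by auto
      then have "indicator (insert j B) i \<le> sum (indicator (insert j B) :: nat \<Rightarrow> nat) (E - B')"
        using finite_ground by (intro member_le_sum) auto
      then show "1 \<le> sum (indicator (insert j B) :: nat \<Rightarrow> nat) (E - B')" using i(1) by simp
    qed
    then have "monom_at f E (indicator (insert j B)) \<in> circuit_ideal"
      unfolding circuit_ideal_eq monomial_ideal_def by (intro ideal_span_base) auto
    moreover have "insert j B \<subseteq> E" using j BE by auto
    from monom_at_indicator[OF this]
    have "monom_at f E (indicator (insert j B)) = f j * (\<Prod>i\<in>B. f i)"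
      using j basesD(3)[OF B] by simp
    ultimately show ?thesis by (simp add: mult.commute)
  qed
  then have "g * h \<in> circuit_ideal" if "g \<in> {\<Prod>i\<in>B. f i}" "h \<in> f ` (E - B)" for g h
    using that by blast
  from ideal_span_mult_subset[OF is_ideal_circuit_ideal _ x[unfolded Q_def] _ _ this]
  show ?thesis using pB f_mem ideal_span_base[of "\<Prod>i\<in>B. f i" "{\<Prod>i\<in>B. f i}"] by auto
qed

lemma prod_basis_cancel:
  assumes B: "B \<in> bases" and r: "r \<in> A" "(\<Prod>i\<in>B. f i) * r \<in> Q (E - B)"
  shows "r \<in> Q (E - B)"
  using nonzerodivisor_monom[OF B r(1), of "\<lambda>_. 1"] r(2) by (simp add: monom_at_def)

lemma ideal_pow_subset_Qpow: "B \<in> bases \<Longrightarrow> ideal_pow circuit_ideal s \<subseteq> Qpow (E - B) s"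
proof (induction s)
  case 0
  show ?case using Qpow_zero[of "E - B"] by auto
next
  case (Suc s)
  show ?case unfolding ideal_pow.simps
  proof (rule ideal_span_least[OF is_ideal_Qpow], force, safe)
    fix x y assume "x \<in> ideal_pow circuit_ideal s" "y \<in> circuit_ideal"
    then show "x * y \<in> Qpow (E - B) (Suc s)"
      using Suc circuit_ideal_subset_Q[OF Suc.prems] by (intro Qpow_Suc_mem) auto
  qed
qed

text \<open>At an associated prime, some basis \<open>B\<close> has all its \<open>f j\<close>
  outside the prime. A power of their product is then an admissible multiplier, because it supplies
  each factor \<open>f i\<close> off \<open>B\<close> with the factors that move it into
  \<open>circuit_ideal\<close>.\<close>

lemma monomial_ideal_subset_symb_pow:
  "monomial_ideal (symbolic_exponents s) \<subseteq> symb_pow circuit_ideal s"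
proof -
  have main: "\<exists>u\<in>A - P. u * monom_at f E a \<in> ideal_pow circuit_ideal s"
    if a: "a \<in> symbolic_exponents s" and P: "prime_ideal P" "x \<in> A" "P = colon circuit_ideal x" for a P x
  proof -
    have notP: "1 \<notin> P" using P(1) by (simp add: prime_ideal_def)
    \<comment> \<open>Here \<open>P\<close> is the intersection of the ideals
      \<open>colon (Q (E - B)) x\<close>. If none were contained in \<open>P\<close>, a product of
      elements chosen outside \<open>P\<close>, one from each, would still lie in
      \<open>P\<close>.\<close>
    have "\<exists>B\<in>bases. colon (Q (E - B)) x \<subseteq> P"
    proof (rule ccontr)
      assume "\<not> ?thesis"
      then have "\<forall>B\<in>bases. \<exists>p. p \<in> colon (Q (E - B)) x \<and> p \<notin> P" by blast
      then obtain p where p: "\<And>B. B \<in> bases \<Longrightarrow> p B \<in> colon (Q (E - B)) x" "\<And>B. B \<in> bases \<Longrightarrow> p B \<notin> P"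
        by metis
      have pA: "p B \<in> A" if "B \<in> bases" for B using p(1)[OF that] by (simp add: colon_def)
      have "prod p bases * x \<in> Q (E - B)" if B: "B \<in> bases" for B
      proof -
        have "p B * x \<in> Q (E - B)" using p(1)[OF B] by (simp add: colon_def)
        then have "prod p (bases - {B}) * (p B * x) \<in> Q (E - B)"
          using pA by (intro is_idealD(4)[OF is_ideal_Q, where x = "p B * x"] prod_mem) auto
        then show ?thesis using prod.remove[OF finite_bases B, of p] by (simp add: algebra_simps)
      qed
      moreover have "prod p bases \<in> A" using pA by blast
      ultimately have "prod p bases \<in> P"
        unfolding P(3) colon_def circuit_ideal_eq_Inter using P(2) by blast
      then show False using prime_ideal_prod[OF P(1), of bases p] pA p(2) by blast
    qed
    then obtain B where B: "B \<in> bases" "colon (Q (E - B)) x \<subseteq> P" by blast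
    note BE = basesD(2)[OF B(1)]
    have xQ: "x \<notin> Q (E - B)" using B(2) notP by (auto simp: colon_def)
    \<comment> \<open>If \<open>f j\<close> were in \<open>P\<close>, then \<open>f j * x\<close>
      would lie in \<open>Q (E - B)\<close>; cancelling \<open>f j\<close> would put
      \<open>x\<close> there, hence \<open>1\<close> into \<open>P\<close>.\<close>
    have fP: "f j \<notin> P" if "j \<in> B" for j
      using nonzerodivisor_cobasis[OF B(1) that P(2)] xQ circuit_ideal_subset_Q[OF B(1)]
      unfolding P(3) colon_def by auto
    have fA: "f j \<in> A" if "j \<in> B" for j using f_mem BE that by auto
    define b where "b = (\<Prod>i\<in>B. f i)"
    have b: "b \<in> A" "b \<notin> P"
      using prime_ideal_prod[OF P(1), of B f] fP fA unfolding b_def by blast+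
    define S where "S = sum a (E - B)"
    have S: "s \<le> S" using a B(1) by (auto simp: S_def symbolic_exponents_def)
    have "b ^ S \<in> A - P" using b prime_ideal_power[OF P(1) b(1)] by blast
    moreover have "b ^ S * monom_at f E a \<in> ideal_pow circuit_ideal s"
    proof -
      have "(b * f i) ^ a i \<in> ideal_pow circuit_ideal (a i)" if "i \<in> E - B" for i
      proof -
        have "b * f i \<in> circuit_ideal"
          unfolding b_def using that by (intro basis_monom_mult_Q[OF B(1)] f_in_Q)
        from ideal_pow_power_mem[OF is_ideal_circuit_ideal ideal_pow_one_mem[OF this], of "a i"]
        show ?thesis by simp
      qed
      then have "(\<Prod>i\<in>E - B. (b * f i) ^ a i) \<in> ideal_pow circuit_ideal S"
        unfolding S_def by (intro ideal_pow_prod_mem[OF is_ideal_circuit_ideal]) auto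
      then have "(\<Prod>i\<in>E - B. (b * f i) ^ a i) \<in> ideal_pow circuit_ideal s"
        using ideal_pow_antimono[OF is_ideal_circuit_ideal S] by blast
      moreover have "(\<Prod>i\<in>E - B. (b * f i) ^ a i) = b ^ S * monom_at f (E - B) a"
        unfolding S_def monom_at_def by (simp add: power_mult_distrib prod.distrib power_sum)
      ultimately show ?thesis
        unfolding monom_at_split[OF BE]
        using is_idealD(5)[OF is_ideal_pow[OF is_ideal_circuit_ideal] monom_at_mem[OF BE]]
        by (metis mult.assoc)
    qed
    ultimately show ?thesis by blast
  qed
  show ?thesis
  proof
    fix g assume g: "g \<in> monomial_ideal (symbolic_exponents s)"
    have "\<exists>u\<in>A - P. u * g \<in> ideal_pow circuit_ideal s" if P: "assoc_prime circuit_ideal P" for P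
    proof -
      obtain x where x: "prime_ideal P" "x \<in> A" "P = colon circuit_ideal x"
        using P by (auto simp: assoc_prime_def)
      have "monomial_ideal (symbolic_exponents s) \<subseteq> {g \<in> A. \<exists>u\<in>A - P. u * g \<in> ideal_pow circuit_ideal s}"
        unfolding monomial_ideal_def using main[OF _ x] monom_at_mem
        by (intro ideal_span_least is_ideal_saturation x(1) is_ideal_pow is_ideal_circuit_ideal) auto
      then show ?thesis using g by blast
    qed
    then show "g \<in> symb_pow circuit_ideal s"
      using g is_idealD(1)[OF is_ideal_monomial_ideal] unfolding symb_pow_def by blast
  qed
qed

text \<open>Otherwise \<open>g\<close> has an initial form with a coefficient outside
  \<open>Q (E - B)\<close>. A prime colon ideal above that coefficient is associated to
  \<open>circuit_ideal\<close>. The multiplier given by the symbolic power then kills the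
  coefficient by quasi-regularity, so it belongs to the very prime it should avoid.\<close>

lemma symb_pow_subset_Qpow:
  assumes B: "B \<in> bases"
  shows "symb_pow circuit_ideal s \<subseteq> Qpow (E - B) s"
proof (rule subsetI, rule ccontr)
  fix g assume g: "g \<in> symb_pow circuit_ideal s" and ng: "g \<notin> Qpow (E - B) s"
  note BE = basesD(2)[OF B] and EB = Diff_subset[of E B]
  have gA: "g \<in> A" using g by (simp add: symb_pow_def)
  \<comment> \<open>The least power not containing \<open>g\<close> is \<open>Suc d\<close>, so
    \<open>g\<close> is a form of degree \<open>d\<close> with some coefficient not in
    \<open>Q (E - B)\<close>.\<close>
  define j where "j = (LEAST j. g \<notin> Qpow (E - B) j)"
  have j1: "g \<notin> Qpow (E - B) j" unfolding j_def using ng by (rule LeastI)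
  have js: "j \<le> s" unfolding j_def using ng by (rule Least_le)
  have "j \<noteq> 0" using j1 gA Qpow_zero[OF EB] by metis
  then obtain d where d: "j = Suc d" using not0_implies_Suc by blast
  have "g \<in> Qpow (E - B) d" using not_less_Least[of d "\<lambda>j. g \<notin> Qpow (E - B) j"] d unfolding j_def by simp
  then obtain c where c: "\<And>\<alpha>. c \<alpha> \<in> A" "g = (\<Sum>\<alpha>\<in>exponents (E - B) d. c \<alpha> * monom_at f (E - B) \<alpha>)"
    using Qpow_repr[OF EB] by metis
  obtain \<alpha> where \<alpha>: "\<alpha> \<in> exponents (E - B) d" "c \<alpha> \<notin> Q (E - B)"
    using sum_mem_Qpow_Suc[OF EB, of d c] j1 c(2) d by auto
  obtain y where y: "y \<in> A" "prime_ideal (colon (Q (E - B)) (c \<alpha> * y))"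
    using prime_colon_above[OF is_ideal_Q[OF EB] c(1) \<alpha>(2)] by blast
  have cyA: "c \<alpha> * y \<in> A" using y c by auto
  have bA: "(\<Prod>i\<in>B. f i) \<in> A" using BE f_mem by auto
  \<comment> \<open>Multiplication by the product over \<open>B\<close> moves
    \<open>Q (E - B)\<close> into \<open>circuit_ideal\<close> and can be cancelled modulo
    \<open>Q (E - B)\<close>. So a prime annihilator modulo the latter is also one modulo the
    former.\<close>
  have "p * ((\<Prod>i\<in>B. f i) * (c \<alpha> * y)) \<in> circuit_ideal \<longleftrightarrow> p * (c \<alpha> * y) \<in> Q (E - B)" if p: "p \<in> A" for p
  proof
    assume "p * ((\<Prod>i\<in>B. f i) * (c \<alpha> * y)) \<in> circuit_ideal"
    then have "(\<Prod>i\<in>B. f i) * (p * (c \<alpha> * y)) \<in> Q (E - B)"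
      using circuit_ideal_subset_Q[OF B] by (auto simp: algebra_simps)
    then show "p * (c \<alpha> * y) \<in> Q (E - B)" using prod_basis_cancel[OF B mult_mem[OF p cyA]] by blast
  next
    assume "p * (c \<alpha> * y) \<in> Q (E - B)"
    from basis_monom_mult_Q[OF B this]
    show "p * ((\<Prod>i\<in>B. f i) * (c \<alpha> * y)) \<in> circuit_ideal" by (simp add: algebra_simps)
  qed
  then have "colon circuit_ideal ((\<Prod>i\<in>B. f i) * (c \<alpha> * y)) = colon (Q (E - B)) (c \<alpha> * y)"
    unfolding colon_def by blast
  then have "assoc_prime circuit_ideal (colon (Q (E - B)) (c \<alpha> * y))"
    unfolding assoc_prime_def using y(2) bA cyA by blast
  then obtain u where u: "u \<in> A" "u \<notin> colon (Q (E - B)) (c \<alpha> * y)" "u * g \<in> ideal_pow circuit_ideal s"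
    using g unfolding symb_pow_def by blast
  have "u * g \<in> Qpow (E - B) (Suc d)"
    using u(3) ideal_pow_subset_Qpow[OF B] Qpow_antimono[OF EB js] d by blast
  moreover have "u * g = (\<Sum>\<alpha>\<in>exponents (E - B) d. (u * c \<alpha>) * monom_at f (E - B) \<alpha>)"
    unfolding c(2) by (simp add: sum_distrib_left mult.assoc)
  ultimately have "u * c \<alpha> \<in> Q (E - B)"
    using quasi_regular_cobasis[OF B, unfolded quasi_regular_def, rule_format, of "\<lambda>\<alpha>. u * c \<alpha>" d \<alpha>]
      u(1) c(1) \<alpha>(1) mult_mem by metis
  then have "u * c \<alpha> * y \<in> Q (E - B)" using is_idealD(5)[OF is_ideal_Q[OF EB] y(1)] by blast
  then have "u \<in> colon (Q (E - B)) (c \<alpha> * y)" using u(1) by (simp add: colon_def mult.assoc)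
  then show False using u(2) by blast
qed

theorem symb_pow_eq: "symb_pow circuit_ideal s = monomial_ideal (symbolic_exponents s)"
proof (rule equalityI[OF _ monomial_ideal_subset_symb_pow], rule subsetI)
  fix g assume g: "g \<in> symb_pow circuit_ideal s"
  then have "g \<in> A" by (simp add: symb_pow_def)
  then show "g \<in> monomial_ideal (symbolic_exponents s)"
    using symb_pow_subset_Qpow g by (intro Inter_Qpow_subset_monomial_ideal) auto
qed

end

section \<open>Noetherianity and degrees in polynomial rings\<close>

abbreviation (input) "keys \<equiv> Poly_Mapping.keys"
abbreviation (input) "lookup \<equiv> Poly_Mapping.lookup"
abbreviation (input) "single \<equiv> Poly_Mapping.single"

definition polys_in :: "nat set \<Rightarrow> 'l::field mpoly set" where
  "polys_in V = {p. \<forall>m \<in> keys p. keys m \<subseteq> V}"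

lemma keys_plus_nat: "keys (a + b) = keys a \<union> keys (b :: 'x \<Rightarrow>\<^sub>0 nat)"
  by (auto simp: in_keys_iff lookup_add)

lemma lookup_single_mult:
  "lookup (single m c * p) (m + k) = c * lookup (p :: (nat \<Rightarrow>\<^sub>0 nat) \<Rightarrow>\<^sub>0 'l::comm_ring_1) k"
proof -
  have "lookup (single m c * p) (m + k)
      = (\<Sum>l. (c when m = l) * (\<Sum>q. lookup p q when m + k = l + q))"
    by (simp add: lookup_mult lookup_single prod_fun_def)
  also have "\<dots> = (\<Sum>l. (c * (\<Sum>q. lookup p q when m + k = l + q)) when m = l)"
    by (simp only: when_mult)
  also have "\<dots> = c * (\<Sum>q. lookup p q when m + k = m + q)" by (rule Sum_any_when_equal')
  also have "(\<Sum>q. lookup p q when m + k = m + q) = lookup p k" by simp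
  finally show ?thesis .
qed

lemma keys_single_mult_ge:
  assumes "k \<in> keys (single m c * (p :: (nat \<Rightarrow>\<^sub>0 nat) \<Rightarrow>\<^sub>0 'l::comm_ring_1))"
  shows "\<exists>j\<in>keys p. k = m + j"
proof -
  from assms keys_mult[of "single m c" p] obtain a b where "k = a + b" "a \<in> keys (single m c)" "b \<in> keys p"
    by blast
  then show ?thesis by (auto split: if_splits)
qed

lemma sum_single_keys: "(\<Sum>m\<in>keys p. single m (lookup p m)) = (p :: 'x \<Rightarrow>\<^sub>0 'y::comm_monoid_add)"
proof (rule poly_mapping_eqI)
  fix k
  show "lookup (\<Sum>m\<in>keys p. single m (lookup p m)) k = lookup p k"
    by (cases "k \<in> keys p") (auto simp: lookup_sum lookup_single when_def in_keys_iff sum.delta)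
qed

lemma subring_polys_in: "subring_carrier (polys_in V)"
proof
  show "1 \<in> polys_in V" by (simp add: polys_in_def)
next
  fix x y :: "'l::field mpoly" assume xy: "x \<in> polys_in V" "y \<in> polys_in V"
  then show "x + y \<in> polys_in V" using keys_add[of x y] by (auto simp: polys_in_def)
  show "x * y \<in> polys_in V" using xy keys_mult[of x y] unfolding polys_in_def
    by (force simp: keys_plus_nat)
next
  fix x :: "'l::field mpoly" assume "x \<in> polys_in V"
  then show "- x \<in> polys_in V" by (simp add: polys_in_def in_keys_iff)
qed

lemma single_in_polys: "keys m \<subseteq> V \<Longrightarrow> single m c \<in> polys_in V"
  by (simp add: polys_in_def)

section \<open>The lemma of Dickson, leading monomials and the ascending chain condition\<close>

lemma nat_seq_incseq_subseq: "\<exists>r. strict_mono r \<and> incseq ((s :: nat \<Rightarrow> nat) \<circ> r)"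
proof -
  obtain r where r: "strict_mono r" "monoseq (\<lambda>n. s (r n))" using seq_monosub by blast
  show ?thesis
  proof (cases "incseq (\<lambda>n. s (r n))")
    case True
    then show ?thesis using r by (auto simp: comp_def)
  next
    case False
    then have dec: "decseq (\<lambda>n. s (r n))" using r(2) by (auto simp: monoseq_iff)
    \<comment> \<open>A nonincreasing sequence of natural numbers is constant from the point where
      it reaches its minimum, so its tail is also nondecreasing.\<close>
    define m where "m = (LEAST m. \<exists>n. m = s (r n))"
    have "\<exists>n. m = s (r n)" unfolding m_def by (rule LeastI_ex) auto
    then obtain N where N: "m = s (r N)" by blast
    have "s (r n) = m" if "N \<le> n" for n
    proof (rule antisym)
      show "s (r n) \<le> m" unfolding N using dec that by (rule decseqD)
      show "m \<le> s (r n)" unfolding m_def by (rule Least_le) auto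
    qed
    then have "incseq (s \<circ> (\<lambda>n. r (N + n)))" by (simp add: incseq_def)
    moreover have "strict_mono (\<lambda>n. r (N + n))" using r(1) by (simp add: strict_mono_def)
    ultimately show ?thesis by blast
  qed
qed

lemma dickson_subseq:
  assumes "finite V"
  shows "\<exists>r :: nat \<Rightarrow> nat. strict_mono r \<and> (\<forall>v\<in>V. incseq (\<lambda>n. lookup (f (r n) :: 'x \<Rightarrow>\<^sub>0 nat) v))"
  using assms
proof induction
  case empty
  show ?case by (intro exI[of _ id]) (simp add: strict_mono_def)
next
  case (insert v V)
  then obtain r where r: "strict_mono r" "\<forall>v\<in>V. incseq (\<lambda>n. lookup (f (r n)) v)" by blast
  obtain r' where r': "strict_mono r'" "incseq ((\<lambda>n. lookup (f (r n)) v) \<circ> r')"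
    using nat_seq_incseq_subseq by blast
  have "incseq (\<lambda>n. lookup (f (r (r' n))) w)" if w: "w \<in> insert v V" for w
  proof (cases "w \<in> V")
    case True
    show ?thesis
      unfolding incseq_def
    proof (intro allI impI)
      fix a b :: nat assume "a \<le> b"
      then have "r' a \<le> r' b" using r'(1) strict_mono_less_eq by blast
      then show "lookup (f (r (r' a))) w \<le> lookup (f (r (r' b))) w"
        using r(2) True unfolding incseq_def by blast
    qed
  next
    case False
    then show ?thesis using w r'(2) by (simp add: comp_def)
  qed
  moreover have "strict_mono (\<lambda>n. r (r' n))" using r(1) r'(1) by (simp add: strict_mono_def)
  ultimately show ?case by blast
qed

text \<open>A subsequence that is nondecreasing in every variable contains a divisible pair. The
  quotient \<open>d\<close> is kept because it serves as a monomial multiplier.\<close>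

lemma dickson:
  assumes "finite V" "\<And>n. keys (f n :: 'x \<Rightarrow>\<^sub>0 nat) \<subseteq> V"
  shows "\<exists>i j. i < (j::nat) \<and> (\<exists>d. f j = d + f i \<and> keys d \<subseteq> V)"
proof -
  obtain r where r: "strict_mono r" "\<forall>v\<in>V. incseq (\<lambda>n. lookup (f (r n)) v)"
    using dickson_subseq[OF assms(1), of f] by blast
  have le: "lookup (f (r 0)) v \<le> lookup (f (r 1)) v" for v
  proof (cases "v \<in> V")
    case True
    then show ?thesis using r(2) incseqD[of "\<lambda>n. lookup (f (r n)) v" 0 1] by simp
  next
    case False
    then have "v \<notin> keys (f (r 0))" using assms(2) by blast
    then show ?thesis by (simp add: in_keys_iff)
  qed
  then have "f (r 1) = (f (r 1) - f (r 0)) + f (r 0)"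
    by (intro poly_mapping_eqI) (simp add: lookup_add lookup_minus)
  moreover have "keys (f (r 1) - f (r 0)) \<subseteq> V"
    using assms(2)[of "r 1"] by (auto simp: in_keys_iff lookup_minus)
  moreover have "r 0 < r 1" using r(1) by (simp add: strict_mono_def)
  ultimately show ?thesis by blast
qed

lemma poly_mapping_nat_nonneg: "0 \<le> (d :: 'x::linorder \<Rightarrow>\<^sub>0 nat)"
proof (rule ccontr)
  assume "\<not> 0 \<le> d"
  then have "d < 0" by simp
  then show False unfolding less_poly_mapping.rep_eq less_fun_def by simp
qed

text \<open>An infinite descent would contain a divisible pair, but a multiple is never smaller than
  its divisor in an order compatible with addition.\<close>

lemma wf_monomials:
  assumes "finite V"
  shows "wf {(x, y :: nat \<Rightarrow>\<^sub>0 nat). x < y \<and> keys x \<subseteq> V \<and> keys y \<subseteq> V}"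
  unfolding wf_iff_no_infinite_down_chain
proof
  assume "\<exists>f :: nat \<Rightarrow> nat \<Rightarrow>\<^sub>0 nat. \<forall>i. (f (Suc i), f i) \<in> {(x, y). x < y \<and> keys x \<subseteq> V \<and> keys y \<subseteq> V}"
  then obtain f :: "nat \<Rightarrow> nat \<Rightarrow>\<^sub>0 nat" where f: "\<And>i. f (Suc i) < f i" "\<And>i. keys (f i) \<subseteq> V" by auto
  obtain i j d where ij: "i < j" "f j = d + f i" using dickson[OF assms, of f] f(2) by blast
  have "f j < f i" using ij(1) by (induction j) (auto simp: less_Suc_eq intro: less_trans[OF f(1)] f(1))
  moreover have "f i \<le> f j" using add_right_mono[OF poly_mapping_nat_nonneg[of d], of "f i"] ij(2) by simp
  ultimately show False by simp
qed

text \<open>For the zero polynomial this is a maximum over the empty set, an unspecified value;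
  hence zero is treated separately in the arguments on leading monomials.\<close>

definition lead :: "'l::field mpoly \<Rightarrow> nat \<Rightarrow>\<^sub>0 nat" where
  "lead p = Max (keys p)"

lemma lead_in_keys: "p \<noteq> 0 \<Longrightarrow> lead p \<in> keys p"
  unfolding lead_def by (intro Max_in) simp_all

lemma le_lead: "m \<in> keys p \<Longrightarrow> m \<le> lead p"
  unfolding lead_def by simp

lemma lead_eqI: "m \<in> keys p \<Longrightarrow> (\<And>k. k \<in> keys p \<Longrightarrow> k \<le> m) \<Longrightarrow> lead p = m"
  unfolding lead_def by (intro Max_eqI) auto

lemma lead_single_mult:
  assumes "p \<noteq> 0"
  shows "lead (single m 1 * p) = m + lead p" "single m 1 * p \<noteq> 0"
proof -
  have k: "m + lead p \<in> keys (single m 1 * p)"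
    using lead_in_keys[OF assms] by (simp add: in_keys_iff lookup_single_mult)
  then show "single m 1 * p \<noteq> 0" by auto
  show "lead (single m 1 * p) = m + lead p"
  proof (rule lead_eqI[OF k])
    fix j assume "j \<in> keys (single m 1 * p)"
    then obtain i where "i \<in> keys p" "j = m + i" using keys_single_mult_ge by blast
    then show "j \<le> m + lead p" using le_lead by (simp add: add_left_mono)
  qed
qed

text \<open>Subtracting a scalar multiple of an element of \<open>K\<close> with the same leading
  monomial lowers the leading monomial, so well-founded induction reduces every element of
  \<open>L\<close> to \<open>K\<close>.\<close>

lemma ideal_eq_if_same_leads:
  fixes K L :: "'l::field mpoly set"
  assumes V: "finite V" and K: "subring_carrier.is_ideal (polys_in V) K"
    and L: "subring_carrier.is_ideal (polys_in V) L" and sub: "K \<subseteq> L"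
    and lead: "\<And>p. p \<in> L \<Longrightarrow> p \<noteq> 0 \<Longrightarrow> \<exists>q\<in>K. q \<noteq> 0 \<and> lead q = lead p"
  shows "L = K"
proof -
  interpret subring_carrier "polys_in V :: 'l mpoly set" by (rule subring_polys_in)
  note K = is_idealD[OF K] and L = is_idealD[OF L]
  have "p \<in> K" if "p \<in> L" for p
    using that
  proof (induction "lead p" arbitrary: p rule: wf_induct_rule[OF wf_monomials[OF V]])
    case (1 p)
    show ?case
    proof (cases "p = 0")
      case True
      then show ?thesis using K(2) by simp
    next
      case False
      then obtain q where q: "q \<in> K" "q \<noteq> 0" "lead q = lead p" using lead 1 by blast
      define c where "c = lookup p (lead p) / lookup q (lead p)"
      define p' where "p' = p - single 0 c * q"
      have cA: "single 0 c \<in> polys_in V" by (simp add: single_in_polys)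
      have lookup: "lookup p' m = lookup p m - c * lookup q m" for m
        using lookup_single_mult[of 0 c q m] by (simp add: p'_def lookup_minus)
      have "lookup q (lead p) \<noteq> 0" using lead_in_keys[OF q(2)] q(3) by (simp add: in_keys_iff)
      then have nk: "lead p \<notin> keys p'" by (simp add: in_keys_iff lookup c_def)
      have cq: "single 0 c * q \<in> K" using K(4)[OF cA q(1)] .
      have p'L: "p' \<in> L" unfolding p'_def using 1(2) cq sub L(7) by blast
      have pA: "p \<in> polys_in V" "p' \<in> polys_in V" using 1(2) p'L L(1) by auto
      have "p' \<in> K"
      proof (cases "p' = 0")
        case True
        then show ?thesis using K(2) by simp
      next
        case False
        have lk: "lead p' \<in> keys p'" using lead_in_keys[OF False] .
        then have "lead p' \<in> keys p \<union> keys q" by (auto simp: in_keys_iff lookup)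
        then have "lead p' \<le> lead p" using le_lead[of _ p] le_lead[of _ q] q(3) by auto
        then have "lead p' < lead p" using nk lk by (metis order_le_less)
        moreover have "keys (lead p') \<subseteq> V" using pA(2) lk by (auto simp: polys_in_def)
        moreover have "keys (lead p) \<subseteq> V"
          using pA(1) lead_in_keys[OF \<open>p \<noteq> 0\<close>] by (auto simp: polys_in_def)
        ultimately show ?thesis using 1(1) p'L by blast
      qed
      then have "p' + single 0 c * q \<in> K" using cq K(3) by blast
      then show ?thesis by (simp add: p'_def)
    qed
  qed
  then show ?thesis using sub by blast
qed

text \<open>Without a maximal member there is a strictly ascending chain, and each step supplies a
  leading monomial new to it. By \<open>dickson\<close> one of these divides a later one, which was
  therefore already a leading monomial.\<close>

lemma polys_in_maximal_ideal:
  fixes \<F> :: "'l::field mpoly set set"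
  assumes V: "finite V" and ne: "\<F> \<noteq> {}" and id: "\<And>K. K \<in> \<F> \<Longrightarrow> subring_carrier.is_ideal (polys_in V) K"
  shows "\<exists>M\<in>\<F>. \<forall>K\<in>\<F>. M \<subseteq> K \<longrightarrow> K = M"
proof (rule ccontr)
  interpret subring_carrier "polys_in V :: 'l mpoly set" by (rule subring_polys_in)
  assume "\<not> ?thesis"
  then have "\<forall>M\<in>\<F>. \<exists>K\<in>\<F>. M \<subseteq> K \<and> K \<noteq> M" by blast
  then obtain next_ideal where nxt: "\<And>M. M \<in> \<F> \<Longrightarrow> next_ideal M \<in> \<F> \<and> M \<subseteq> next_ideal M \<and> next_ideal M \<noteq> M"
    by metis
  obtain K0 where K0: "K0 \<in> \<F>" using ne by blast
  define Ks where "Ks n = (next_ideal ^^ n) K0" for n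
  have Ks: "Ks n \<in> \<F>" for n unfolding Ks_def by (induction n) (use K0 nxt in auto)
  have Suc: "Ks n \<subseteq> Ks (Suc n)" "Ks (Suc n) \<noteq> Ks n" for n using nxt[OF Ks[of n]] by (auto simp: Ks_def)
  have mono: "Ks i \<subseteq> Ks j" if "i \<le> j" for i j
    using lift_Suc_mono_le[of Ks i j] Suc(1) that by blast
  have "\<exists>p\<in>Ks (Suc n). p \<noteq> 0 \<and> (\<forall>q\<in>Ks n. q \<noteq> 0 \<longrightarrow> lead q \<noteq> lead p)" for n
    using ideal_eq_if_same_leads[OF V id[OF Ks[of n]] id[OF Ks[of "Suc n"]] Suc(1)] Suc(2)[of n] by metis
  then obtain p where p: "\<And>n. p n \<in> Ks (Suc n)" "\<And>n. p n \<noteq> 0"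
      "\<And>n q. q \<in> Ks n \<Longrightarrow> q \<noteq> 0 \<Longrightarrow> lead q \<noteq> lead (p n)" by metis
  have "p n \<in> polys_in V" for n using p(1) is_idealD(1)[OF id[OF Ks]] by blast
  then have "keys (lead (p n)) \<subseteq> V" for n using lead_in_keys[OF p(2)[of n]] by (auto simp: polys_in_def)
  then obtain i j d where ij: "i < j" "lead (p j) = d + lead (p i)" "keys d \<subseteq> V"
    using dickson[OF V, of "\<lambda>n. lead (p n)"] by blast
  have "p i \<in> Ks j" using p(1)[of i] mono[of "Suc i" j] ij(1) by auto
  then have "single d 1 * p i \<in> Ks j"
    using is_idealD(4)[OF id[OF Ks]] single_in_polys[OF ij(3)] by blast
  then show False using p(3)[of _ j] lead_single_mult[OF p(2)[of i], of d] ij(2) by metis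
qed

text \<open>A maximal proper ideal among the annihilators of multiples of \<open>c\<close> is prime:
  for \<open>p\<close> outside it, multiplying once more by \<open>p\<close> gives a larger
  annihilator in the family, hence the same one.\<close>

lemma polys_in_prime_colon:
  fixes K :: "'l::field mpoly set"
  assumes V: "finite V" and K: "subring_carrier.is_ideal (polys_in V) K"
    and c: "c \<in> polys_in V" "c \<notin> K"
  shows "\<exists>y\<in>polys_in V. subring_carrier.prime_ideal (polys_in V) (subring_carrier.colon (polys_in V) K (c * y))"
proof -
  interpret subring_carrier "polys_in V :: 'l mpoly set" by (rule subring_polys_in)
  define \<F> where "\<F> = {colon K (c * y) | y. y \<in> polys_in V \<and> c * y \<notin> K}"
  have "colon K (c * 1) \<in> \<F>" unfolding \<F>_def using c by (intro CollectI exI[of _ 1]) simp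
  then have "\<F> \<noteq> {}" by blast
  moreover have "is_ideal M" if "M \<in> \<F>" for M
    using that is_ideal_colon[OF K] c(1) unfolding \<F>_def by auto
  ultimately obtain M where M: "M \<in> \<F>" "\<forall>K\<in>\<F>. M \<subseteq> K \<longrightarrow> K = M"
    using polys_in_maximal_ideal[OF V, of \<F>] by blast
  then obtain y where y: "y \<in> polys_in V" "c * y \<notin> K" "M = colon K (c * y)" by (auto simp: \<F>_def)
  have "q \<in> M" if pq: "p \<in> polys_in V" "q \<in> polys_in V" "p * q \<in> M" "p \<notin> M" for p q
  proof -
    have "c * (y * p) \<notin> K" using pq y by (auto simp: colon_def algebra_simps)
    then have "colon K (c * (y * p)) \<in> \<F>" unfolding \<F>_def using y(1) pq(1) by blast
    moreover have "M \<subseteq> colon K (c * (y * p))"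
    proof
      fix a assume "a \<in> M"
      then have a: "a \<in> polys_in V" "p * (a * (c * y)) \<in> K"
        using pq(1) is_idealD(4)[OF K] by (auto simp: y(3) colon_def)
      then show "a \<in> colon K (c * (y * p))" by (simp add: colon_def algebra_simps)
    qed
    ultimately have "colon K (c * (y * p)) = M" using M(2) by blast
    moreover have "q \<in> colon K (c * (y * p))" using pq(2,3) by (simp add: y(3) colon_def algebra_simps)
    ultimately show ?thesis by blast
  qed
  then have "prime_ideal M"
    unfolding prime_ideal_def
    using y(2) is_ideal_colon[OF K mult_mem[OF c(1) y(1)]] unfolding y(3) by (auto simp: colon_def[of K "c * y"])
  then show ?thesis using y by blast
qed

section \<open>Ideals generated by variables\<close>

lemma Var_in_polys: "i \<in> V \<Longrightarrow> Var i \<in> polys_in V"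
  unfolding Var_def by (intro single_in_polys) auto

text \<open>The condition on monomials defines an ideal, and each monomial satisfying it is a
  multiple of a variable from \<open>D\<close>.\<close>

lemma ideal_span_Var:
  assumes "D \<subseteq> V"
  shows "subring_carrier.ideal_span (polys_in V) (Var ` D)
    = {p :: 'l::field mpoly. p \<in> polys_in V \<and> (\<forall>m\<in>keys p. keys m \<inter> D \<noteq> {})}"
proof -
  interpret subring_carrier "polys_in V :: 'l mpoly set" by (rule subring_polys_in)
  define K where "K = {p :: 'l mpoly. p \<in> polys_in V \<and> (\<forall>m\<in>keys p. keys m \<inter> D \<noteq> {})}"
  have VD: "Var ` D \<subseteq> (polys_in V :: 'l mpoly set)" using Var_in_polys assms by blast
  have "is_ideal K" unfolding is_ideal_def
  proof (intro conjI ballI)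
    fix x y assume "x \<in> K" "y \<in> K"
    then show "x + y \<in> K" using keys_add[of x y] unfolding K_def by blast
  next
    fix a x :: "'l mpoly" assume "a \<in> polys_in V" "x \<in> K"
    moreover from \<open>x \<in> K\<close> have "keys m \<inter> D \<noteq> {}" if "m \<in> keys (a * x)" for m
      using that keys_mult[of a x] unfolding K_def by (force simp: keys_plus_nat)
    ultimately show "a * x \<in> K" unfolding K_def by blast
  qed (auto simp: K_def)
  moreover have "Var ` D \<subseteq> K" using VD by (auto simp: K_def Var_def)
  ultimately have "ideal_span (Var ` D) \<subseteq> K" by (rule ideal_span_least)
  moreover have "p \<in> ideal_span (Var ` D)" if p: "p \<in> K" for p
  proof -
    have "single m (lookup p m) \<in> ideal_span (Var ` D)" if m: "m \<in> keys p" for m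
    proof -
      obtain i where i: "i \<in> keys m" "i \<in> D" using p m by (auto simp: K_def)
      have mi: "m = (m - single i 1) + single i 1"
        using i by (intro poly_mapping_eqI) (auto simp: lookup_add lookup_minus lookup_single when_def in_keys_iff)
      have "keys m \<subseteq> V" using p m by (auto simp: K_def polys_in_def)
      then have "keys (m - single i 1) \<subseteq> V" by (auto simp: in_keys_iff lookup_minus)
      then have "single (m - single i 1) (lookup p m) * Var i \<in> ideal_span (Var ` D)"
        using i(2) by (intro is_idealD(4)[OF is_ideal_span[OF VD]] single_in_polys ideal_span_base) auto
      moreover have "single (m - single i 1) (lookup p m) * Var i = single m (lookup p m)"
        unfolding Var_def mult_single mi[symmetric] by simp
      ultimately show ?thesis by simp
    qed
    then have "(\<Sum>m\<in>keys p. single m (lookup p m)) \<in> ideal_span (Var ` D)"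
      by (rule is_ideal_sum[OF is_ideal_span[OF VD]])
    then show ?thesis unfolding sum_single_keys .
  qed
  ultimately show ?thesis unfolding K_def by blast
qed

text \<open>Multiplication by \<open>Var j\<close> only shifts exponents at \<open>j\<close>, which
  lies outside \<open>D\<close>. This makes the variables an instance of the general
  setting.\<close>

lemma Var_nonzerodivisor:
  fixes r :: "'l::field mpoly"
  assumes "D \<subseteq> V" "j \<notin> D" "r \<in> polys_in V"
    "Var j * r \<in> subring_carrier.ideal_span (polys_in V) (Var ` D)"
  shows "r \<in> subring_carrier.ideal_span (polys_in V) (Var ` D)"
proof -
  have "keys m \<inter> D \<noteq> {}" if "m \<in> keys r" for m
  proof -
    have "single j 1 + m \<in> keys (Var j * r)"
      using that unfolding Var_def by (simp add: in_keys_iff lookup_single_mult)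
    then have "keys (single j 1 + m) \<inter> D \<noteq> {}" using assms(4) unfolding ideal_span_Var[OF assms(1)] by blast
    then show ?thesis using assms(2) by (auto simp: keys_plus_nat)
  qed
  then show ?thesis using assms(3) unfolding ideal_span_Var[OF assms(1)] by blast
qed

section \<open>Homogeneous polynomials and initial degrees\<close>

definition mdeg :: "(nat \<Rightarrow>\<^sub>0 nat) \<Rightarrow> nat" where
  "mdeg m = (\<Sum>i\<in>keys m. lookup m i)"

lemma mdeg_add: "mdeg (a + b) = mdeg a + mdeg b"
proof -
  have *: "mdeg m = (\<Sum>i\<in>keys a \<union> keys b. lookup m i)" if "keys m \<subseteq> keys a \<union> keys b" for m
    unfolding mdeg_def using that by (intro sum.mono_neutral_left) (auto simp: in_keys_iff)
  show ?thesis using *[of a] *[of b] *[of "a + b"] by (simp add: keys_plus_nat lookup_add sum.distrib)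
qed

lemma homogeneous_iff: "homogeneous_of_degree d p \<longleftrightarrow> (\<forall>m\<in>keys p. mdeg m = d)"
  by (simp add: homogeneous_of_degree_def mdeg_def)

lemma homogeneous_one: "homogeneous_of_degree 0 1"
  by (simp add: homogeneous_iff mdeg_def)

lemma homogeneous_mult:
  "homogeneous_of_degree d p \<Longrightarrow> homogeneous_of_degree e q \<Longrightarrow> homogeneous_of_degree (d + e) (p * q)"
  unfolding homogeneous_iff using keys_mult[of p q] by (force simp: mdeg_add)

lemma homogeneous_power: "homogeneous_of_degree d p \<Longrightarrow> homogeneous_of_degree (n * d) (p ^ n)"
  by (induction n) (auto simp: homogeneous_one intro: homogeneous_mult)

lemma homogeneous_prod:
  "(\<And>i. i \<in> F \<Longrightarrow> homogeneous_of_degree (d i) (p i)) \<Longrightarrow> homogeneous_of_degree (\<Sum>i\<in>F. d i) (\<Prod>i\<in>F. p i)"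
  by (induction F rule: infinite_finite_induct) (auto simp: homogeneous_one intro: homogeneous_mult)

definition initial_degree_ge :: "nat \<Rightarrow> nat set \<Rightarrow> 'l::field mpoly set" where
  "initial_degree_ge d V = {p \<in> polys_in V. \<forall>m\<in>keys p. d \<le> mdeg m}"

lemma initial_degree_ge_mult:
  "p \<in> initial_degree_ge d V \<Longrightarrow> q \<in> initial_degree_ge e V \<Longrightarrow> p * q \<in> initial_degree_ge (d + e) V"
proof -
  assume pq: "p \<in> initial_degree_ge d V" "q \<in> initial_degree_ge e V"
  then have "p * q \<in> polys_in V"
    using subring_carrier.mult_mem[OF subring_polys_in] by (auto simp: initial_degree_ge_def)
  moreover have "d + e \<le> mdeg m" if "m \<in> keys (p * q)" for m
  proof -
    obtain a b where "m = a + b" "a \<in> keys p" "b \<in> keys q"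
      using \<open>m \<in> keys (p * q)\<close> keys_mult[of p q] by blast
    then show ?thesis using pq by (simp add: mdeg_add initial_degree_ge_def add_mono)
  qed
  ultimately show ?thesis by (simp add: initial_degree_ge_def)
qed

lemma is_ideal_initial_degree_ge:
  "subring_carrier.is_ideal (polys_in V) (initial_degree_ge d V :: 'l::field mpoly set)"
proof -
  interpret subring_carrier "polys_in V :: 'l mpoly set" by (rule subring_polys_in)
  show ?thesis
    unfolding is_ideal_def
  proof (intro conjI ballI)
    fix x y :: "'l mpoly" assume "x \<in> initial_degree_ge d V" "y \<in> initial_degree_ge d V"
    then show "x + y \<in> initial_degree_ge d V"
      using keys_add[of x y] unfolding initial_degree_ge_def by blast
  next
    fix a x :: "'l mpoly" assume "a \<in> polys_in V" "x \<in> initial_degree_ge d V"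
    then show "a * x \<in> initial_degree_ge d V"
      using initial_degree_ge_mult[of a 0 V x d] by (simp add: initial_degree_ge_def)
  qed (auto simp: initial_degree_ge_def)
qed

lemma ideal_pow_initial_degree:
  fixes K :: "'l::field mpoly set"
  assumes "K \<subseteq> initial_degree_ge d V"
  shows "subring_carrier.ideal_pow (polys_in V) K s \<subseteq> initial_degree_ge (s * d) V"
proof -
  interpret subring_carrier "polys_in V :: 'l mpoly set" by (rule subring_polys_in)
  show ?thesis
  proof (induction s)
    case 0
    show ?case by (simp add: initial_degree_ge_def)
  next
    case (Suc s)
    show ?case unfolding ideal_pow.simps
    proof (rule ideal_span_least[OF is_ideal_initial_degree_ge], safe)
      fix x y assume "x \<in> ideal_pow K s" "y \<in> K"
      then have "x * y \<in> initial_degree_ge (s * d + d) V"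
        using Suc assms by (intro initial_degree_ge_mult) auto
      then show "x * y \<in> initial_degree_ge (Suc s * d) V" by (simp add: add.commute)
    qed
  qed
qed

section \<open>Level sets, nullity and generalized Hamming weights\<close>

context matroid
begin

definition nullity :: "'v set \<Rightarrow> nat" where
  "nullity U = card U - matroid_rank \<Delta> U"

lemma nullity_add_rank: "U \<subseteq> E \<Longrightarrow> nullity U + matroid_rank \<Delta> U = card U"
  using rank_le_card[of U] finite_ground finite_subset unfolding nullity_def by fastforce

lemma nullity_pos_iff:
  assumes "U \<subseteq> E" shows "0 < nullity U \<longleftrightarrow> U \<notin> \<Delta>"
proof -
  have fin: "finite U" using assms finite_ground finite_subset by blast
  have "U \<in> \<Delta>" if "nullity U = 0"
  proof -
    have "card U = matroid_rank \<Delta> U" using that nullity_add_rank[OF assms] by simp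
    then show ?thesis using rank_attained[of U] card_subset_eq[OF fin] by metis
  qed
  moreover have "nullity U = 0" if "U \<in> \<Delta>" using indep_rank[OF that] by (simp add: nullity_def)
  ultimately show ?thesis by (metis not_gr_zero)
qed

lemma nullity_le_diff_basis:
  assumes "U \<subseteq> E" "B \<in> bases"
  shows "nullity U \<le> card (U - B)"
proof -
  have fin: "finite U" using assms finite_ground finite_subset by blast
  have "U \<inter> B \<in> \<Delta>" using indep_subset[OF basesD(1)[OF assms(2)]] by blast
  then have "card (U \<inter> B) \<le> matroid_rank \<Delta> U" by (rule card_le_rank) auto
  moreover have "card U = card (U \<inter> B) + card (U - B)"
    using fin card_Int_Diff[of U B] by simp
  ultimately show ?thesis by (simp add: nullity_def)
qed

lemma nullity_mono:
  assumes "U \<subseteq> V" "V \<subseteq> E" shows "nullity U \<le> nullity V"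
proof -
  have fin: "finite V" by (rule finite_subset[OF assms(2) finite_ground])
  note fin = fin finite_subset[OF assms(1) fin]
  obtain F where F: "F \<in> \<Delta>" "F \<subseteq> V" "card F = matroid_rank \<Delta> V" using rank_attained by blast
  have "F \<inter> U \<in> \<Delta>" using indep_subset[OF F(1)] by blast
  then have "card (F \<inter> U) \<le> matroid_rank \<Delta> U" by (rule card_le_rank) auto
  moreover have "card F = card (F \<inter> U) + card (F - U)"
    using finite_indep[OF F(1)] card_Int_Diff[of F U] by simp
  moreover have "card (F - U) \<le> card (V - U)" using F fin by (intro card_mono) auto
  moreover have "card (V - U) + card U = card V"
    using card_Diff_subset[OF fin(2) assms(1)] card_mono[OF fin(1) assms(1)] by simp
  moreover have "nullity U + matroid_rank \<Delta> U = card U" "nullity V + matroid_rank \<Delta> V = card V"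
    using assms by (auto intro: nullity_add_rank)
  ultimately show ?thesis using F(3) by linarith
qed

text \<open>An element \<open>e\<close> outside \<open>U\<close> is a coloop: deleting it keeps the
  nullity, so it lowers the rank and \<open>e\<close> lies in every basis. A basis extending
  \<open>C - {e}\<close> would then contain the circuit.\<close>

lemma circuits_subset_if_full_nullity:
  assumes U: "U \<subseteq> E" "nullity U = nullity E" and C: "C \<in> circuits E \<Delta>"
  shows "C \<subseteq> U"
proof (rule ccontr)
  assume "\<not> C \<subseteq> U"
  then obtain e where e: "e \<in> C" "e \<notin> U" by blast
  have CE: "C \<subseteq> E" using C by (auto simp: circuits_def)
  then have "e \<in> E" using e by blast
  have "nullity E \<le> nullity (E - {e})" using U e nullity_mono[of U "E - {e}"] by auto
  then have r: "matroid_rank \<Delta> (E - {e}) < matroid_rank \<Delta> E"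
    using nullity_add_rank[of "E - {e}"] nullity_add_rank[of E] card_Suc_Diff1[OF finite_ground \<open>e \<in> E\<close>] by auto
  have "C - {e} \<in> \<Delta>" using C e(1) by (auto simp: circuits_def)
  then obtain B where B: "B \<in> bases" "C - {e} \<subseteq> B" using extend_to_basis bases_nonempty by blast
  have "e \<in> B"
  proof (rule ccontr)
    assume "e \<notin> B"
    then have "B \<subseteq> E - {e}" using basesD(2)[OF B(1)] by blast
    then show False using card_le_rank[OF basesD(1)[OF B(1)], of "E - {e}"] basesD(4)[OF B(1)] r by simp
  qed
  then have "C \<subseteq> B" using B(2) by blast
  then show False using circuit_not_subset_basis[OF C B(1)] by blast
qed

text \<open>Deleting one element lowers the nullity by at most one, so the rest is still
  dependent.\<close>

lemma circuit_avoiding: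
  assumes "2 \<le> nullity E" "e \<in> E"
  shows "\<exists>C\<in>circuits E \<Delta>. e \<notin> C"
proof -
  have "matroid_rank \<Delta> (E - {e}) \<le> matroid_rank \<Delta> E" by (intro rank_mono) auto
  then have "0 < nullity (E - {e})"
    using assms nullity_add_rank[of "E - {e}"] nullity_add_rank[of E] card_Suc_Diff1[OF finite_ground assms(2)] by auto
  then have "E - {e} \<notin> \<Delta>" using nullity_pos_iff[of "E - {e}"] by auto
  then show ?thesis using dependent_contains_circuit[of "E - {e}"] by blast
qed

text \<open>A basis of maximal total is greedy: it meets every level set in a maximal independent
  subset. The elements of a level set off this basis are then at most as many as its nullity, and
  summing over levels bounds the cost of the basis.\<close>

lemma symbolic_exponents_levels:
  assumes a: "a \<in> symbolic_exponents s" and M: "\<And>i. i \<in> E \<Longrightarrow> a i \<le> M"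
  shows "s \<le> (\<Sum>t\<in>{1..M}. nullity {i\<in>E. t \<le> a i})"
proof -
  have "finite (sum a ` bases)" "sum a ` bases \<noteq> {}" using finite_bases bases_nonempty by auto
  then obtain B where B: "B \<in> bases" "sum a B = Max (sum a ` bases)"
    using Max_in by (metis imageE)
  have max: "sum a B' \<le> sum a B" if "B' \<in> bases" for B'
    unfolding B(2) using that finite_bases by (intro Max_ge) auto
  note BE = basesD(2)[OF B(1)] and Bfin = basesD(3)[OF B(1)]
  have level: "card {i\<in>E - B. t \<le> a i} \<le> nullity {i\<in>E. t \<le> a i}" for t
  proof -
    obtain F where F: "F \<in> \<Delta>" "F \<subseteq> {i\<in>E. t \<le> a i}" "card F = matroid_rank \<Delta> {i\<in>E. t \<le> a i}"
      using rank_attained by blast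
    have "card F \<le> card {i\<in>B. t \<le> a i}"
    proof (rule ccontr)
      assume "\<not> ?thesis"
      then have less: "card {i\<in>B. t \<le> a i} < card F" by simp
      from exchange_across_level[OF B(1) F(1) _ less] F(2)
      obtain i j where ij: "i \<in> B" "j \<in> F - B" "insert j (B - {i}) \<in> bases" "a i < t" by blast
      then have "t \<le> a j" "j \<in> E - B" using F(2) by auto
      then show False
        using sum_exchange(1)[OF B(1) ij(1), of j a] max[OF ij(3)] ij(4) by simp
    qed
    moreover have "{i\<in>E. t \<le> a i} - {i\<in>B. t \<le> a i} = {i\<in>E - B. t \<le> a i}" by blast
    then have "card {i\<in>E - B. t \<le> a i} + card {i\<in>B. t \<le> a i} = card {i\<in>E. t \<le> a i}"
    proof -
      have "{i\<in>B. t \<le> a i} \<subseteq> {i\<in>E. t \<le> a i}" using BE by blast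
      then show ?thesis
        using card_Diff_subset[of "{i\<in>B. t \<le> a i}" "{i\<in>E. t \<le> a i}"]
          card_mono[of "{i\<in>E. t \<le> a i}" "{i\<in>B. t \<le> a i}"] Bfin finite_ground
          \<open>{i\<in>E. t \<le> a i} - {i\<in>B. t \<le> a i} = {i\<in>E - B. t \<le> a i}\<close> by simp
    qed
    ultimately show ?thesis
      using F(3) nullity_add_rank[of "{i\<in>E. t \<le> a i}"] by auto
  qed
  have "s \<le> sum a (E - B)" using a B(1) by (auto simp: symbolic_exponents_def)
  also have "\<dots> = (\<Sum>t\<in>{1..M}. card {i\<in>E - B. t \<le> a i})"
    using finite_ground M by (intro sum_levels) auto
  also have "\<dots> \<le> (\<Sum>t\<in>{1..M}. nullity {i\<in>E. t \<le> a i})" using level by (intro sum_mono)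
  finally show ?thesis .
qed

lemma indicator_symbolic_exponents:
  assumes "U \<subseteq> E"
  shows "(\<lambda>i. m * indicator U i) \<in> symbolic_exponents (m * nullity U)"
  unfolding symbolic_exponents_def
proof (intro CollectI ballI)
  fix B assume B: "B \<in> bases"
  have "(E - B) \<inter> U = U - B" using assms by blast
  then have "(\<Sum>i\<in>E - B. m * indicator U i) = m * card (U - B)"
    using finite_ground by (simp add: sum_distrib_left[symmetric] indicator_def)
  then show "m * nullity U \<le> (\<Sum>i\<in>E - B. m * indicator U i)"
    using nullity_le_diff_basis[OF assms B] by simp
qed

section \<open>Generalized Hamming weights\<close>

lemma hamming_weight_attained:
  assumes "r \<le> nullity E"
  obtains U where "U \<subseteq> E" "nullity U = r" "card U = hamming_weight E \<Delta> r"
proof -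
  define H where "H = {card U | U. U \<subseteq> E \<and> card U - matroid_rank \<Delta> U = r}"
  obtain B where B: "B \<in> bases" using bases_nonempty by blast
  note B' = basesD[OF B]
  have "card (E - B) = nullity E"
    using card_Diff_subset[OF B'(3,2)] B'(4) by (simp add: nullity_def)
  \<comment> \<open>A basis together with \<open>r\<close> further elements has nullity
    \<open>r\<close>, so the minimum ranges over a nonempty set.\<close>
  then obtain D where D: "D \<subseteq> E - B" "card D = r" "finite D"
    using obtain_subset_with_card_n[of r "E - B"] assms by metis
  have rk: "matroid_rank \<Delta> (B \<union> D) = matroid_rank \<Delta> E"
    using card_le_rank[OF B'(1), of "B \<union> D"] rank_mono[of "B \<union> D" E] B' D by fastforce
  have "card (B \<union> D) = card B + r" using D B'(3) by (subst card_Un_disjoint) auto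
  then have "card (B \<union> D) \<in> H" unfolding H_def using rk B' D by (intro CollectI exI[of _ "B \<union> D"]) auto
  moreover have "finite H"
    unfolding H_def using finite_ground by simp
  ultimately have "Min H \<in> H" by (intro Min_in) auto
  then show ?thesis using that unfolding H_def hamming_weight_def nullity_def by force
qed

lemma hamming_weight_le:
  assumes "U \<subseteq> E" "nullity U = r"
  shows "hamming_weight E \<Delta> r \<le> card U"
  unfolding hamming_weight_def using assms finite_ground
  by (intro Min_le) (auto simp: nullity_def)

lemma hamming_weight_ge: "r \<le> nullity E \<Longrightarrow> r \<le> hamming_weight E \<Delta> r"
  using hamming_weight_attained[of r] unfolding nullity_def by (metis diff_le_self)

lemma hamming_weight_le_card_circuit:
  assumes C: "C \<in> circuits E \<Delta>"
  shows "hamming_weight E \<Delta> 1 \<le> card C"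
proof (rule hamming_weight_le)
  show CE: "C \<subseteq> E" using C by (auto simp: circuits_def)
  have "C \<noteq> {}" using C empty_indep by (auto simp: circuits_def)
  then obtain e where e: "e \<in> C" by blast
  have fin: "finite C" using CE finite_ground finite_subset by blast
  have "C - {e} \<in> \<Delta>" using C e by (auto simp: circuits_def)
  then have "card (C - {e}) \<le> matroid_rank \<Delta> C" by (rule card_le_rank) auto
  moreover have "0 < nullity C" using nullity_pos_iff[OF CE] C by (auto simp: circuits_def)
  ultimately show "nullity C = 1"
    using nullity_add_rank[OF CE] card_Suc_Diff1[OF fin e] by simp
qed

end

section \<open>Ordinary powers containing a given symbolic monomial\<close>

context noetherian_matroid_family
begin

lemma dependent_prod_mem:
  assumes "U \<subseteq> E" "U \<notin> \<Delta>"
  shows "(\<Prod>i\<in>U. f i) \<in> circuit_ideal"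
proof -
  obtain C where C: "C \<in> circuits E \<Delta>" "C \<subseteq> U" using dependent_contains_circuit[OF assms] by blast
  have fin: "finite U" using assms finite_ground finite_subset by blast
  have "(\<Prod>i\<in>C. f i) \<in> circuit_ideal"
    unfolding circuit_ideal_def using C(1) by (intro ideal_span_base) auto
  moreover have "(\<Prod>i\<in>U - C. f i) \<in> A" using assms f_mem by auto
  ultimately show ?thesis
    using prod.subset_diff[OF C(2) fin, of f] is_idealD(4)[OF is_ideal_circuit_ideal] by simp
qed

text \<open>When the nullity is at least two, no element lies in every circuit, so the product over \<open>e\<close> of
  circuits avoiding \<open>e\<close> divides the power \<open>card E - 1\<close> of the product of all elements in circuits.\<close>

lemma prod_Union_circuits_power_mem:
  assumes two: "2 \<le> nullity E"
  shows "(\<Prod>i\<in>\<Union>(circuits E \<Delta>). f i) ^ (card E - 1) \<in> ideal_pow circuit_ideal (card E)"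
proof -
  define W where "W = \<Union>(circuits E \<Delta>)"
  have WE: "W \<subseteq> E" by (auto simp: W_def circuits_def)
  obtain C where C: "\<And>e. e \<in> E \<Longrightarrow> C e \<in> circuits E \<Delta>" "\<And>e. e \<in> E \<Longrightarrow> e \<notin> C e"
    using circuit_avoiding[OF two] by metis
  have CW: "C e \<subseteq> W" if "e \<in> E" for e using C(1)[OF that] by (auto simp: W_def)
  define b where "b i = (\<Sum>e\<in>E. indicator (C e) i :: nat)" for i
  have "(\<Prod>e\<in>E. monom_at f E (indicator (C e))) \<in> ideal_pow circuit_ideal (\<Sum>e\<in>E. 1)"
  proof (rule ideal_pow_prod_mem[OF is_ideal_circuit_ideal])
    fix e assume e: "e \<in> E"
    have "(\<Prod>i\<in>C e. f i) \<in> circuit_ideal"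
      unfolding circuit_ideal_def using C(1)[OF e] by (intro ideal_span_base) auto
    then show "monom_at f E (indicator (C e)) \<in> ideal_pow circuit_ideal 1"
      using monom_at_indicator[of "C e"] CW[OF e] WE by (metis ideal_pow_one_mem order_trans)
  qed
  moreover have "(\<Prod>e\<in>E. monom_at f E (indicator (C e))) = monom_at f E b"
    unfolding monom_at_def b_def power_sum by (rule prod.swap)
  ultimately have mem: "monom_at f E b \<in> ideal_pow circuit_ideal (card E)" by simp
  have "b i \<le> (card E - 1) * indicator W i" if i: "i \<in> E" for i
  proof (cases "i \<in> W")
    case True
    have "b i = (\<Sum>e\<in>E - {i}. indicator (C e) i)"
      unfolding b_def using C(2)[OF i] finite_ground i by (simp add: sum.remove)
    also have "\<dots> \<le> (\<Sum>e\<in>E - {i}. 1)" by (intro sum_mono) (auto simp: indicator_def)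
    finally show ?thesis using True i finite_ground by simp
  next
    case False
    then have "b i = 0" unfolding b_def using CW by (intro sum.neutral) (auto simp: indicator_def)
    then show ?thesis by simp
  qed
  then obtain c where c: "c \<in> A" "monom_at f E (\<lambda>i. (card E - 1) * indicator W i) = c * monom_at f E b"
    using monom_at_dvd[of b "\<lambda>i. (card E - 1) * indicator W i"] by metis
  have "monom_at f E (\<lambda>i. (card E - 1) * indicator W i) = monom_at f E (indicator W) ^ (card E - 1)"
    unfolding monom_at_def by (simp add: prod_power_distrib power_mult[symmetric] mult.commute)
  then have "(\<Prod>i\<in>W. f i) ^ (card E - 1) = c * monom_at f E b"
    using c(2) monom_at_indicator[OF WE] by simp
  then show ?thesis
    using is_idealD(4)[OF is_ideal_pow[OF is_ideal_circuit_ideal] c(1) mem] unfolding W_def by simp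
qed

text \<open>Divide \<open>p\<close> by \<open>card E - 1\<close>. Each full block of factors gains
  one additional power by \<open>prod_Union_circuits_power_mem\<close>, while each remaining factor
  still contributes one because it contains a circuit.\<close>

lemma prod_Union_circuits_power:
  assumes two: "2 \<le> nullity E"
  shows "(\<Prod>i\<in>\<Union>(circuits E \<Delta>). f i) ^ p \<in> ideal_pow circuit_ideal (p + p div (card E - 1))"
proof -
  define w where "w = (\<Prod>i\<in>\<Union>(circuits E \<Delta>). f i)"
  define n where "n = card E"
  have n: "1 < n" using two nullity_add_rank[of E] by (simp add: n_def)
  have WE: "\<Union>(circuits E \<Delta>) \<subseteq> E" by (auto simp: circuits_def)
  have "E \<notin> \<Delta>" using two nullity_pos_iff[of E] by auto
  then obtain C where "C \<in> circuits E \<Delta>" using dependent_contains_circuit[of E] by blast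
  then have "\<Union>(circuits E \<Delta>) \<notin> \<Delta>" using indep_subset[of _ C] by (auto simp: circuits_def)
  then have w1: "w \<in> ideal_pow circuit_ideal 1"
    unfolding w_def using dependent_prod_mem[OF WE] by (intro ideal_pow_one_mem)
  note pw = ideal_pow_power_mem[OF is_ideal_circuit_ideal]
  have "(w ^ (n - 1)) ^ (p div (n - 1)) \<in> ideal_pow circuit_ideal (n * (p div (n - 1)))"
    using prod_Union_circuits_power_mem[OF two] unfolding w_def n_def by (rule pw)
  from ideal_pow_add_mem[OF is_ideal_circuit_ideal this pw[OF w1, of "p mod (n - 1)"]]
  have "w ^ ((n - 1) * (p div (n - 1)) + p mod (n - 1))
      \<in> ideal_pow circuit_ideal (n * (p div (n - 1)) + 1 * (p mod (n - 1)))"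
    by (simp only: power_add power_mult)
  moreover have "(n - 1) * (p div (n - 1)) + p mod (n - 1) = p" by simp
  moreover have "n * (p div (n - 1)) = (n - 1) * (p div (n - 1)) + p div (n - 1)"
    using n by (cases n) auto
  then have "n * (p div (n - 1)) + 1 * (p mod (n - 1)) = p + p div (n - 1)"
    using mult_div_mod_eq[of "n - 1" p] by linarith
  ultimately show ?thesis unfolding w_def n_def by simp
qed

text \<open>The witness \<open>p\<close> counts the levels of full nullity, and \<open>q\<close> the
  other dependent levels, whose nullity is at least one smaller. Independent levels add nothing to
  the nullity sum and enter only as ring elements.\<close>

lemma symbolic_monomial_in_ideal_pow:
  assumes a: "a \<in> symbolic_exponents s"
  shows "\<exists>p q. s \<le> nullity E * p + (nullity E - 1) * q \<and>
    monom_at f E a \<in> ideal_pow circuit_ideal (p + q) \<and>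
    (2 \<le> nullity E \<longrightarrow> monom_at f E a \<in> ideal_pow circuit_ideal (p + p div (card E - 1) + q))"
proof -
  define M where "M = sum a E"
  have M: "a i \<le> M" if "i \<in> E" for i unfolding M_def using that finite_ground by (intro member_le_sum) auto
  define U where "U t = {i\<in>E. t \<le> a i}" for t
  have UE: "U t \<subseteq> E" for t by (auto simp: U_def)
  define m where "m t = (\<Prod>i\<in>U t. f i)" for t
  have mA: "m t \<in> A" for t unfolding m_def using f_mem UE by blast
  define T1 where "T1 = {t\<in>{1..M}. 0 < nullity (U t) \<and> nullity (U t) = nullity E}"
  define T2 where "T2 = {t\<in>{1..M}. 0 < nullity (U t) \<and> nullity (U t) \<noteq> nullity E}"
  define T3 where "T3 = {t\<in>{1..M}. nullity (U t) = 0}"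
  have T: "{1..M} = T1 \<union> T2 \<union> T3" by (auto simp: T1_def T2_def T3_def)
  have fin: "finite T1" "finite T2" "finite T3" by (auto simp: T1_def T2_def T3_def)
  have disj: "T1 \<inter> T2 = {}" "(T1 \<union> T2) \<inter> T3 = {}" by (auto simp: T1_def T2_def T3_def)
  have null_le: "nullity (U t) \<le> nullity E" for t using nullity_mono[OF UE[of t]] by simp
  have "s \<le> (\<Sum>t\<in>{1..M}. nullity (U t))"
    using symbolic_exponents_levels[OF a M] by (simp add: U_def)
  also have "\<dots> = (\<Sum>t\<in>T1. nullity (U t)) + (\<Sum>t\<in>T2. nullity (U t)) + (\<Sum>t\<in>T3. nullity (U t))"
    unfolding T using fin disj by (simp add: sum.union_disjoint)
  also have "(\<Sum>t\<in>T1. nullity (U t)) = nullity E * card T1" by (simp add: T1_def)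
  also have "(\<Sum>t\<in>T3. nullity (U t)) = 0" by (simp add: T3_def)
  also have "(\<Sum>t\<in>T2. nullity (U t)) \<le> (\<Sum>t\<in>T2. nullity E - 1)"
  proof (rule sum_mono)
    fix t assume "t \<in> T2"
    then show "nullity (U t) \<le> nullity E - 1" using null_le[of t] unfolding T2_def by clarify linarith
  qed
  finally have s: "s \<le> nullity E * card T1 + (nullity E - 1) * card T2" by (simp add: mult.commute)
  \<comment> \<open>The monomial is the product over \<open>t\<close> of the squarefree products
    over its level sets, obtained by exchanging the order of the two products.\<close>
  have "monom_at f E a = (\<Prod>i\<in>E. \<Prod>t\<in>{1..M}. if t \<le> a i then f i else 1)"
    unfolding monom_at_def
  proof (rule prod.cong[OF refl])
    fix i assume "i \<in> E"
    then have "{1..M} \<inter> {t. t \<le> a i} = {1..a i}" using M[of i] by auto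
    then show "f i ^ a i = (\<Prod>t\<in>{1..M}. if t \<le> a i then f i else 1)"
      by (simp add: prod.If_cases)
  qed
  also have "\<dots> = (\<Prod>t\<in>{1..M}. \<Prod>i\<in>E. if t \<le> a i then f i else 1)" by (rule prod.swap)
  also have "\<dots> = (\<Prod>t\<in>{1..M}. m t)"
    unfolding m_def U_def using finite_ground by (simp add: prod.inter_filter)
  also have "\<dots> = prod m T1 * prod m T2 * prod m T3"
    unfolding T using fin disj by (simp add: prod.union_disjoint)
  finally have mon: "monom_at f E a = prod m T1 * prod m T2 * prod m T3" .
  have m1: "m t \<in> ideal_pow circuit_ideal 1" if "0 < nullity (U t)" for t
    unfolding m_def using that nullity_pos_iff[OF UE] by (intro ideal_pow_one_mem dependent_prod_mem UE) auto
  note pm = ideal_pow_prod_mem[OF is_ideal_circuit_ideal, where s = "\<lambda>_. 1"]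
  have T1: "prod m T1 \<in> ideal_pow circuit_ideal (card T1)"
    using pm[of T1 m] m1 by (simp add: T1_def del: ideal_pow.simps)
  have T2: "prod m T2 \<in> ideal_pow circuit_ideal (card T2)"
    using pm[of T2 m] m1 by (simp add: T2_def del: ideal_pow.simps)
  have T3: "prod m T3 \<in> A" using mA by blast
  have comb: "monom_at f E a \<in> ideal_pow circuit_ideal (d + card T2)" if "prod m T1 \<in> ideal_pow circuit_ideal d" for d
    unfolding mon
    by (intro is_idealD(5)[OF is_ideal_pow] ideal_pow_add_mem that T2 T3 is_ideal_circuit_ideal)
  have "prod m T1 \<in> ideal_pow circuit_ideal (card T1 + card T1 div (card E - 1))" if two: "2 \<le> nullity E"
  proof -
    define W where "W = \<Union>(circuits E \<Delta>)"
    \<comment> \<open>A level set of full nullity contains every circuit, so the same product over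
      \<open>W\<close> splits off from all these levels.\<close>
    have "m t = (\<Prod>i\<in>W. f i) * (\<Prod>i\<in>U t - W. f i)" if "t \<in> T1" for t
    proof -
      have "W \<subseteq> U t" using that circuits_subset_if_full_nullity[OF UE[of t]] by (auto simp: T1_def W_def)
      then show ?thesis unfolding m_def
        using prod.subset_diff[of W "U t" f] UE finite_ground finite_subset mult.commute by metis
    qed
    then have "prod m T1 = (\<Prod>i\<in>W. f i) ^ card T1 * (\<Prod>t\<in>T1. \<Prod>i\<in>U t - W. f i)"
      by (simp add: prod.distrib)
    moreover have "(\<Prod>t\<in>T1. \<Prod>i\<in>U t - W. f i) \<in> A" using f_mem UE by blast
    ultimately show ?thesis
      using is_idealD(5)[OF is_ideal_pow[OF is_ideal_circuit_ideal]]
        prod_Union_circuits_power[OF two, of "card T1"] unfolding W_def by metis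
  qed
  then show ?thesis using s comb[OF T1] comb by blast
qed

text \<open>A generator outside the \<open>r\<close>-th power limits the counts \<open>p\<close> and
  \<open>q\<close>. The first bound uses \<open>p + q < r\<close>; the second also uses the factors
  gained by blocks of full levels.\<close>

lemma not_subset_ideal_pow_bound:
  assumes "\<not> monomial_ideal (symbolic_exponents s) \<subseteq> ideal_pow circuit_ideal r" and c: "1 \<le> nullity E"
  shows "real s \<le> real (nullity E) * real r"
    and "2 \<le> nullity E \<Longrightarrow>
      real s \<le> max (real (nullity E) * (real (card E) - 1) / real (card E)) (real (nullity E) - 1) * real r"
proof -
  obtain a where a: "a \<in> symbolic_exponents s" "monom_at f E a \<notin> ideal_pow circuit_ideal r"
    using assms(1) ideal_span_least[OF is_ideal_pow[OF is_ideal_circuit_ideal]]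
    unfolding monomial_ideal_def by blast
  obtain p q where pq: "s \<le> nullity E * p + (nullity E - 1) * q"
      "monom_at f E a \<in> ideal_pow circuit_ideal (p + q)"
      "2 \<le> nullity E \<Longrightarrow> monom_at f E a \<in> ideal_pow circuit_ideal (p + p div (card E - 1) + q)"
    using symbolic_monomial_in_ideal_pow[OF a(1)] by blast
  have small: "d < r" if "monom_at f E a \<in> ideal_pow circuit_ideal d" for d
    using that a(2) ideal_pow_antimono[OF is_ideal_circuit_ideal, of r d] by (meson not_le subsetD)
  have "s \<le> nullity E * p + nullity E * q"
    using pq(1) mult_le_mono1[of "nullity E - 1" "nullity E" q] by linarith
  also have "\<dots> = nullity E * (p + q)" by (simp add: distrib_left)
  also have "\<dots> \<le> nullity E * r" using small[OF pq(2)] by simp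
  finally show "real s \<le> real (nullity E) * real r" by (metis of_nat_le_iff of_nat_mult)
  assume two: "2 \<le> nullity E"
  define n where "n = real (card E)"
  \<comment> \<open>These are the two rates of nullity per factor: a full level yields
    asymptotically \<open>n / (n - 1)\<close> factors for nullity \<open>nullity E\<close>, any
    other dependent level one factor for at most \<open>nullity E - 1\<close>.\<close>
  define \<rho> where "\<rho> = max (real (nullity E) * (n - 1) / n) (real (nullity E) - 1)"
  have card: "2 \<le> card E" using two nullity_add_rank[of E] by simp
  then have n: "n > 1" by (simp add: n_def)
  \<comment> \<open>Rounding in the division costs less than one. This is regained because failure
    of membership is a strict inequality between integers.\<close>
  have "p < (p div (card E - 1) + 1) * (card E - 1)"
    using card div_less_iff_less_mult[of "card E - 1" p "p div (card E - 1) + 1"] by simp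
  then have "real p < real ((p div (card E - 1) + 1) * (card E - 1))" by (rule of_nat_less_iff[THEN iffD2])
  also have "\<dots> = (real (p div (card E - 1)) + 1) * (n - 1)"
    unfolding n_def using card by (simp only: of_nat_mult of_nat_add of_nat_1 of_nat_diff)
  finally have "real p / (n - 1) < real (p div (card E - 1)) + 1"
    using n by (simp add: divide_less_eq)
  moreover have "p + p div (card E - 1) + q + 1 \<le> r" using small[OF pq(3)[OF two]] by simp
  then have "real p + real (p div (card E - 1)) + real q + 1 \<le> real r"
    by (metis of_nat_1 of_nat_add of_nat_le_iff)
  moreover have "real p * (n / (n - 1)) = real p + real p / (n - 1)"
    using n by (simp add: field_simps)
  ultimately have r: "real p * (n / (n - 1)) + real q \<le> real r" by linarith
  have \<rho>0: "\<rho> \<ge> 0" using two by (simp add: \<rho>_def le_max_iff_disj)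
  have "real s \<le> real (nullity E) * real p + (real (nullity E) - 1) * real q"
  proof -
    have "real s \<le> real (nullity E * p + (nullity E - 1) * q)" using pq(1) by (rule of_nat_mono)
    then show ?thesis using c by (simp only: of_nat_mult of_nat_add of_nat_1 of_nat_diff)
  qed
  also have "\<dots> \<le> \<rho> * (n / (n - 1)) * real p + \<rho> * real q"
  proof (intro add_mono mult_right_mono)
    have "real (nullity E) = real (nullity E) * (n - 1) / n * (n / (n - 1))" using n by simp
    also have "\<dots> \<le> \<rho> * (n / (n - 1))" using n by (intro mult_right_mono) (auto simp: \<rho>_def)
    finally show "real (nullity E) \<le> \<rho> * (n / (n - 1))" .
  qed (auto simp: \<rho>_def)
  also have "\<dots> = \<rho> * (real p * (n / (n - 1)) + real q)" by (simp add: algebra_simps)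
  also have "\<dots> \<le> \<rho> * real r" using r \<rho>0 by (rule mult_left_mono)
  finally show "real s \<le> max (real (nullity E) * (real (card E) - 1) / real (card E)) (real (nullity E) - 1) * real r"
    unfolding \<rho>_def n_def .
qed

end

section \<open>Translation to rings with carrier sets\<close>

context subring_carrier
begin

abbreviation (input) sub_ring :: "'a ring" where
  "sub_ring \<equiv> ring_of_type_algebra\<lparr>carrier := A\<rparr>"

lemma sub_ring_ops:
  "carrier sub_ring = A" "x \<otimes>\<^bsub>sub_ring\<^esub> y = x * y" "x \<oplus>\<^bsub>sub_ring\<^esub> y = x + y"
  "\<one>\<^bsub>sub_ring\<^esub> = 1" "\<zero>\<^bsub>sub_ring\<^esub> = 0"
  by (simp_all add: ring_of_type_algebra_def)

lemma ring_of_type_algebra_ops: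
  "x \<otimes>\<^bsub>ring_of_type_algebra\<^esub> y = x * y" "x \<oplus>\<^bsub>ring_of_type_algebra\<^esub> y = x + y"
  for x y :: "'b::comm_ring_1"
  by (simp_all add: ring_of_type_algebra_def)

lemmas sub_ring_simps = sub_ring_ops ring_of_type_algebra_ops

lemma cring_sub_ring: "cring sub_ring"
proof (rule cringI)
  show "abelian_group sub_ring"
  proof (rule abelian_groupI)
    fix x assume "x \<in> carrier sub_ring"
    then show "\<exists>y\<in>carrier sub_ring. y \<oplus>\<^bsub>sub_ring\<^esub> x = \<zero>\<^bsub>sub_ring\<^esub>"
      unfolding sub_ring_simps by (intro bexI[of _ "- x"]) auto
  qed (auto simp: sub_ring_simps)
  show "Group.comm_monoid sub_ring"
    by (rule comm_monoidI) (auto simp: sub_ring_simps mult.assoc mult.commute)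
qed (auto simp: sub_ring_simps distrib_right)

lemma ideal_sub_ring_iff: "ideal K sub_ring \<longleftrightarrow> is_ideal K"
proof
  assume "ideal K sub_ring"
  then interpret ideal K sub_ring .
  show "is_ideal K"
    unfolding is_ideal_def
    using a_subset additive_subgroup.zero_closed[OF is_additive_subgroup]
      additive_subgroup.a_closed[OF is_additive_subgroup] I_l_closed
    unfolding sub_ring_simps by (intro conjI ballI) simp_all
next
  interpret R: cring sub_ring by (rule cring_sub_ring)
  assume K: "is_ideal K"
  show "ideal K sub_ring"
  proof (rule idealI)
    show "ring sub_ring" by (rule R.ring_axioms)
    show "subgroup K (add_monoid sub_ring)"
    proof (rule R.add.subgroupI)
      fix x assume x: "x \<in> K"
      then have "x \<in> A" using is_idealD(1)[OF K] by blast
      then have "\<ominus>\<^bsub>sub_ring\<^esub> x = - x"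
        using R.minus_equality[of "- x" x] by (auto simp: sub_ring_simps)
      then show "\<ominus>\<^bsub>sub_ring\<^esub> x \<in> K" using is_idealD(6)[OF K x] by simp
    qed (use is_idealD[OF K] in \<open>auto simp: sub_ring_simps\<close>)
  qed (use is_idealD[OF K] in \<open>auto simp: sub_ring_simps\<close>)
qed

lemma genideal_sub_ring:
  assumes "G \<subseteq> A" shows "genideal sub_ring G = ideal_span G"
proof
  interpret R: cring sub_ring by (rule cring_sub_ring)
  have "G \<subseteq> genideal sub_ring G" using R.genideal_self[of G] assms by (simp add: sub_ring_simps)
  moreover have "is_ideal (genideal sub_ring G)"
    using R.genideal_ideal[of G] assms by (simp add: sub_ring_simps ideal_sub_ring_iff)
  ultimately show "ideal_span G \<subseteq> genideal sub_ring G" by (intro ideal_span_least)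
  show "genideal sub_ring G \<subseteq> ideal_span G"
    using is_ideal_span[OF assms] ideal_span_base by (intro R.genideal_minimal) (auto simp: ideal_sub_ring_iff)
qed

lemma ideal_prod_sub_ring:
  assumes K: "is_ideal K" and L: "is_ideal L"
  shows "ideal_prod sub_ring K L = ideal_span {x * y | x y. x \<in> K \<and> y \<in> L}"
proof
  interpret R: cring sub_ring by (rule cring_sub_ring)
  have sub: "{x * y | x y. x \<in> K \<and> y \<in> L} \<subseteq> A"
    using is_idealD(1)[OF K] is_idealD(1)[OF L] by blast
  show "ideal_prod sub_ring K L \<subseteq> ideal_span {x * y | x y. x \<in> K \<and> y \<in> L}"
  proof
    fix x assume "x \<in> ideal_prod sub_ring K L"
    then show "x \<in> ideal_span {x * y | x y. x \<in> K \<and> y \<in> L}"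
    proof induction
      case (prod i j)
      then show ?case unfolding sub_ring_simps by (intro ideal_span_base) blast
    next
      case (sum s1 s2)
      then show ?case unfolding sub_ring_simps using is_idealD(3)[OF is_ideal_span[OF sub]] by blast
    qed
  qed
  have "is_ideal (ideal_prod sub_ring K L)"
    using R.ideal_prod_is_ideal K L by (simp add: ideal_sub_ring_iff)
  moreover have "x * y \<in> ideal_prod sub_ring K L" if "x \<in> K" "y \<in> L" for x y
    using ideal_prod.prod[OF that, of sub_ring] by (simp add: sub_ring_simps)
  ultimately show "ideal_span {x * y | x y. x \<in> K \<and> y \<in> L} \<subseteq> ideal_prod sub_ring K L"
    by (intro ideal_span_least) auto
qed

lemma ideal_power_sub_ring:
  assumes K: "is_ideal K"
  shows "ideal_power sub_ring K s = ideal_pow K s"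
proof (induction s)
  case 0
  show ?case by (simp add: nat_pow_def ideals_set_def sub_ring_simps)
next
  case (Suc s)
  have "ideal_power sub_ring K (Suc s) = ideal_prod sub_ring (ideal_power sub_ring K s) K"
    by (simp add: nat_pow_def ideals_set_def)
  then show ?case unfolding Suc using ideal_prod_sub_ring[OF is_ideal_pow[OF K] K] by simp
qed

lemma quotient_carrier: "carrier (sub_ring Quot K) = {K +>\<^bsub>sub_ring\<^esub> x | x. x \<in> A}"
  by (auto simp: FactRing_def A_RCOSETS_def' sub_ring_simps)

lemma quotient_zero: "\<zero>\<^bsub>sub_ring Quot K\<^esub> = K"
  by (simp add: FactRing_def)

lemma quotient_mult:
  assumes "is_ideal K" "x \<in> A" "y \<in> A"
  shows "(K +>\<^bsub>sub_ring\<^esub> x) \<otimes>\<^bsub>sub_ring Quot K\<^esub> (K +>\<^bsub>sub_ring\<^esub> y) = K +>\<^bsub>sub_ring\<^esub> (x * y)"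
  using ideal.rcoset_mult_add[of K sub_ring x y] assms
  by (simp add: FactRing_def ideal_sub_ring_iff sub_ring_simps)

lemma coset_eq_iff:
  assumes K: "is_ideal K" and x: "x \<in> A"
  shows "K +>\<^bsub>sub_ring\<^esub> x = K \<longleftrightarrow> x \<in> K"
proof
  interpret K: ideal K sub_ring using K by (simp add: ideal_sub_ring_iff)
  show "x \<in> K" if "K +>\<^bsub>sub_ring\<^esub> x = K"
    using K.a_rcos_self[of x] that x by (simp add: sub_ring_simps)
  show "K +>\<^bsub>sub_ring\<^esub> x = K" if "x \<in> K"
    using K.a_rcos_const[OF that] .
qed

lemma quotient_ann_iff:
  assumes K: "is_ideal K" and "x \<in> A" "y \<in> A"
  shows "(K +>\<^bsub>sub_ring\<^esub> x) \<otimes>\<^bsub>sub_ring Quot K\<^esub> (K +>\<^bsub>sub_ring\<^esub> y) = \<zero>\<^bsub>sub_ring Quot K\<^esub> \<longleftrightarrow> x * y \<in> K"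
  using assms by (simp add: quotient_mult quotient_zero coset_eq_iff mult_mem)

lemma primeideal_sub_ring_iff: "primeideal P sub_ring \<longleftrightarrow> prime_ideal P"
proof
  assume "primeideal P sub_ring"
  then interpret primeideal P sub_ring .
  have P: "is_ideal P" using is_ideal ideal_sub_ring_iff by blast
  have "1 \<notin> P"
  proof
    assume "1 \<in> P"
    then have "A \<subseteq> P" using is_idealD(4)[OF P, of _ 1] by auto
    then show False using I_notcarr is_idealD(1)[OF P] by (auto simp: sub_ring_simps)
  qed
  then show "prime_ideal P" unfolding prime_ideal_def using P I_prime by (simp add: sub_ring_simps)
next
  assume P: "prime_ideal P"
  then show "primeideal P sub_ring"
    unfolding prime_ideal_def
    by (intro primeidealI cring_sub_ring) (auto simp: sub_ring_simps ideal_sub_ring_iff)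
qed

lemma associated_primes_sub_ring:
  assumes K: "is_ideal K"
  shows "associated_primes sub_ring K = {P. assoc_prime K P}"
proof -
  have "{a \<in> carrier sub_ring. (K +>\<^bsub>sub_ring\<^esub> a) \<otimes>\<^bsub>sub_ring Quot K\<^esub> (K +>\<^bsub>sub_ring\<^esub> x) = \<zero>\<^bsub>sub_ring Quot K\<^esub>}
      = colon K x" if "x \<in> A" for x
    using quotient_ann_iff[OF K _ that] by (auto simp: colon_def sub_ring_simps)
  then have "(\<exists>Y\<in>carrier (sub_ring Quot K). P = {a \<in> carrier sub_ring.
      (K +>\<^bsub>sub_ring\<^esub> a) \<otimes>\<^bsub>sub_ring Quot K\<^esub> Y = \<zero>\<^bsub>sub_ring Quot K\<^esub>}) \<longleftrightarrow> (\<exists>x\<in>A. P = colon K x)" for P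
    unfolding quotient_carrier by auto
  then show ?thesis
    by (simp add: associated_primes_def assoc_prime_def primeideal_sub_ring_iff)
qed

text \<open>Only the condition on the last member enters; listing a set first and a new element last
  turns regularity into cancellation modulo that set.\<close>

lemma regular_sequence_snoc_nonzerodivisor:
  assumes "regular_sequence sub_ring (fs @ [g])" and r: "r \<in> A" "g * r \<in> ideal_span (set fs)"
  shows "r \<in> ideal_span (set fs)"
proof -
  have fs: "set fs \<subseteq> A" "g \<in> A" using assms(1) by (auto simp: regular_sequence_def sub_ring_simps)
  have gen: "genideal sub_ring (set fs) = ideal_span (set fs)" using genideal_sub_ring[OF fs(1)] .
  have "length fs < length (fs @ [g])" by simp
  then have "\<forall>x\<in>carrier (sub_ring Quot ideal_span (set fs)).
      (ideal_span (set fs) +>\<^bsub>sub_ring\<^esub> g) \<otimes>\<^bsub>sub_ring Quot ideal_span (set fs)\<^esub> x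
        = \<zero>\<^bsub>sub_ring Quot ideal_span (set fs)\<^esub> \<longrightarrow> x = \<zero>\<^bsub>sub_ring Quot ideal_span (set fs)\<^esub>"
    using assms(1) unfolding regular_sequence_def Let_def
    by (elim conjE allE[of _ "length fs"]) (simp add: gen)
  then have "ideal_span (set fs) +>\<^bsub>sub_ring\<^esub> r = \<zero>\<^bsub>sub_ring Quot ideal_span (set fs)\<^esub>"
    using quotient_ann_iff[OF is_ideal_span[OF fs(1)] fs(2) r(1)] r unfolding quotient_carrier by blast
  then show ?thesis
    unfolding quotient_zero using coset_eq_iff[OF is_ideal_span[OF fs(1)] r(1)] by blast
qed

end

section \<open>Localization and symbolic powers\<close>

lemma subring_localization:
  assumes "subring_carrier A" "subring_carrier.prime_ideal A P"
  shows "subring_carrier {Fract a u | a u. a \<in> A \<and> u \<in> A - P}"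
proof -
  interpret subring_carrier A by fact
  have P: "is_ideal P" "1 \<notin> P" "\<And>p q. p \<in> A \<Longrightarrow> q \<in> A \<Longrightarrow> p * q \<in> P \<Longrightarrow> p \<in> P \<or> q \<in> P"
    using assms(2) by (auto simp: prime_ideal_def)
  have nz: "u \<noteq> 0" if "u \<in> A - P" for u using that is_idealD(2)[OF P(1)] by auto
  show ?thesis
  proof
    show "1 \<in> {Fract a u | a u. a \<in> A \<and> u \<in> A - P}"
      unfolding One_fract_def using P(2) by blast
  next
    fix x y assume "x \<in> {Fract a u | a u. a \<in> A \<and> u \<in> A - P}" "y \<in> {Fract a u | a u. a \<in> A \<and> u \<in> A - P}"
    then obtain a u b v where x: "x = Fract a u" "a \<in> A" "u \<in> A - P"
      and y: "y = Fract b v" "b \<in> A" "v \<in> A - P" by blast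
    have uv: "u * v \<in> A - P" using x y P(3) by blast
    have "x + y = Fract (a * v + b * u) (u * v)" using x y nz by simp
    moreover have "a * v + b * u \<in> A" using x y by auto
    ultimately show "x + y \<in> {Fract a u | a u. a \<in> A \<and> u \<in> A - P}" using uv by blast
    have "x * y = Fract (a * b) (u * v)" using x y nz by simp
    moreover have "a * b \<in> A" using x y by auto
    ultimately show "x * y \<in> {Fract a u | a u. a \<in> A \<and> u \<in> A - P}" using uv by blast
  next
    fix x assume "x \<in> {Fract a u | a u. a \<in> A \<and> u \<in> A - P}"
    then obtain a u where x: "x = Fract a u" "a \<in> A" "u \<in> A - P" by blast
    then have "- x = Fract (- a) u" "- a \<in> A" by auto
    then show "- x \<in> {Fract a u | a u. a \<in> A \<and> u \<in> A - P}" using x by blast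
  qed
qed

text \<open>The fractions with numerator in \<open>K\<close> and denominator outside
  \<open>P\<close> already form an ideal of the localization, so a common denominator is always
  available.\<close>

lemma mem_extension_localization_iff:
  assumes A: "subring_carrier A" and P: "subring_carrier.prime_ideal A P"
    and K: "subring_carrier.is_ideal A K" and a: "a \<in> A"
  shows "Fract a 1 \<in> genideal (localization_at (ring_of_type_algebra\<lparr>carrier := A\<rparr>) P) ((\<lambda>b. Fract b 1) ` K)
    \<longleftrightarrow> (\<exists>u\<in>A - P. u * a \<in> K)"
proof -
  interpret subring_carrier A by fact
  define L where "L = {Fract a u | a u. a \<in> A \<and> u \<in> A - P}"
  interpret L: subring_carrier L unfolding L_def by (rule subring_localization[OF A P])
  have loc: "localization_at (ring_of_type_algebra\<lparr>carrier := A\<rparr>) P = ring_of_type_algebra\<lparr>carrier := L\<rparr>"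
    by (simp add: localization_at_def L_def)
  have P': "is_ideal P" "1 \<notin> P" "\<And>p q. p \<in> A \<Longrightarrow> q \<in> A \<Longrightarrow> p * q \<in> P \<Longrightarrow> p \<in> P \<or> q \<in> P"
    using P by (auto simp: prime_ideal_def)
  have nz: "u \<noteq> 0" if "u \<in> A - P" for u using that is_idealD(2)[OF P'(1)] by auto
  have one: "1 \<in> A - P" using P'(2) by simp
  have sub: "(\<lambda>b. Fract b 1) ` K \<subseteq> L" using is_idealD(1)[OF K] one unfolding L_def by blast
  have gen: "genideal (localization_at (ring_of_type_algebra\<lparr>carrier := A\<rparr>) P) ((\<lambda>b. Fract b 1) ` K)
      = L.ideal_span ((\<lambda>b. Fract b 1) ` K)"
    unfolding loc by (rule L.genideal_sub_ring[OF sub])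
  define KL where "KL = {Fract b u | b u. b \<in> K \<and> u \<in> A - P}"
  have KL: "L.is_ideal KL"
    unfolding L.is_ideal_def
  proof (intro conjI ballI)
    show "KL \<subseteq> L" using is_idealD(1)[OF K] unfolding KL_def L_def by blast
    show "0 \<in> KL" unfolding KL_def Zero_fract_def using is_idealD(2)[OF K] one by blast
  next
    fix x y assume "x \<in> KL" "y \<in> KL"
    then obtain b u c v where x: "x = Fract b u" "b \<in> K" "u \<in> A - P"
      and y: "y = Fract c v" "c \<in> K" "v \<in> A - P" unfolding KL_def by blast
    have uv: "u * v \<in> A - P" using x y P'(3) by blast
    have "x + y = Fract (b * v + c * u) (u * v)" using x y nz by simp
    moreover have "b * v + c * u \<in> K" using x y is_idealD(3,5)[OF K] by simp
    ultimately show "x + y \<in> KL" unfolding KL_def using uv by blast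
  next
    fix x y assume "x \<in> L" "y \<in> KL"
    then obtain b u c v where x: "x = Fract b u" "b \<in> A" "u \<in> A - P"
      and y: "y = Fract c v" "c \<in> K" "v \<in> A - P" unfolding KL_def L_def by blast
    have uv: "u * v \<in> A - P" using x y P'(3) by blast
    have "x * y = Fract (b * c) (u * v)" using x y nz by simp
    moreover have "b * c \<in> K" using x y is_idealD(4)[OF K] by simp
    ultimately show "x * y \<in> KL" unfolding KL_def using uv by blast
  qed
  show ?thesis unfolding gen
  proof
    assume "Fract a 1 \<in> L.ideal_span ((\<lambda>b. Fract b 1) ` K)"
    moreover have "(\<lambda>b. Fract b 1) ` K \<subseteq> KL" unfolding KL_def using one by blast
    ultimately have "Fract a 1 \<in> KL" using L.ideal_span_least[OF KL] by blast
    then obtain b u where bu: "Fract a 1 = Fract b u" "b \<in> K" "u \<in> A - P" unfolding KL_def by blast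
    \<comment> \<open>In a domain, equality of fractions is cross multiplication, so the denominator
      itself is the multiplier.\<close>
    then have "u * a = b" using nz[OF bu(3)] by (simp add: eq_fract mult.commute)
    then show "\<exists>u\<in>A - P. u * a \<in> K" using bu by blast
  next
    assume "\<exists>u\<in>A - P. u * a \<in> K"
    then obtain u where u: "u \<in> A - P" "u * a \<in> K" by blast
    have "Fract 1 u \<in> L" unfolding L_def using u(1) by blast
    moreover have "Fract (u * a) 1 \<in> L.ideal_span ((\<lambda>b. Fract b 1) ` K)"
      using u(2) by (intro L.ideal_span_base) blast
    ultimately have "Fract 1 u * Fract (u * a) 1 \<in> L.ideal_span ((\<lambda>b. Fract b 1) ` K)"
      by (rule L.is_idealD(4)[OF L.is_ideal_span[OF sub]])
    moreover have "Fract 1 u * Fract (u * a) 1 = Fract a 1" using nz[OF u(1)] by (simp add: eq_fract)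
    ultimately show "Fract a 1 \<in> L.ideal_span ((\<lambda>b. Fract b 1) ` K)" by simp
  qed
qed

lemma symbolic_power_sub_ring:
  assumes A: "subring_carrier A" and K: "subring_carrier.is_ideal A K"
  shows "symbolic_power (ring_of_type_algebra\<lparr>carrier := A\<rparr>) K s = subring_carrier.symb_pow A K s"
proof -
  interpret subring_carrier A by fact
  have "(\<forall>P\<in>associated_primes sub_ring K.
      Fract a 1 \<in> genideal (localization_at sub_ring P) ((\<lambda>b. Fract b 1) ` ideal_power sub_ring K s))
    \<longleftrightarrow> (\<forall>P. assoc_prime K P \<longrightarrow> (\<exists>u\<in>A - P. u * a \<in> ideal_pow K s))" if a: "a \<in> A" for a
    unfolding associated_primes_sub_ring[OF K] ideal_power_sub_ring[OF K]
    using mem_extension_localization_iff[OF A _ is_ideal_pow[OF K] a] unfolding assoc_prime_def by auto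
  then show ?thesis unfolding symbolic_power_def symb_pow_def sub_ring_simps by blast
qed

lemma polynomial_ring_eq: "polynomial_ring V = ring_of_type_algebra\<lparr>carrier := polys_in V\<rparr>"
  by (simp add: polynomial_ring_def polys_in_def)

section \<open>Resurgence\<close>

lemma ring_hom_sub_ring:
  assumes "\<phi> \<in> ring_hom (ring_of_type_algebra\<lparr>carrier := A\<rparr>) (ring_of_type_algebra\<lparr>carrier := B\<rparr>)"
    and "subring_carrier A"
  shows "\<And>x. x \<in> A \<Longrightarrow> \<phi> x \<in> B" "\<And>x y. x \<in> A \<Longrightarrow> y \<in> A \<Longrightarrow> \<phi> (x + y) = \<phi> x + \<phi> y"
    "\<And>x y. x \<in> A \<Longrightarrow> y \<in> A \<Longrightarrow> \<phi> (x * y) = \<phi> x * \<phi> y" "\<phi> 1 = 1" "\<phi> 0 = 0"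
    "\<And>F u. (\<And>i. i \<in> F \<Longrightarrow> u i \<in> A) \<Longrightarrow> \<phi> (\<Prod>i\<in>F. u i) = (\<Prod>i\<in>F. \<phi> (u i))"
proof -
  interpret subring_carrier A by fact
  show "\<And>x. x \<in> A \<Longrightarrow> \<phi> x \<in> B" and add: "\<And>x y. x \<in> A \<Longrightarrow> y \<in> A \<Longrightarrow> \<phi> (x + y) = \<phi> x + \<phi> y"
    and mult: "\<And>x y. x \<in> A \<Longrightarrow> y \<in> A \<Longrightarrow> \<phi> (x * y) = \<phi> x * \<phi> y" and one: "\<phi> 1 = 1"
    using assms(1) by (auto simp: ring_hom_def ring_of_type_algebra_def)
  show "\<phi> 0 = 0" using add[of 0 0] by simp
  show "\<phi> (\<Prod>i\<in>F. u i) = (\<Prod>i\<in>F. \<phi> (u i))" if "\<And>i. i \<in> F \<Longrightarrow> u i \<in> A" for F and u :: "'c \<Rightarrow> 'a"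
    using that by (induction F rule: infinite_finite_induct) (auto simp: one mult prod_mem)
qed

text \<open>An eventual failure of containment occurs at some \<open>t \<ge> 1\<close>, and scaling
  both exponents by \<open>t\<close> leaves the ratio unchanged.\<close>

lemma asymptotic_resurgence_le_resurgence: "asymptotic_resurgence A J \<le> resurgence A J"
  unfolding asymptotic_resurgence_def resurgence_def
proof (rule Sup_subset_mono, safe)
  fix s r :: nat
  assume sr: "1 \<le> s" "1 \<le> r"
    and ev: "\<forall>\<^sub>F t in sequentially. \<not> symbolic_power A J (s * t) \<subseteq> ideal_power A J (r * t)"
  from eventually_conj[OF ev eventually_ge_at_top[of 1]]
  obtain t where t: "1 \<le> t" "\<not> symbolic_power A J (s * t) \<subseteq> ideal_power A J (r * t)"
    using eventually_happens by fastforce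
  have "real s / real r = real (s * t) / real (r * t)" using t(1) by simp
  moreover have "1 \<le> s * t" "1 \<le> r * t" using sr t(1) by (simp_all add: Suc_le_eq)
  ultimately show "\<exists>s' r'. ereal (real s / real r) = ereal (real s' / real r') \<and> 1 \<le> s' \<and> 1 \<le> r' \<and>
      \<not> symbolic_power A J s' \<subseteq> ideal_power A J r'"
    using t(2) by metis
qed

lemma resurgence_mono:
  assumes "\<And>s r. \<not> symbolic_power A J s \<subseteq> ideal_power A J r \<Longrightarrow> \<not> symbolic_power B I s \<subseteq> ideal_power B I r"
  shows "resurgence A J \<le> resurgence B I"
  unfolding resurgence_def using assms by (intro Sup_subset_mono) blast

lemma resurgence_le:
  assumes "\<And>s r. \<not> symbolic_power A J s \<subseteq> ideal_power A J r \<Longrightarrow> real s \<le> \<rho> * real r"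
  shows "resurgence A J \<le> ereal \<rho>"
  unfolding resurgence_def
proof (rule Sup_least)
  fix x assume "x \<in> {ereal (real s / real r) | s r. s \<ge> 1 \<and> r \<ge> 1 \<and> \<not> symbolic_power A J s \<subseteq> ideal_power A J r}"
  then obtain s r where "x = ereal (real s / real r)" "1 \<le> r" "real s \<le> \<rho> * real r" using assms by blast
  then show "x \<le> ereal \<rho>" by (simp add: divide_le_eq)
qed

theorem corollary8p6:
  fixes n k N :: nat
    and \<Delta> :: "nat set set"
    and S R :: "'l::field mpoly ring"
    and f :: "nat \<Rightarrow> 'l mpoly"
    and \<delta> :: "nat \<Rightarrow> nat"
    and \<phi> :: "'l mpoly \<Rightarrow> 'l mpoly"
    and I J :: "'l mpoly set"
  assumes "matroid {1..n} \<Delta>"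
    and "matroid_rank \<Delta> {1..n} = k"
    and "0 < k" and "k < n"
    and "N \<ge> n - k"
    and "S = polynomial_ring {1..n}"
    and "R = polynomial_ring {0..N}"
    and "\<And>i. i \<in> {1..n} \<Longrightarrow> f i \<in> carrier R"
    and "\<And>i. i \<in> {1..n} \<Longrightarrow> homogeneous_of_degree (\<delta> i) (f i)"
    and "\<And>is. distinct is \<Longrightarrow> set is \<subseteq> {1..n} \<Longrightarrow> length is \<le> n - k + 1 \<Longrightarrow>
           regular_sequence R (map f is)"
    and "\<phi> \<in> ring_hom S R"
    and "\<And>c. \<phi> (Const c) = Const c"
    and "\<And>i. i \<in> {1..n} \<Longrightarrow> \<phi> (Var i) = f i"
    and "I = stanley_reisner_ideal {1..n} \<Delta>"
    and "J = genideal R (\<phi> ` I)"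
  shows "(asymptotic_resurgence R J \<le> resurgence R J \<and>
          resurgence R J \<le> resurgence S I \<and>
          resurgence S I \<le> ereal (real (n - k)) \<and>
          (n - k \<noteq> 1 \<longrightarrow> resurgence S I < ereal (real (n - k)))) \<and>
         ((\<forall>i\<in>{1..n}. \<forall>j\<in>{1..n}. \<delta> i = \<delta> j) \<longrightarrow>
          real (n - k) * real (hamming_weight {1..n} \<Delta> 1) / real n
            \<le> Max ((\<lambda>r. real r * real (hamming_weight {1..n} \<Delta> 1)
                      / real (hamming_weight {1..n} \<Delta> r)) ` {1..n - k}) \<and>
          ereal (Max ((\<lambda>r. real r * real (hamming_weight {1..n} \<Delta> 1)
                      / real (hamming_weight {1..n} \<Delta> r)) ` {1..n - k}))
            \<le> asymptotic_resurgence R J)"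
proof -
  interpret M: matroid "{1..n}" \<Delta> by fact
  define SA :: "'l mpoly set" where "SA = polys_in {1..n}"
  define RA :: "'l mpoly set" where "RA = polys_in {0..N}"
  have S: "S = ring_of_type_algebra\<lparr>carrier := SA\<rparr>" and R: "R = ring_of_type_algebra\<lparr>carrier := RA\<rparr>"
    using assms(6,7) by (simp_all add: polynomial_ring_eq SA_def RA_def)
  interpret SC: subring_carrier SA unfolding SA_def by (rule subring_polys_in)
  interpret RC: subring_carrier RA unfolding RA_def by (rule subring_polys_in)
  have fRA: "f i \<in> RA" if "i \<in> {1..n}" for i using assms(8)[OF that] by (simp add: R RC.sub_ring_simps)
  interpret SF: subring_family SA "{1..n}" Var
    by unfold_locales (auto simp: SA_def intro: Var_in_polys)
  interpret RF: subring_family RA "{1..n}" f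
    by unfold_locales (use fRA in auto)
  \<comment> \<open>Taking the variables as the family makes \<open>I\<close> an instance of the
    same description of symbolic powers that is applied to \<open>J\<close>.\<close>
  interpret SM: noetherian_matroid_family "{1..n}" \<Delta> SA Var
  proof unfold_locales
    fix D :: "nat set" and j and r :: "'l mpoly"
    assume D: "D \<subseteq> {1..n}" "j \<in> {1..n} - D" and r: "r \<in> SA" "Var j * r \<in> SF.Q D"
    from D(2) have "j \<notin> D" by blast
    from Var_nonzerodivisor[OF D(1) this r[unfolded SF.Q_def, unfolded SA_def]]
    show "r \<in> SF.Q D" unfolding SF.Q_def unfolding SA_def .
  next
    fix K :: "'l mpoly set" and c
    assume "SC.is_ideal K" "c \<in> SA" "c \<notin> K"
    then show "\<exists>y\<in>SA. SC.prime_ideal (SC.colon K (c * y))"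
      unfolding SA_def by (intro polys_in_prime_colon) auto
  qed
  interpret RM: noetherian_matroid_family "{1..n}" \<Delta> RA f
  proof unfold_locales
    fix D :: "nat set" and j and r :: "'l mpoly"
    assume D: "D \<subseteq> {1..n}" "card D + matroid_rank \<Delta> {1..n} \<le> card {1..n}" "j \<in> {1..n} - D"
      and r: "r \<in> RA" "f j * r \<in> RF.Q D"
    have fin: "finite D" using D(1) finite_subset by blast
    define js where "js = sorted_list_of_set D"
    have js: "distinct js" "set js = D" "length js = card D" using fin by (simp_all add: js_def)
    \<comment> \<open>The list has \<open>card D + 1\<close> entries, at most
      \<open>n - k + 1\<close>. With \<open>j\<close> placed last, its regularity says that
      \<open>f j\<close> is a nonzerodivisor modulo \<open>Q D\<close>.\<close>
    have "regular_sequence R (map f (js @ [j]))"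
      using D js assms(2) by (intro assms(10)) auto
    then have "regular_sequence (ring_of_type_algebra\<lparr>carrier := RA\<rparr>) (map f js @ [f j])"
      by (simp add: R)
    from RC.regular_sequence_snoc_nonzerodivisor[OF this r(1)] show "r \<in> RF.Q D"
      using r(2) js(2) unfolding RF.Q_def by simp
  next
    fix K :: "'l mpoly set" and c
    assume "RC.is_ideal K" "c \<in> RA" "c \<notin> K"
    then show "\<exists>y\<in>RA. RC.prime_ideal (RC.colon K (c * y))"
      unfolding RA_def by (intro polys_in_prime_colon) auto
  qed
  have nul: "M.nullity {1..n} = n - k" using assms(2) by (simp add: M.nullity_def)
  note \<phi> = ring_hom_sub_ring[OF assms(11)[unfolded S R] SC.subring_carrier_axioms]
  have Var_mem: "Var i \<in> SA" if "i \<in> {1..n}" for i using that by (rule SF.f_mem)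
  have I: "I = SM.circuit_ideal"
    unfolding assms(14) stanley_reisner_ideal_def SM.circuit_ideal_def polynomial_ring_eq SA_def[symmetric]
    using SM.prod_circuit_mem by (intro SC.genideal_sub_ring) auto
  have \<phi>_prod: "\<phi> (\<Prod>i\<in>C. Var i) = (\<Prod>i\<in>C. f i)" if "C \<subseteq> {1..n}" for C
  proof -
    have "\<phi> (\<Prod>i\<in>C. Var i) = (\<Prod>i\<in>C. \<phi> (Var i))" using Var_mem that by (intro \<phi>(6)) blast
    also have "\<dots> = (\<Prod>i\<in>C. f i)" using assms(13) that by (intro prod.cong) auto
    finally show ?thesis .
  qed
  have \<phi>_monom: "\<phi> (monom_at Var {1..n} a) = monom_at f {1..n} a" for a
  proof -
    have "\<phi> (Var i ^ m) = f i ^ m" if "i \<in> {1..n}" for i m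
      using \<phi>(6)[of "{..<m}" "\<lambda>_. Var i"] Var_mem[OF that] assms(13)[OF that] by simp
    then show ?thesis
      unfolding monom_at_def using \<phi>(6)[of "{1..n}" "\<lambda>i. Var i ^ a i"] Var_mem SC.power_mem by simp
  qed
  have circ: "C \<subseteq> {1..n}" if "C \<in> circuits {1..n} \<Delta>" for C using that by (simp add: circuits_def)
  have vimage: "SC.is_ideal {p \<in> SA. \<phi> p \<in> K}" if K: "RC.is_ideal K" for K
    unfolding SC.is_ideal_def using RC.is_idealD[OF K] \<phi>(1-3,5) by auto
  have \<phi>I: "\<phi> ` I \<subseteq> RM.circuit_ideal"
  proof -
    have "{\<Prod>i\<in>C. Var i | C. C \<in> circuits {1..n} \<Delta>} \<subseteq> {p \<in> SA. \<phi> p \<in> RM.circuit_ideal}"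
    proof safe
      fix C assume C: "C \<in> circuits {1..n} \<Delta>"
      then show "(\<Prod>i\<in>C. Var i) \<in> SA" by (rule SM.prod_circuit_mem)
      show "\<phi> (\<Prod>i\<in>C. Var i) \<in> RM.circuit_ideal"
        unfolding \<phi>_prod[OF circ[OF C]] RM.circuit_ideal_def using C by (intro RC.ideal_span_base) blast
    qed
    then show ?thesis
      unfolding I SM.circuit_ideal_def
      using SC.ideal_span_least[OF vimage[OF RM.is_ideal_circuit_ideal]] by blast
  qed
  have J: "J = RM.circuit_ideal"
  proof -
    have sub: "\<phi> ` I \<subseteq> RA" using \<phi>I RC.is_idealD(1)[OF RM.is_ideal_circuit_ideal] by blast
    have "J = RC.ideal_span (\<phi> ` I)" unfolding assms(15) R by (rule RC.genideal_sub_ring[OF sub])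
    moreover have "RC.ideal_span (\<phi> ` I) \<subseteq> RM.circuit_ideal"
      by (rule RC.ideal_span_least[OF RM.is_ideal_circuit_ideal \<phi>I])
    moreover have "{\<Prod>i\<in>C. f i | C. C \<in> circuits {1..n} \<Delta>} \<subseteq> \<phi> ` I"
    proof safe
      fix C assume C: "C \<in> circuits {1..n} \<Delta>"
      have "(\<Prod>i\<in>C. Var i) \<in> I" unfolding I SM.circuit_ideal_def using C by (intro SC.ideal_span_base) auto
      then show "(\<Prod>i\<in>C. f i) \<in> \<phi> ` I" using \<phi>_prod[OF circ[OF C]] by (metis imageI)
    qed
    then have "RM.circuit_ideal \<subseteq> RC.ideal_span (\<phi> ` I)"
      unfolding RM.circuit_ideal_def by (rule RC.ideal_span_mono)
    ultimately show ?thesis by blast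
  qed
  have symbS: "symbolic_power S I s = SM.monomial_ideal (M.symbolic_exponents s)" for s
    unfolding S I symbolic_power_sub_ring[OF SC.subring_carrier_axioms SM.is_ideal_circuit_ideal]
    by (rule SM.symb_pow_eq)
  have symbR: "symbolic_power R J s = RM.monomial_ideal (M.symbolic_exponents s)" for s
    unfolding R J symbolic_power_sub_ring[OF RC.subring_carrier_axioms RM.is_ideal_circuit_ideal]
    by (rule RM.symb_pow_eq)
  have powS: "ideal_power S I s = SC.ideal_pow SM.circuit_ideal s" for s
    unfolding S I by (rule SC.ideal_power_sub_ring[OF SM.is_ideal_circuit_ideal])
  have powR: "ideal_power R J s = RC.ideal_pow RM.circuit_ideal s" for s
    unfolding R J by (rule RC.ideal_power_sub_ring[OF RM.is_ideal_circuit_ideal])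
  have \<phi>_pow: "SC.ideal_pow SM.circuit_ideal r \<subseteq> {p \<in> SA. \<phi> p \<in> RC.ideal_pow RM.circuit_ideal r}" for r
  proof (induction r)
    case 0
    show ?case using \<phi>(1) by auto
  next
    case (Suc r)
    show ?case unfolding SC.ideal_pow.simps
    proof (rule SC.ideal_span_least[OF vimage[OF RC.is_ideal_pow[OF RM.is_ideal_circuit_ideal]]], safe)
      fix x y assume xy: "x \<in> SC.ideal_pow SM.circuit_ideal r" "y \<in> SM.circuit_ideal"
      then have mem: "x \<in> SA" "y \<in> SA" "\<phi> x \<in> RC.ideal_pow RM.circuit_ideal r" "\<phi> y \<in> RM.circuit_ideal"
        using Suc \<phi>I SC.is_idealD(1)[OF SM.is_ideal_circuit_ideal] unfolding I by auto
      then show "x * y \<in> SA" by blast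
      show "\<phi> (x * y) \<in> RC.ideal_pow RM.circuit_ideal (Suc r)"
        using RC.ideal_pow_Suc_mem[OF mem(3,4)] \<phi>(3)[OF mem(1,2)] by simp
    qed
  qed
  \<comment> \<open>Symbolic powers of \<open>I\<close> and \<open>J\<close> are generated by
    monomials with the same exponents, and \<open>\<phi>\<close> maps powers of \<open>I\<close>
    into powers of \<open>J\<close>. Hence every containment for \<open>I\<close> passes to
    \<open>J\<close>.\<close>
  have transfer: "symbolic_power R J s \<subseteq> ideal_power R J r" if sub: "symbolic_power S I s \<subseteq> ideal_power S I r" for s r
    unfolding symbR powR RM.monomial_ideal_def
  proof (rule RC.ideal_span_least[OF RC.is_ideal_pow[OF RM.is_ideal_circuit_ideal]], rule image_subsetI)
    fix a assume "a \<in> M.symbolic_exponents s"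
    then have "monom_at Var {1..n} a \<in> symbolic_power S I s"
      unfolding symbS SM.monomial_ideal_def by (intro SC.ideal_span_base) auto
    then have "monom_at Var {1..n} a \<in> SC.ideal_pow SM.circuit_ideal r" using sub unfolding powS by blast
    then show "monom_at f {1..n} a \<in> RC.ideal_pow RM.circuit_ideal r"
      using \<phi>_pow[of r] \<phi>_monom by auto
  qed
  have c1: "1 \<le> M.nullity {1..n}" using nul assms(4) by simp
  have a2: "resurgence R J \<le> resurgence S I"
    using transfer by (intro resurgence_mono) blast
  have bound: "resurgence S I \<le> ereal \<rho>"
    if "\<And>s r. \<not> SM.monomial_ideal (M.symbolic_exponents s) \<subseteq> SC.ideal_pow SM.circuit_ideal r \<Longrightarrow> real s \<le> \<rho> * real r"
    for \<rho>
    using that unfolding symbS[symmetric] powS[symmetric] by (rule resurgence_le)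
  have a3: "resurgence S I \<le> ereal (real (n - k))"
    using SM.not_subset_ideal_pow_bound(1)[OF _ c1] unfolding nul by (intro bound)
  \<comment> \<open>For \<open>n - k = 1\<close> there is a single circuit, \<open>I\<close> is
    principal, and the supremum of \<open>s / r\<close> over \<open>s < r\<close> equals one; so
    strictness is confined to larger values.\<close>
  have a4: "resurgence S I < ereal (real (n - k))" if "n - k \<noteq> 1"
  proof -
    have two: "2 \<le> M.nullity {1..n}" using that c1 nul by simp
    have "resurgence S I \<le> ereal (max (real (n - k) * (real n - 1) / real n) (real (n - k) - 1))"
      using SM.not_subset_ideal_pow_bound(2)[OF _ c1 two] unfolding nul by (intro bound) simp
    moreover have "max (real (n - k) * (real n - 1) / real n) (real (n - k) - 1) < real (n - k)"
    proof -
      define c x where "c = real (n - k)" and "x = real n"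
      have "0 < c" "0 < x" using assms(4) by (simp_all add: c_def x_def)
      then have "c * (x - 1) / x < c" by (simp add: divide_less_eq right_diff_distrib)
      then have "max (c * (x - 1) / x) (c - 1) < c" by simp
      then show ?thesis unfolding c_def x_def .
    qed
    then have "ereal (max (real (n - k) * (real n - 1) / real n) (real (n - k) - 1)) < ereal (real (n - k))"
      by (simp only: less_ereal.simps)
    ultimately show ?thesis by (meson le_less_trans)
  qed
  have b: "real (n - k) * real (hamming_weight {1..n} \<Delta> 1) / real n
            \<le> Max ((\<lambda>r. real r * real (hamming_weight {1..n} \<Delta> 1)
                      / real (hamming_weight {1..n} \<Delta> r)) ` {1..n - k}) \<and>
          ereal (Max ((\<lambda>r. real r * real (hamming_weight {1..n} \<Delta> 1)
                      / real (hamming_weight {1..n} \<Delta> r)) ` {1..n - k}))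
            \<le> asymptotic_resurgence R J"
    if same: "\<forall>i\<in>{1..n}. \<forall>j\<in>{1..n}. \<delta> i = \<delta> j"
  proof
    define d where "d = hamming_weight {1..n} \<Delta>"
    define Rs where "Rs = (\<lambda>r. real r * real (d 1) / real (d r)) ` {1..n - k}"
    have Rs: "finite Rs" "Rs \<noteq> {}" using assms(4) by (auto simp: Rs_def)
    have d_pos: "0 < d r" if "r \<in> {1..n - k}" for r
      using M.hamming_weight_ge[of r] that nul by (simp add: d_def)
    \<comment> \<open>The first inequality of (b) comes from the term \<open>r = n - k\<close>,
      since the whole ground set has this nullity.\<close>
    have "d (n - k) \<le> n" using M.hamming_weight_le[of "{1..n}" "n - k"] nul by (simp add: d_def)
    then have "real (n - k) * real (d 1) / real n \<le> real (n - k) * real (d 1) / real (d (n - k))"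
      using d_pos[of "n - k"] assms(4) by (intro divide_left_mono) auto
    also have "\<dots> \<le> Max Rs"
      unfolding Rs_def using assms(4) by (intro Max_ge finite_imageI imageI) auto
    finally show "real (n - k) * real (hamming_weight {1..n} \<Delta> 1) / real n
            \<le> Max ((\<lambda>r. real r * real (hamming_weight {1..n} \<Delta> 1)
                      / real (hamming_weight {1..n} \<Delta> r)) ` {1..n - k})"
      unfolding Rs_def d_def .
    define e where "e = \<delta> 1"
    have hom: "homogeneous_of_degree e (f i)" if "i \<in> {1..n}" for i
    proof -
      have "1 \<in> {1..n}" using assms(4) by simp
      then have "\<delta> i = e" unfolding e_def using same that by blast
      then show ?thesis using assms(9)[OF that] by simp
    qed
    \<comment> \<open>Each \<open>f i\<close> is a nonzerodivisor modulo the zero ideal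
      \<open>Q {}\<close>.\<close>
    have f_nz: "f i \<noteq> 0" if i: "i \<in> {1..n}" for i
    proof
      assume "f i = 0"
      then have "1 \<in> RF.Q {}"
        using RM.nonzerodivisor[of "{}" i 1] i assms(2,4) RC.ideal_span_zero by (simp add: RF.Q_def)
      then show False by (simp add: RF.Q_def RC.ideal_span_empty)
    qed
    \<comment> \<open>In degree zero, \<open>f 1\<close> would be a nonzero constant and generate
      the unit ideal, whereas a regular sequence generates a proper ideal. Positivity is needed to
      cancel \<open>e\<close> when degrees are compared.\<close>
    have e_pos: "0 < e"
    proof (rule ccontr)
      assume "\<not> 0 < e"
      then have hom0: "homogeneous_of_degree 0 (f 1)" using hom[of 1] assms(4) by simp
      have one: "1 \<in> {1..n}" using assms(4) by simp
      have "m = 0" if "m \<in> keys (f 1)" for m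
      proof -
        have "mdeg m = 0" using hom0 that by (simp add: homogeneous_iff)
        then have "\<forall>i\<in>keys m. lookup m i = 0" by (simp add: mdeg_def)
        then show "m = 0" by (intro poly_mapping_eqI) (metis in_keys_iff lookup_zero)
      qed
      then have f1: "f 1 = single 0 (lookup (f 1) 0)"
        by (intro poly_mapping_eqI) (auto simp: lookup_single when_def in_keys_iff)
      define c where "c = lookup (f 1) 0"
      have c: "c \<noteq> 0" "f 1 = single 0 c" using f1 f_nz[OF one] by (auto simp: c_def)
      have gen: "genideal R (set (map f [1])) = RC.ideal_span {f 1}"
        using RC.genideal_sub_ring[of "{f 1}"] fRA[OF one] by (simp add: R)
      have "single 0 (1 / c) * f 1 \<in> RC.ideal_span {f 1}"
        using fRA[OF one] unfolding RA_def
        by (intro subring_carrier.is_idealD(4)[OF subring_polys_in subring_carrier.is_ideal_span[OF subring_polys_in]]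
            single_in_polys subring_carrier.ideal_span_base[OF subring_polys_in]) auto
      moreover have "single 0 (1 / c) * f 1 = 1" using c by (simp add: mult_single)
      ultimately have "1 \<in> RC.ideal_span {f 1}" by simp
      then have "RC.ideal_span {f 1} = RA"
        using RC.is_idealD(1,5)[OF RC.is_ideal_span[of "{f 1}"]] RC.is_idealD(5)[OF RC.is_ideal_span[of "{f 1}"], of _ 1]
          fRA[OF one] by auto
      moreover have "regular_sequence R (map f [1])" using one by (intro assms(10)) auto
      ultimately show False using gen unfolding regular_sequence_def by (simp add: R RC.sub_ring_simps)
    qed
    have idg: "RC.is_ideal (initial_degree_ge q {0..N})" for q
      unfolding RA_def by (rule is_ideal_initial_degree_ge)
    have Jdeg: "RM.circuit_ideal \<subseteq> initial_degree_ge (d 1 * e) {0..N}"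
      unfolding RM.circuit_ideal_def
    proof (rule RC.ideal_span_least[OF idg], safe)
      fix C assume C: "C \<in> circuits {1..n} \<Delta>"
      have "homogeneous_of_degree (\<Sum>i\<in>C. e) (\<Prod>i\<in>C. f i)"
        using hom circ[OF C] by (intro homogeneous_prod) auto
      then have "homogeneous_of_degree (card C * e) (\<Prod>i\<in>C. f i)" by simp
      moreover have "d 1 * e \<le> card C * e"
        using M.hamming_weight_le_card_circuit[OF C] by (simp add: d_def)
      ultimately show "(\<Prod>i\<in>C. f i) \<in> initial_degree_ge (d 1 * e) {0..N}"
        using RM.prod_circuit_mem[OF C] by (simp add: initial_degree_ge_def homogeneous_iff RA_def)
    qed
    \<comment> \<open>The monomial with exponent \<open>m * t\<close> on a set of nullity
      \<open>r\<close> and size \<open>d r\<close> lies in the symbolic power. Its degree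
      \<open>m * t * d r * e\<close> is below the initial degree bound
      \<open>q * t * d 1 * e\<close> of the ordinary power.\<close>
    have notin: "\<not> symbolic_power R J (m * r * t) \<subseteq> ideal_power R J (q * t)"
      if r: "r \<in> {1..n - k}" and t: "1 \<le> t" and less: "m * d r < q * d 1" for m r q t
    proof
      assume sub: "symbolic_power R J (m * r * t) \<subseteq> ideal_power R J (q * t)"
      obtain U where U: "U \<subseteq> {1..n}" "M.nullity U = r" "card U = d r"
        using M.hamming_weight_attained[of r] r nul unfolding d_def by auto
      define a where "a i = m * t * indicator U i" for i
      have "a \<in> M.symbolic_exponents (m * r * t)"
        using M.indicator_symbolic_exponents[OF U(1), of "m * t"] U(2) by (simp add: a_def[abs_def] mult_ac)
      then have "monom_at f {1..n} a \<in> symbolic_power R J (m * r * t)"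
        unfolding symbR RM.monomial_ideal_def by (intro RC.ideal_span_base) auto
      then have "monom_at f {1..n} a \<in> RC.ideal_pow RM.circuit_ideal (q * t)" using sub powR by blast
      then have mem: "monom_at f {1..n} a \<in> initial_degree_ge (q * t * (d 1 * e)) {0..N}"
        using ideal_pow_initial_degree[OF Jdeg, of "q * t", folded RA_def] by blast
      have "homogeneous_of_degree (\<Sum>i\<in>{1..n}. a i * e) (monom_at f {1..n} a)"
        unfolding monom_at_def using hom by (intro homogeneous_prod homogeneous_power)
      moreover have "(\<Sum>i\<in>{1..n}. a i * e) = m * t * d r * e"
      proof -
        have "(\<Sum>i\<in>{1..n}. a i * e) = m * t * (\<Sum>i\<in>{1..n}. indicator U i) * e"
          unfolding a_def sum_distrib_left sum_distrib_right ..
        also have "(\<Sum>i\<in>{1..n}. indicator U i) = card ({1..n} \<inter> U)" by (simp add: indicator_def Int_def)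
        also have "{1..n} \<inter> U = U" using U(1) by blast
        finally show ?thesis using U(3) by simp
      qed
      ultimately have hm: "homogeneous_of_degree (m * t * d r * e) (monom_at f {1..n} a)" by simp
      have "monom_at f {1..n} a \<noteq> 0" unfolding monom_at_def using f_nz by simp
      then have "lead (monom_at f {1..n} a) \<in> keys (monom_at f {1..n} a)" by (rule lead_in_keys)
      then have "q * t * (d 1 * e) \<le> m * t * d r * e"
        using hm mem unfolding homogeneous_iff initial_degree_ge_def by fastforce
      then have "(q * d 1) * (t * e) \<le> (m * d r) * (t * e)" by (simp add: mult_ac)
      then show False using less t e_pos by simp
    qed
    have lower: "ereal (real r * real (d 1) / real (d r)) \<le> asymptotic_resurgence R J"
      if r: "r \<in> {1..n - k}" for r
    proof -
      have d1: "0 < d 1" using d_pos[of 1] assms(4) by simp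
      have dr: "0 < d r" using d_pos[OF r] .
      have "(\<lambda>j. real r * real (d 1) / real (d r) - real r / real (d r) / real j)
          \<longlonglongrightarrow> real r * real (d 1) / real (d r) - 0"
        by (intro tendsto_diff tendsto_const lim_const_over_n)
      then have lim: "(\<lambda>j. ereal (real r * real (d 1) / real (d r) - real r / real (d r) / real j))
          \<longlonglongrightarrow> ereal (real r * real (d 1) / real (d r))"
        by simp
      have "ereal (real r * real (d 1) / real (d r) - real r / real (d r) / real j) \<le> asymptotic_resurgence R J"
        if j: "2 \<le> j" for j
      proof -
        \<comment> \<open>With \<open>q = d r * j\<close>, this is the largest \<open>m\<close> for
          which \<open>m * d r < q * d 1\<close>. The ratios \<open>m * r / q\<close> tend to
          \<open>r * d 1 / d r\<close> as \<open>j\<close> grows, and \<open>j \<ge> 2\<close> keeps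
          \<open>m\<close> positive.\<close>
        define m where "m = d 1 * j - 1"
        have dj: "2 \<le> d 1 * j" using j d1 mult_le_mono[of 1 "d 1" 2 j] by simp
        then have m: "1 \<le> m" by (simp add: m_def)
        have "m + 1 = d 1 * j" using dj by (simp add: m_def)
        then have m_real: "real m = real (d 1) * real j - 1" by (metis add_diff_cancel_right' of_nat_1 of_nat_add of_nat_mult)
        have "m * d r < (d 1 * j) * d r" using dj dr by (simp add: m_def)
        then have less: "m * d r < (d r * j) * d 1" by (simp add: mult_ac)
        have "\<forall>\<^sub>F t in sequentially. \<not> symbolic_power R J (m * r * t) \<subseteq> ideal_power R J (d r * j * t)"
          using eventually_ge_at_top[of 1] by eventually_elim (rule notin[OF r _ less])
        moreover have "1 \<le> m * r" "1 \<le> d r * j" using m r dr j by (simp_all add: Suc_le_eq)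
        ultimately have "ereal (real (m * r) / real (d r * j)) \<le> asymptotic_resurgence R J"
          unfolding asymptotic_resurgence_def by (intro Sup_upper) blast
        moreover have "real (m * r) / real (d r * j) = real r * real (d 1) / real (d r) - real r / real (d r) / real j"
          using dr j by (simp add: m_real field_simps)
        ultimately show ?thesis by simp
      qed
      then show ?thesis by (intro Lim_bounded[OF lim, of 2]) auto
    qed
    have "Max Rs \<in> Rs" using Rs by (rule Max_in)
    then have "ereal (Max Rs) \<le> asymptotic_resurgence R J" using lower unfolding Rs_def by auto
    then show "ereal (Max ((\<lambda>r. real r * real (hamming_weight {1..n} \<Delta> 1)
                      / real (hamming_weight {1..n} \<Delta> r)) ` {1..n - k}))
            \<le> asymptotic_resurgence R J"
      unfolding Rs_def d_def .
  qed
  show ?thesis using asymptotic_resurgence_le_resurgence a2 a3 a4 b by blast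
qed

end
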